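(* Let orthonormal functions $\phi_0=1,\phi_1,\phi_2,\ldots$ be dense in $L^2_w(\Omega)$. Let the function $g$ satisfy $\int_\Omega|g(x)\phi_i(x)|^2\,w(x)\,dx<\infty$ for all $i=0,1,\ldots$, and let $M_n[g]$ be the $(n+1)\times(n+1)$ matrix with elements $[M_n[g]]_{i,j}=\langle\phi_i,g\,\phi_j\rangle$, $i,j=0,1,\ldots,n$. Then for bounded and continuous $f$, $$\begin{bmatrix}f(M_n[g])&0_{(n+1)\times\infty}\\0_{\infty\times(n+1)}&0_\infty\end{bmatrix}=f\left(\begin{bmatrix}M_n[g]&0_{(n+1)\times\infty}\\0_{\infty\times(n+1)}&0_\infty\end{bmatrix}\right)\xrightarrow{\;s\;}f(M_\infty[g]),$$ and, as $n\to\infty$, $$e_0^\top f(M_n[g])\,e_0\to e_0^\top f(M_\infty[g])\,e_0=\langle 1,f(M[g])\,1\rangle=\int_\Omega f(g(x))\,w(x)\,dx.$$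
   Context: $\Omega\subset\mathbb{R}^d$, $w:\Omega\to[0,\infty)$ with $\int_\Omega w(x)\,dx=1$, $g:\Omega\to\mathbb{R}$ is measurable and $f:\mathbb{R}\to\mathbb{R}$. $L^2_w(\Omega)$ is the Hilbert space with inner product $\langle\phi,\psi\rangle=\int_\Omega\overline{\phi(x)}\,\psi(x)\,w(x)\,dx$ and norm $\|\phi\|=\sqrt{\langle\phi,\phi\rangle}$. Orthonormal functions being dense means that their linear span is dense, i.e. they form an orthonormal basis. $M[g]$ is the maximal multiplication operator $\phi\mapsto g\phi$ with domain $\{\phi:\|g\phi\|<\infty\}$, which is self-adjoint. $M_\infty[g]$ is the infinite matrix $[\langle\phi_i,g\,\phi_j\rangle]_{i,j\ge0}$, regarded as an operator on $\ell^2$ (the absolutely square-summable sequences, indexed from $0$) with domain $\{v\in\ell^2:\|M_\infty[g]v\|<\infty\}$; it is taken as a known fact that, under the stated square-integrability condition on $g$, $M_\infty[g]$ is self-adjoint and its domain is isomorphic with the domain of $M[g]$. Functions of self-adjoint operators and matrices are defined through the spectral representation. $e_0$ is the vector with $1$ in component $0$ and $0$ elsewhere, in $\mathbb{C}^{n+1}$ or $\ell^2$. $0_{n\times m}$ and $0_\infty$ denote zero matrices ($0_\infty$ being infinite). $\xrightarrow{\;s\;}$ denotes strong operator convergence on $\ell^2$ as $n\to\infty$.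
   Formalization: The displayed equality is false if f(0)≠0 (e.g. f=1); it is proved as stated when f(0)=0, and in general with f(0) times the identity as lower block; both sides converge strongly for every f. Self-adjointness of M_∞[g], which can fail, is an explicit assumption. *)

theory Defs
  imports "HOL-Analysis.Analysis"
begin

text \<open>
  All Hilbert spaces are complex spaces \<open>L\<^sup>2(M)\<close> of functions, with equality understood
  almost everywhere: \<open>\<complex>\<^sup>n\<^sup>+\<^sup>1\<close> is \<open>L\<^sup>2\<close> of the counting measure on \<open>{..n}\<close>, the sequence space
  \<open>\<ell>\<^sup>2\<close> is \<open>L\<^sup>2\<close> of the counting measure on the natural numbers, and the weighted space is
  \<open>L\<^sup>2\<close> of Lebesgue measure on \<open>\<Omega>\<close> with density \<open>w\<close>.
\<close>

definition L2_space :: "'a measure \<Rightarrow> ('a \<Rightarrow> complex) set" where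
  "L2_space M = {u \<in> borel_measurable M. integrable M (\<lambda>x. (cmod (u x))\<^sup>2)}"

definition ip :: "'a measure \<Rightarrow> ('a \<Rightarrow> complex) \<Rightarrow> ('a \<Rightarrow> complex) \<Rightarrow> complex" where
  "ip M u v = (LINT x|M. cnj (u x) * v x)"

definition nrm :: "'a measure \<Rightarrow> ('a \<Rightarrow> complex) \<Rightarrow> real" where
  "nrm M u = sqrt (Re (ip M u u))"

abbreviation Cvec :: "nat \<Rightarrow> nat measure" where
  "Cvec n \<equiv> count_space {..n}"

abbreviation ell2 :: "nat measure" where
  "ell2 \<equiv> count_space UNIV"

definition weighted :: "'a::euclidean_space set \<Rightarrow> ('a \<Rightarrow> real) \<Rightarrow> 'a measure" where
  "weighted \<Omega> w = density (lebesgue_on \<Omega>) (\<lambda>x. ennreal (w x))"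

definition dense_in_L2 :: "'a measure \<Rightarrow> ('a \<Rightarrow> complex) set \<Rightarrow> bool" where
  "dense_in_L2 M S \<longleftrightarrow> S \<subseteq> L2_space M \<and>
     (\<forall>u\<in>L2_space M. \<forall>\<epsilon>>0. \<exists>v\<in>S. nrm M (\<lambda>x. u x - v x) < \<epsilon>)"

definition lin_span :: "(nat \<Rightarrow> 'a \<Rightarrow> complex) \<Rightarrow> ('a \<Rightarrow> complex) set" where
  "lin_span \<phi> = {(\<lambda>x. \<Sum>i<n. c i * \<phi> i x) | n c. True}"

definition orthonormal_seq :: "'a measure \<Rightarrow> (nat \<Rightarrow> 'a \<Rightarrow> complex) \<Rightarrow> bool" where
  "orthonormal_seq M \<phi> \<longleftrightarrow> (\<forall>i. \<phi> i \<in> L2_space M) \<and>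
     (\<forall>i j. ip M (\<phi> i) (\<phi> j) = (if i = j then 1 else 0))"

text \<open>A possibly unbounded operator is a pair of its domain and its action on that domain.\<close>

type_synonym 'a l2op = "('a \<Rightarrow> complex) set \<times> (('a \<Rightarrow> complex) \<Rightarrow> 'a \<Rightarrow> complex)"

definition op_eq :: "'a measure \<Rightarrow> 'a l2op \<Rightarrow> 'a l2op \<Rightarrow> bool" where
  "op_eq M A B \<longleftrightarrow> fst A = fst B \<and> (\<forall>u\<in>fst A. AE x in M. snd A u x = snd B u x)"

text \<open>
  The last conjunct says that the graph of the adjoint, i.e. the set of all \<open>(u, z)\<close> with
  \<open>\<langle>u, A v\<rangle> = \<langle>z, v\<rangle>\<close> for every \<open>v\<close> in the domain of \<open>A\<close>, coincides with the graph of \<open>A\<close>.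
\<close>

definition self_adjoint :: "'a measure \<Rightarrow> 'a l2op \<Rightarrow> bool" where
  "self_adjoint M A \<longleftrightarrow>
     dense_in_L2 M (fst A) \<and> snd A ` fst A \<subseteq> L2_space M \<and>
     (\<forall>u\<in>L2_space M. \<forall>z\<in>L2_space M.
        (\<forall>v\<in>fst A. ip M u (snd A v) = ip M z v) \<longleftrightarrow>
        (u \<in> fst A \<and> (AE x in M. snd A u x = z x)))"

definition strong_conv :: "'a measure \<Rightarrow> (nat \<Rightarrow> 'a l2op) \<Rightarrow> 'a l2op \<Rightarrow> bool" where
  "strong_conv M B A \<longleftrightarrow>
     (\<forall>n. fst (B n) = L2_space M) \<and> fst A = L2_space M \<and>
     (\<forall>u\<in>L2_space M. (\<lambda>n. nrm M (\<lambda>x. snd (B n) u x - snd A u x)) \<longlonglongrightarrow> 0)"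

text \<open>
  Projection-valued measures on the Borel sets of the real line. Linearity of each \<open>E S\<close>
  and \<open>E (S \<inter> S') = E S E S'\<close> (almost everywhere) are consequences.
\<close>

definition projection_valued_measure ::
  "'a measure \<Rightarrow> (real set \<Rightarrow> ('a \<Rightarrow> complex) \<Rightarrow> 'a \<Rightarrow> complex) \<Rightarrow> bool" where
  "projection_valued_measure M E \<longleftrightarrow>
     (\<forall>S\<in>sets borel. \<forall>u\<in>L2_space M.
        E S u \<in> L2_space M \<and> (AE x in M. E S (E S u) x = E S u x) \<and>
        (\<forall>v\<in>L2_space M. ip M u (E S v) = ip M (E S u) v)) \<and>
     (\<forall>u\<in>L2_space M. AE x in M. E UNIV u x = u x) \<and>
     (\<forall>F :: nat \<Rightarrow> real set. range F \<subseteq> sets borel \<longrightarrow> disjoint_family F \<longrightarrow>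
        (\<forall>u\<in>L2_space M. \<forall>v\<in>L2_space M.
           (\<lambda>k. ip M u (E (F k) v)) sums ip M u (E (\<Union>k. F k) v)))"

definition scalar_measure ::
  "'a measure \<Rightarrow> (real set \<Rightarrow> ('a \<Rightarrow> complex) \<Rightarrow> 'a \<Rightarrow> complex) \<Rightarrow> ('a \<Rightarrow> complex) \<Rightarrow> real measure" where
  "scalar_measure M E u = measure_of UNIV (sets borel) (\<lambda>S. ennreal (Re (ip M u (E S u))))"

text \<open>
  \<open>spectral_integral M E f B\<close> says \<open>B = \<integral> f dE\<close>: the domain of \<open>B\<close> consists of the \<open>u\<close> with
  \<open>\<integral> \<bar>f\<bar>\<^sup>2 d\<langle>u, E u\<rangle> < \<infinity>\<close>, and \<open>B\<close> is the linear operator with \<open>\<langle>u, B u\<rangle> = \<integral> f d\<langle>u, E u\<rangle>\<close>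
  there. By polarization the quadratic form determines \<open>B\<close>.
\<close>

definition spectral_integral ::
  "'a measure \<Rightarrow> (real set \<Rightarrow> ('a \<Rightarrow> complex) \<Rightarrow> 'a \<Rightarrow> complex) \<Rightarrow> (real \<Rightarrow> real) \<Rightarrow> 'a l2op \<Rightarrow> bool" where
  "spectral_integral M E f B \<longleftrightarrow>
     fst B = {u \<in> L2_space M. integrable (scalar_measure M E u) (\<lambda>t. (f t)\<^sup>2)} \<and>
     (\<forall>u\<in>fst B. snd B u \<in> L2_space M \<and>
        ip M u (snd B u) = complex_of_real (LINT t|scalar_measure M E u. f t)) \<and>
     (\<forall>u\<in>fst B. \<forall>v\<in>fst B. \<forall>a b. AE x in M.
        snd B (\<lambda>y. a * u y + b * v y) x = a * snd B u x + b * snd B v x)"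

definition spectral_measure ::
  "'a measure \<Rightarrow> 'a l2op \<Rightarrow> (real set \<Rightarrow> ('a \<Rightarrow> complex) \<Rightarrow> 'a \<Rightarrow> complex) \<Rightarrow> bool" where
  "spectral_measure M A E \<longleftrightarrow>
     projection_valued_measure M E \<and> spectral_integral M E (\<lambda>t. t) A"

text \<open>
  \<open>f(A) = \<integral> f dE\<close> for the spectral measure \<open>E\<close> of a self-adjoint \<open>A\<close>. The choice only fixes
  representatives of almost-everywhere classes and irrelevant values off the domain.
\<close>

definition op_fun :: "'a measure \<Rightarrow> 'a l2op \<Rightarrow> (real \<Rightarrow> real) \<Rightarrow> 'a l2op" where
  "op_fun M A f = (SOME B. \<exists>E. spectral_measure M A E \<and> spectral_integral M E f B)"

definition mult_op :: "'a measure \<Rightarrow> ('a \<Rightarrow> real) \<Rightarrow> 'a l2op" where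
  "mult_op M g =
     ({u \<in> L2_space M. (\<lambda>x. complex_of_real (g x) * u x) \<in> L2_space M},
      \<lambda>u x. complex_of_real (g x) * u x)"

text \<open>
  The maximal operator of the matrix \<open>[A i j]\<close> with \<open>i, j \<in> I\<close>; entries with an index outside
  \<open>I\<close> play no role. For \<open>I = {..n}\<close> the domain is the whole space.
\<close>

definition mat_op :: "nat set \<Rightarrow> (nat \<Rightarrow> nat \<Rightarrow> complex) \<Rightarrow> nat l2op" where
  "mat_op I A =
     ({v \<in> L2_space (count_space I).
         (\<forall>i\<in>I. (\<lambda>j. A i j * v j) summable_on I) \<and>
         (\<lambda>i. \<Sum>\<^sub>\<infinity>j\<in>I. A i j * v j) \<in> L2_space (count_space I)},
      \<lambda>v i. \<Sum>\<^sub>\<infinity>j\<in>I. A i j * v j)"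

definition basis_vec :: "nat \<Rightarrow> nat \<Rightarrow> complex" where
  "basis_vec j = (\<lambda>i. if i = j then 1 else 0)"

definition matrix_of :: "nat l2op \<Rightarrow> nat \<Rightarrow> nat \<Rightarrow> complex" where
  "matrix_of B i j = snd B (basis_vec j) i"

text \<open>
  The infinite block-diagonal matrix with upper left block \<open>[A i j]\<close>, \<open>i, j \<le> n\<close>, and
  lower right block \<open>c\<close> times the infinite identity matrix (\<open>c = 0\<close>: padding with zeros).
  Functions of such operators act blockwise, so a zero lower block turns into \<open>f 0\<close> times
  the identity, which vanishes only if \<open>f 0 = 0\<close>.
\<close>

definition block :: "nat \<Rightarrow> (nat \<Rightarrow> nat \<Rightarrow> complex) \<Rightarrow> complex \<Rightarrow> nat \<Rightarrow> nat \<Rightarrow> complex" where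
  "block n A c i j = (if i \<le> n \<and> j \<le> n then A i j else if i = j then c else 0)"

definition gmat :: "'a measure \<Rightarrow> (nat \<Rightarrow> 'a \<Rightarrow> complex) \<Rightarrow> ('a \<Rightarrow> real) \<Rightarrow> nat \<Rightarrow> nat \<Rightarrow> complex" where
  "gmat M \<phi> g i j = ip M (\<phi> i) (\<lambda>x. complex_of_real (g x) * \<phi> j x)"

abbreviation M_fin :: "'a measure \<Rightarrow> (nat \<Rightarrow> 'a \<Rightarrow> complex) \<Rightarrow> ('a \<Rightarrow> real) \<Rightarrow> nat \<Rightarrow> nat l2op" where
  "M_fin M \<phi> g n \<equiv> mat_op {..n} (gmat M \<phi> g)"

abbreviation M_inf :: "'a measure \<Rightarrow> (nat \<Rightarrow> 'a \<Rightarrow> complex) \<Rightarrow> ('a \<Rightarrow> real) \<Rightarrow> nat l2op" where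
  "M_inf M \<phi> g \<equiv> mat_op UNIV (gmat M \<phi> g)"

end

theory Submission
  imports Defs
begin

text \<open>
  Why the theorem holds. In the basis \<open>\<phi>\<close> the multiplication operator \<open>M[g]\<close> becomes the matrix
  \<open>M\<^sub>\<infinity>[g]\<close>: the coefficient map is unitary by the Riesz-Fischer theorem, a direct computation shows
  that \<open>M\<^sub>\<infinity>[g]\<close> extends the conjugated \<open>M[g]\<close>, and since \<open>M\<^sub>\<infinity>[g]\<close> is symmetric, pairing it with
  functions on which \<open>g\<close> is bounded shows that the extension is not proper (\<open>represents_M_inf\<close>).
  Hence \<open>f(M\<^sub>\<infinity>[g])\<close> is unitarily equivalent to multiplication by \<open>f \<circ> g\<close>, and its entry at
  \<open>\<phi>\<^sub>0 = 1\<close> is the integral of \<open>f \<circ> g\<close> against the weight.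

  Strong convergence starts from resolvents. The vectors \<open>x\<^sub>n = (A\<^sub>n - z)\<inverse> u\<close>, where \<open>A\<^sub>n\<close> is the
  zero-padded section, are bounded, so every subsequence has a further one that converges in each
  coordinate. The rows of \<open>M\<^sub>\<infinity>[g]\<close> are square-summable, which allows passing to the limit in each
  row of \<open>(A\<^sub>n - z) x\<^sub>n = u\<close>; the limit \<open>x\<close> lies in the maximal domain of \<open>M\<^sub>\<infinity>[g]\<close> and is therefore
  \<open>(M\<^sub>\<infinity>[g] - z)\<inverse> u\<close>. The identity \<open>\<parallel>x\<parallel>\<^sup>2 = Im \<langle>u, x\<rangle> / Im z\<close>, valid for all these resolvents, turns
  weak convergence into norm convergence (\<open>converges_resolvent\<close>). The functions \<open>f\<close> for which
  \<open>f(A\<^sub>n)\<close> converges strongly form a uniformly closed algebra, which by the Stone-Weierstrass theorem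
  contains every continuous function of compact support (\<open>converges_compact_support\<close>). For bounded
  continuous \<open>f\<close> a cutoff \<open>\<kappa>\<close> is split off: \<open>\<parallel>f(A\<^sub>n) (1 - \<kappa>(A\<^sub>n)) u\<parallel>\<close> is at most a multiple of
  \<open>\<parallel>(1 - \<kappa>(A\<^sub>n)) u\<parallel>\<close>, which converges to a quantity that is small for a wide cutoff
  (\<open>converges_bounded_continuous\<close>).

  All of this presupposes that \<open>f(A)\<close> is computable from some convenient spectral measure, although
  \<open>op_fun\<close> allows any spectral measure of \<open>A\<close>. The core is \<open>scalar_measure_unique\<close>: if \<open>x\<close> lies in
  the range of \<open>E[c,d]\<close>, then \<open>\<parallel>(A - c)\<^sup>k x\<parallel> \<le> (d - c)\<^sup>k \<parallel>x\<parallel>\<close>, whereas on the range of \<open>F[e,\<infinity>)\<close> the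
  operator \<open>A - c\<close> increases norms at least by the factor \<open>e - c\<close>; for \<open>e > d\<close> the growth rates conflict, so
  \<open>F[e,\<infinity>) E[c,d] = 0\<close>. Two spectral measures \<open>E\<close> and \<open>F\<close> of \<open>A\<close> thus agree on half-lines.
\<close>

section \<open>The space of square-integrable functions\<close>

lemma L2_spaceI:
  "u \<in> borel_measurable M \<Longrightarrow> integrable M (\<lambda>x. (cmod (u x))\<^sup>2) \<Longrightarrow> u \<in> L2_space M"
  by (simp add: L2_space_def)

lemma L2_measurable: "u \<in> L2_space M \<Longrightarrow> u \<in> borel_measurable M"
  by (simp add: L2_space_def)

lemma L2_integrable_sq: "u \<in> L2_space M \<Longrightarrow> integrable M (\<lambda>x. (cmod (u x))\<^sup>2)"
  by (simp add: L2_space_def)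

lemma L2_dominated:
  assumes "u \<in> borel_measurable M" "integrable M F" "AE x in M. (cmod (u x))\<^sup>2 \<le> F x"
  shows "u \<in> L2_space M"
proof (rule L2_spaceI[OF assms(1)])
  show "integrable M (\<lambda>x. (cmod (u x))\<^sup>2)"
    using assms by (intro Bochner_Integration.integrable_bound[OF assms(2)]) auto
qed

lemma L2_zero: "(\<lambda>x. 0) \<in> L2_space M"
  by (simp add: L2_space_def)

lemma L2_scale: "u \<in> L2_space M \<Longrightarrow> (\<lambda>x. c * u x) \<in> L2_space M"
  by (auto simp: L2_space_def norm_mult power_mult_distrib)

lemma L2_add:
  assumes "u \<in> L2_space M" "v \<in> L2_space M"
  shows "(\<lambda>x. u x + v x) \<in> L2_space M"
proof (rule L2_dominated)
  show "integrable M (\<lambda>x. 2 * (cmod (u x))\<^sup>2 + 2 * (cmod (v x))\<^sup>2)"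
    using assms by (auto simp: L2_space_def)
  have "(cmod (a + b))\<^sup>2 \<le> 2 * (cmod a)\<^sup>2 + 2 * (cmod b)\<^sup>2" for a b
  proof -
    have "(cmod (a + b))\<^sup>2 \<le> (cmod a + cmod b)\<^sup>2"
      by (simp add: norm_triangle_ineq power_mono)
    also have "\<dots> \<le> 2 * (cmod a)\<^sup>2 + 2 * (cmod b)\<^sup>2"
      using zero_le_power2[of "cmod a - cmod b"] by (simp add: power2_eq_square algebra_simps)
    finally show ?thesis .
  qed
  then show "AE x in M. (cmod (u x + v x))\<^sup>2 \<le> 2 * (cmod (u x))\<^sup>2 + 2 * (cmod (v x))\<^sup>2"
    by simp
  show "(\<lambda>x. u x + v x) \<in> borel_measurable M"
    using assms by (auto simp: L2_space_def)
qed

lemma L2_lincomb: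
  "u \<in> L2_space M \<Longrightarrow> v \<in> L2_space M \<Longrightarrow> (\<lambda>x. a * u x + b * v x) \<in> L2_space M"
  by (intro L2_add L2_scale)

lemma L2_diff:
  "u \<in> L2_space M \<Longrightarrow> v \<in> L2_space M \<Longrightarrow> (\<lambda>x. u x - v x) \<in> L2_space M"
  using L2_lincomb[of u M v 1 "-1"] by simp

lemma L2_sum:
  "(\<And>i. i \<in> I \<Longrightarrow> u i \<in> L2_space M) \<Longrightarrow> (\<lambda>x. \<Sum>i\<in>I. u i x) \<in> L2_space M"
  by (induction I rule: infinite_finite_induct) (auto intro: L2_add L2_zero)

lemma L2_cong_AE:
  assumes "u \<in> L2_space M" "AE x in M. u x = v x" "v \<in> borel_measurable M"
  shows "v \<in> L2_space M"
  by (rule L2_dominated[OF assms(3) L2_integrable_sq[OF assms(1)]]) (use assms(2) in auto)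

lemma borel_measurable_cnj_prod:
  assumes "u \<in> borel_measurable M" "v \<in> borel_measurable M"
  shows "(\<lambda>x. cnj (u x) * v x) \<in> borel_measurable M"
proof -
  have "cnj \<in> borel_measurable borel"
    by (intro borel_measurable_continuous_onI continuous_intros)
  from measurable_compose[OF assms(1) this] assms(2) show ?thesis
    by simp
qed

lemma L2_integrable_prod:
  assumes "u \<in> L2_space M" "v \<in> L2_space M"
  shows "integrable M (\<lambda>x. cnj (u x) * v x)"
proof (rule Bochner_Integration.integrable_bound)
  show "integrable M (\<lambda>x. (cmod (u x))\<^sup>2 + (cmod (v x))\<^sup>2)"
    using assms by (auto simp: L2_space_def)
  have "a * b \<le> a\<^sup>2 + b\<^sup>2" if "a \<ge> 0" "b \<ge> 0" for a b :: real
    using zero_le_power2[of "a - b"] mult_nonneg_nonneg[OF that]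
    by (simp add: power2_eq_square algebra_simps)
  then show "AE x in M. norm (cnj (u x) * v x) \<le> norm ((cmod (u x))\<^sup>2 + (cmod (v x))\<^sup>2)"
    by (simp add: norm_mult)
qed (use assms in \<open>auto simp: L2_space_def borel_measurable_cnj_prod\<close>)


lemma ip_cong_AE:
  assumes "AE x in M. u x = u' x" "AE x in M. v x = v' x"
    and "u \<in> L2_space M" "u' \<in> L2_space M" "v \<in> L2_space M" "v' \<in> L2_space M"
  shows "ip M u v = ip M u' v'"
  unfolding ip_def using assms
  by (intro integral_cong_AE) (auto dest: L2_measurable intro!: borel_measurable_cnj_prod)

lemma ip_lincomb_right:
  assumes "u \<in> L2_space M" "v \<in> L2_space M" "w \<in> L2_space M"
  shows "ip M u (\<lambda>x. a * v x + b * w x) = a * ip M u v + b * ip M u w"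
proof -
  have "ip M u (\<lambda>x. a * v x + b * w x) = (LINT x|M. a * (cnj (u x) * v x) + b * (cnj (u x) * w x))"
    unfolding ip_def by (rule Bochner_Integration.integral_cong) (auto simp: algebra_simps)
  also have "\<dots> = a * ip M u v + b * ip M u w"
    unfolding ip_def using assms
    by (subst Bochner_Integration.integral_add) (auto intro: L2_integrable_prod)
  finally show ?thesis .
qed

lemma ip_cnj: "cnj (ip M u v) = ip M v u"
proof -
  have "cnj (ip M u v) = (LINT x|M. cnj (cnj (u x) * v x))"
    unfolding ip_def by (rule Bochner_Integration.integral_cnj[symmetric])
  then show ?thesis
    by (simp add: ip_def mult.commute)
qed

lemma ip_lincomb_left:
  assumes "u \<in> L2_space M" "v \<in> L2_space M" "w \<in> L2_space M"
  shows "ip M (\<lambda>x. a * v x + b * w x) u = cnj a * ip M v u + cnj b * ip M w u"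
  using arg_cong[OF ip_lincomb_right[OF assms, of a b], of cnj] by (simp add: ip_cnj)

lemma ip_diff_right:
  "u \<in> L2_space M \<Longrightarrow> v \<in> L2_space M \<Longrightarrow> w \<in> L2_space M \<Longrightarrow>
    ip M u (\<lambda>x. v x - w x) = ip M u v - ip M u w"
  using ip_lincomb_right[of u M v w 1 "-1"] by simp

lemma ip_diff_left:
  "u \<in> L2_space M \<Longrightarrow> v \<in> L2_space M \<Longrightarrow> w \<in> L2_space M \<Longrightarrow>
    ip M (\<lambda>x. v x - w x) u = ip M v u - ip M w u"
  using ip_lincomb_left[of u M v w 1 "-1"] by simp

lemma ip_add_right:
  "u \<in> L2_space M \<Longrightarrow> v \<in> L2_space M \<Longrightarrow> w \<in> L2_space M \<Longrightarrow>
    ip M u (\<lambda>x. v x + w x) = ip M u v + ip M u w"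
  using ip_lincomb_right[of u M v w 1 1] by simp

lemma ip_scale_right: "ip M u (\<lambda>x. c * v x) = c * ip M u v"
  unfolding ip_def by (simp flip: integral_mult_right_zero add: algebra_simps)

lemma ip_scale_left: "ip M (\<lambda>x. c * u x) v = cnj c * ip M u v"
  unfolding ip_def by (simp flip: integral_mult_right_zero add: algebra_simps)

lemma ip_zero_right: "ip M u (\<lambda>x. 0) = 0"
  by (simp add: ip_def)

lemma ip_zero_left: "ip M (\<lambda>x. 0) u = 0"
  by (simp add: ip_def)

lemma ip_sum_right:
  assumes "u \<in> L2_space M" "\<And>i. i \<in> I \<Longrightarrow> v i \<in> L2_space M"
  shows "ip M u (\<lambda>x. \<Sum>i\<in>I. c i * v i x) = (\<Sum>i\<in>I. c i * ip M u (v i))"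
  using assms(2)
proof (induction I rule: infinite_finite_induct)
  case (insert i I)
  then show ?case
    using assms(1) by (simp add: ip_add_right L2_scale L2_sum ip_scale_right)
qed (auto simp: ip_zero_right)


lemma ip_self: "ip M u u = complex_of_real (LINT x|M. (cmod (u x))\<^sup>2)"
  unfolding ip_def integral_complex_of_real[symmetric]
  by (rule Bochner_Integration.integral_cong) (simp_all only: complex_norm_square mult.commute)

lemma nrm_sq: "(nrm M u)\<^sup>2 = (LINT x|M. (cmod (u x))\<^sup>2)"
  by (simp add: nrm_def ip_self)

lemma ip_self_nrm: "ip M u u = complex_of_real ((nrm M u)\<^sup>2)"
  by (simp only: nrm_sq ip_self)

lemma nrm_nonneg[simp]: "0 \<le> nrm M u"
  by (simp add: nrm_def ip_self)

lemma nrm_cong_AE: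
  "AE x in M. u x = v x \<Longrightarrow> u \<in> L2_space M \<Longrightarrow> v \<in> L2_space M \<Longrightarrow> nrm M u = nrm M v"
  unfolding nrm_def by (metis ip_cong_AE)

lemma nrm_eq_0_iff:
  assumes "u \<in> L2_space M"
  shows "nrm M u = 0 \<longleftrightarrow> (AE x in M. u x = 0)"
proof -
  have "nrm M u = 0 \<longleftrightarrow> (LINT x|M. (cmod (u x))\<^sup>2) = 0"
    unfolding nrm_sq[symmetric] by simp
  also have "\<dots> \<longleftrightarrow> (AE x in M. u x = 0)"
    using assms by (subst integral_nonneg_eq_0_iff_AE) (auto simp: L2_space_def)
  finally show ?thesis .
qed

lemma nrm_scale: "nrm M (\<lambda>x. c * u x) = cmod c * nrm M u"
proof (rule power2_eq_imp_eq)
  show "(nrm M (\<lambda>x. c * u x))\<^sup>2 = (cmod c * nrm M u)\<^sup>2"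
    by (simp add: nrm_sq norm_mult power_mult_distrib)
qed auto

lemma nrm_zero[simp]: "nrm M (\<lambda>x. 0) = 0"
  by (simp add: nrm_def ip_def)

lemma nrm_minus_commute: "nrm M (\<lambda>x. u x - v x) = nrm M (\<lambda>x. v x - u x)"
  using nrm_scale[of M "-1" "\<lambda>x. u x - v x"] by simp

lemma nrm_add_sq:
  assumes "u \<in> L2_space M" "v \<in> L2_space M"
  shows "(nrm M (\<lambda>x. u x + v x))\<^sup>2 = (nrm M u)\<^sup>2 + 2 * Re (ip M u v) + (nrm M v)\<^sup>2"
proof -
  have "ip M (\<lambda>x. u x + v x) (\<lambda>x. u x + v x) = ip M u u + ip M u v + (cnj (ip M u v) + ip M v v)"
    using assms ip_lincomb_left[of "\<lambda>x. u x + v x" M u v 1 1]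
    by (simp add: L2_add ip_add_right ip_cnj)
  from arg_cong[OF this, of Re] show ?thesis
    by (simp add: ip_self_nrm)
qed

lemma nrm_diff_sq:
  assumes "u \<in> L2_space M" "v \<in> L2_space M"
  shows "(nrm M (\<lambda>x. u x - v x))\<^sup>2 = (nrm M u)\<^sup>2 - 2 * Re (ip M u v) + (nrm M v)\<^sup>2"
  using nrm_add_sq[OF assms(1) L2_scale[OF assms(2), of "-1"]]
  by (simp add: nrm_scale[of M "-1", simplified] ip_scale_right[of M u "-1", simplified])

lemma Cauchy_Schwarz_L2:
  assumes "u \<in> L2_space M" "v \<in> L2_space M"
  shows "cmod (ip M u v) \<le> nrm M u * nrm M v"
proof (cases "nrm M v = 0")
  case True
  then have "ip M u v = ip M u (\<lambda>x. 0)"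
    using assms nrm_eq_0_iff[of v M] by (intro ip_cong_AE) (auto simp: L2_zero)
  then show ?thesis by (simp add: ip_zero_right)
next
  case False
  define c where "c = ip M v u / complex_of_real ((nrm M v)\<^sup>2)"
  have *: "c * ip M u v = complex_of_real ((cmod (ip M u v))\<^sup>2 / (nrm M v)\<^sup>2)"
    unfolding c_def using ip_cnj[of M u v] 
    by (simp add: complex_norm_square mult.commute del: of_real_power)
  have "0 \<le> (nrm M (\<lambda>x. u x - c * v x))\<^sup>2" by simp
  also have "\<dots> = (nrm M u)\<^sup>2 - 2 * Re (c * ip M u v) + (cmod c * nrm M v)\<^sup>2"
    using assms by (simp add: nrm_diff_sq L2_scale ip_scale_right nrm_scale)
  also have "cmod c = cmod (ip M u v) / (nrm M v)\<^sup>2"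
    using ip_cnj[of M u v, THEN arg_cong[where f=cmod]]
    by (simp add: c_def norm_divide norm_power)
  also have "(cmod (ip M u v) / (nrm M v)\<^sup>2 * nrm M v)\<^sup>2 = (cmod (ip M u v))\<^sup>2 / (nrm M v)\<^sup>2"
    using False by (simp add: power2_eq_square)
  finally have "(cmod (ip M u v))\<^sup>2 / (nrm M v)\<^sup>2 \<le> (nrm M u)\<^sup>2"
    unfolding * by simp
  then have "(cmod (ip M u v))\<^sup>2 \<le> (nrm M u * nrm M v)\<^sup>2"
    using False by (simp add: divide_le_eq power_mult_distrib)
  then show ?thesis
    by (rule power2_le_imp_le) simp
qed

lemma nrm_triangle:
  assumes "u \<in> L2_space M" "v \<in> L2_space M"
  shows "nrm M (\<lambda>x. u x + v x) \<le> nrm M u + nrm M v"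
proof (rule power2_le_imp_le)
  have "Re (ip M u v) \<le> nrm M u * nrm M v"
    using Cauchy_Schwarz_L2[OF assms] complex_Re_le_cmod order_trans by blast
  then show "(nrm M (\<lambda>x. u x + v x))\<^sup>2 \<le> (nrm M u + nrm M v)\<^sup>2"
    using assms by (simp add: nrm_add_sq power2_sum)
qed simp

lemma nrm_triangle_diff:
  assumes "u \<in> L2_space M" "v \<in> L2_space M" "w \<in> L2_space M"
  shows "nrm M (\<lambda>x. u x - w x) \<le> nrm M (\<lambda>x. u x - v x) + nrm M (\<lambda>x. v x - w x)"
  using nrm_triangle[of "\<lambda>x. u x - v x" M "\<lambda>x. v x - w x"] assms by (simp add: L2_diff)

lemma nrm_mono:
  assumes "v \<in> L2_space M" "u \<in> borel_measurable M" "AE x in M. cmod (u x) \<le> cmod (v x)"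
  shows "nrm M u \<le> nrm M v"
proof (rule power2_le_imp_le)
  have *: "AE x in M. (cmod (u x))\<^sup>2 \<le> (cmod (v x))\<^sup>2"
    using assms(3) by eventually_elim (simp add: power_mono)
  have "u \<in> L2_space M"
    by (rule L2_dominated[OF assms(2) L2_integrable_sq[OF assms(1)] *])
  then show "(nrm M u)\<^sup>2 \<le> (nrm M v)\<^sup>2"
    unfolding nrm_sq using assms * by (intro integral_mono_AE) (auto intro: L2_integrable_sq)
qed simp

text \<open>
  Operators between these function spaces are determined only almost everywhere, so identities
  between them are proved by pairing with all square-integrable functions.
\<close>
lemma AE_eq_by_ip:
  assumes "u \<in> L2_space M" "v \<in> L2_space M" "\<And>w. w \<in> L2_space M \<Longrightarrow> ip M w u = ip M w v"
  shows "AE x in M. u x = v x"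
proof -
  have "ip M (\<lambda>x. u x - v x) (\<lambda>x. u x - v x) = 0"
    using assms by (simp add: ip_diff_right L2_diff)
  then have "nrm M (\<lambda>x. u x - v x) = 0"
    by (simp add: nrm_def)
  then show ?thesis
    using nrm_eq_0_iff[OF L2_diff[OF assms(1,2)]] by simp
qed

text \<open>
  With \<open>p = C x\<close>, \<open>q = C y\<close> and \<open>r = C (x + c y)\<close> this expands the quadratic form of a linear
  operator \<open>C\<close>. Comparing phases \<open>c\<close> recovers the sesquilinear form from the quadratic one.
\<close>
lemma form_expand:
  assumes "x \<in> L2_space M" "y \<in> L2_space M" "p \<in> L2_space M" "q \<in> L2_space M" "r \<in> L2_space M"
    and "AE t in M. r t = p t + c * q t"
  shows "ip M (\<lambda>t. x t + c * y t) r =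
    ip M x p + (c * ip M x q + cnj c * ip M y p) + cnj c * c * ip M y q"
proof -
  let ?w = "\<lambda>t. x t + c * y t"
  have w: "?w \<in> L2_space M" using assms by (intro L2_add L2_scale)
  have "ip M ?w r = ip M ?w (\<lambda>t. 1 * p t + c * q t)"
    using assms w by (intro ip_cong_AE L2_lincomb) auto
  also have "\<dots> = ip M ?w p + c * ip M ?w q"
    by (subst ip_lincomb_right[OF w assms(3,4)]) simp
  also have "ip M ?w p = ip M x p + cnj c * ip M y p"
    using ip_lincomb_left[OF assms(3,1,2), of 1 c] by simp
  also have "ip M ?w q = ip M x q + cnj c * ip M y q"
    using ip_lincomb_left[OF assms(4,1,2), of 1 c] by simp
  finally show ?thesis
    by (simp add: algebra_simps)
qed

section \<open>Projection-valued measures\<close>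

locale pvm =
  fixes M :: "'a measure" and E :: "real set \<Rightarrow> ('a \<Rightarrow> complex) \<Rightarrow> 'a \<Rightarrow> complex"
  assumes pvm: "projection_valued_measure M E"
begin

lemma E_L2[simp]: "S \<in> sets borel \<Longrightarrow> u \<in> L2_space M \<Longrightarrow> E S u \<in> L2_space M"
  and E_idem: "S \<in> sets borel \<Longrightarrow> u \<in> L2_space M \<Longrightarrow> AE x in M. E S (E S u) x = E S u x"
  and E_sym: "S \<in> sets borel \<Longrightarrow> u \<in> L2_space M \<Longrightarrow> v \<in> L2_space M \<Longrightarrow>
    ip M u (E S v) = ip M (E S u) v"
  and E_UNIV: "u \<in> L2_space M \<Longrightarrow> AE x in M. E UNIV u x = u x"
  and E_sums: "range F \<subseteq> sets borel \<Longrightarrow> disjoint_family F \<Longrightarrow> u \<in> L2_space M \<Longrightarrow>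
    v \<in> L2_space M \<Longrightarrow> (\<lambda>k::nat. ip M u (E (F k) v)) sums ip M u (E (\<Union>k. F k) v)"
  using pvm by (auto simp: projection_valued_measure_def)

lemma E_cong:
  assumes "S \<in> sets borel" "u \<in> L2_space M" "v \<in> L2_space M" "AE x in M. u x = v x"
  shows "AE x in M. E S u x = E S v x"
proof (rule AE_eq_by_ip)
  fix w assume w: "w \<in> L2_space M"
  have "ip M (E S w) u = ip M (E S w) v"
    using assms w by (intro ip_cong_AE) auto
  then show "ip M w (E S u) = ip M w (E S v)"
    using assms w by (simp add: E_sym)
qed (use assms in auto)

lemma E_lincomb:
  assumes "S \<in> sets borel" "u \<in> L2_space M" "v \<in> L2_space M"
  shows "AE x in M. E S (\<lambda>x. a * u x + b * v x) x = a * E S u x + b * E S v x"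
  by (rule AE_eq_by_ip) (use assms in \<open>auto simp: L2_lincomb ip_lincomb_right E_sym\<close>)

lemma E_empty:
  assumes "u \<in> L2_space M" "v \<in> L2_space M"
  shows "ip M u (E {} v) = 0"
proof -
  have "(\<lambda>k::nat. ip M u (E {} v)) sums ip M u (E {} v)"
    using E_sums[of "\<lambda>k. {}" u v] assms by (simp add: disjoint_family_on_def)
  then show ?thesis
    using sums_summable summable_const_iff by blast
qed

lemma E_Un:
  assumes "S \<in> sets borel" "T \<in> sets borel" "S \<inter> T = {}" "u \<in> L2_space M" "v \<in> L2_space M"
  shows "ip M u (E (S \<union> T) v) = ip M u (E S v) + ip M u (E T v)"
proof -
  have "range (binaryset S T) \<subseteq> sets borel" "disjoint_family (binaryset S T)"
    using assms by (auto simp: binaryset_def disjoint_family_on_def)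
  from E_sums[OF this assms(4,5)]
  have "(\<lambda>k. ip M u (E (binaryset S T k) v)) sums ip M u (E (S \<union> T) v)"
    by (simp add: UN_binaryset_eq)
  moreover have "(\<lambda>k. ip M u (E (binaryset S T k) v)) sums (ip M u (E S v) + ip M u (E T v))"
    by (rule binaryset_sums) (use assms E_empty in auto)
  ultimately show ?thesis
    using sums_unique2 by blast
qed

lemma E_Compl:
  assumes "S \<in> sets borel" "u \<in> L2_space M"
  shows "AE x in M. u x = E S u x + E (- S) u x"
proof (rule AE_eq_by_ip)
  fix w assume w: "w \<in> L2_space M"
  have "ip M w u = ip M w (E UNIV u)"
    using assms w by (intro ip_cong_AE) (use E_UNIV[OF assms(2)] in auto)
  also have "\<dots> = ip M w (E S u) + ip M w (E (- S) u)"
    using E_Un[of S "- S" w u] assms w by simp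
  also have "\<dots> = ip M w (\<lambda>x. E S u x + E (- S) u x)"
    using assms w by (simp add: ip_add_right)
  finally show "ip M w u = ip M w (\<lambda>x. E S u x + E (- S) u x)" .
qed (use assms in \<open>auto intro: L2_add\<close>)

lemma ip_E_self:
  assumes "S \<in> sets borel" "u \<in> L2_space M"
  shows "ip M u (E S u) = complex_of_real ((nrm M (E S u))\<^sup>2)"
proof -
  have "ip M u (E S u) = ip M u (E S (E S u))"
    using assms by (intro ip_cong_AE) (use E_idem[OF assms] in auto)
  also have "\<dots> = ip M (E S u) (E S u)"
    using assms by (simp add: E_sym)
  finally show ?thesis
    by (simp only: ip_self_nrm)
qed

lemma E_contraction:
  assumes "S \<in> sets borel" "u \<in> L2_space M"
  shows "nrm M (E S u) \<le> nrm M u"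
proof -
  have "(nrm M (E S u))\<^sup>2 = cmod (ip M u (E S u))"
    by (simp add: ip_E_self assms norm_power)
  also have "\<dots> \<le> nrm M u * nrm M (E S u)"
    using assms by (intro Cauchy_Schwarz_L2) auto
  finally show ?thesis
    by (cases "nrm M (E S u) = 0") (auto simp: power2_eq_square mult_le_cancel_right order.strict_iff_order)
qed

lemma nrm_sq_Un:
  assumes "S \<in> sets borel" "T \<in> sets borel" "S \<inter> T = {}" "u \<in> L2_space M"
  shows "(nrm M (E (S \<union> T) u))\<^sup>2 = (nrm M (E S u))\<^sup>2 + (nrm M (E T u))\<^sup>2"
  using arg_cong[OF E_Un[OF assms assms(4)], of Re] assms by (simp add: ip_E_self)

text \<open>
  For \<open>v = E T u\<close> Pythagoras gives \<open>\<parallel>E S v\<parallel>\<^sup>2 + \<parallel>v\<parallel>\<^sup>2 = \<parallel>E (S \<union> T) v\<parallel>\<^sup>2 \<le> \<parallel>v\<parallel>\<^sup>2\<close>, so nothing is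
  left for \<open>E S v\<close>. Multiplicativity of \<open>E\<close> rests on this.
\<close>
lemma E_disjoint:
  assumes "S \<in> sets borel" "T \<in> sets borel" "S \<inter> T = {}" "u \<in> L2_space M"
  shows "nrm M (E S (E T u)) = 0"
proof -
  let ?v = "E T u"
  have v: "?v \<in> L2_space M" using assms by auto
  have "(nrm M (E S ?v))\<^sup>2 + (nrm M (E T ?v))\<^sup>2 \<le> (nrm M ?v)\<^sup>2"
    using E_contraction[of "S \<union> T" ?v] assms v
    by (simp flip: nrm_sq_Un)
  moreover have "nrm M (E T ?v) = nrm M ?v"
    using assms by (intro nrm_cong_AE E_idem) auto
  ultimately show ?thesis
    by simp
qed

lemma E_Int:
  assumes "S \<in> sets borel" "T \<in> sets borel" "u \<in> L2_space M"
  shows "AE x in M. E S (E T u) x = E (S \<inter> T) u x"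
proof (rule AE_eq_by_ip)
  fix w assume w: "w \<in> L2_space M"
  have disj: "ip M z (E A (E B u)) = 0"
    if "z \<in> L2_space M" "A \<in> sets borel" "B \<in> sets borel" "A \<inter> B = {}" for z A B
    using Cauchy_Schwarz_L2[of z M "E A (E B u)"] E_disjoint[of A B u] assms that by simp
  have split: "ip M w (E S v) = ip M w (E (S \<inter> T) v) + ip M w (E (S - T) v)"
    if "v \<in> L2_space M" for v
    using E_Un[of "S \<inter> T" "S - T" w v] assms w that by (simp add: Int_Diff_Un Int_Diff_disjoint)
  have "ip M w (E (S \<inter> T) u) = ip M (E (S \<inter> T) w) (\<lambda>x. E T u x + E (- T) u x)"
    using assms w E_Compl[of T u]
    by (subst E_sym) (auto intro!: ip_cong_AE L2_add)
  also have "\<dots> = ip M w (E (S \<inter> T) (E T u)) + ip M w (E (S \<inter> T) (E (- T) u))"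
    using assms w by (simp add: ip_add_right E_sym)
  also have "\<dots> = ip M w (E (S \<inter> T) (E T u))"
    using assms w by (subst (2) disj) auto
  also have "\<dots> = ip M w (E S (E T u))"
    using assms w by (subst split, simp, subst disj) auto
  finally show "ip M w (E S (E T u)) = ip M w (E (S \<inter> T) u)" by simp
qed (use assms in auto)

lemma E_continuous:
  assumes "range F \<subseteq> sets borel" "incseq F" "u \<in> L2_space M" "v \<in> L2_space M"
  shows "(\<lambda>n. ip M u (E (F n) v)) \<longlonglongrightarrow> ip M u (E (\<Union>n. F n) v)"
proof -
  have D: "disjointed F n \<in> sets borel" for n
    using assms(1) sets.range_disjointed_sets[of F borel] by auto
  have Fn: "F n \<in> sets borel" for n using assms(1) by auto
  have sum: "(\<Sum>k<Suc n. ip M u (E (disjointed F k) v)) = ip M u (E (F n) v)" for n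
  proof (induction n)
    case 0
    then show ?case by (simp add: disjointed_def)
  next
    case (Suc n)
    have eq: "F (Suc n) = F n \<union> disjointed F (Suc n)" "F n \<inter> disjointed F (Suc n) = {}"
      using incseq_SucD[OF assms(2), of n] by (auto simp: disjointed_mono[OF assms(2)])
    have "ip M u (E (F n \<union> disjointed F (Suc n)) v) =
        ip M u (E (F n) v) + ip M u (E (disjointed F (Suc n)) v)"
      by (rule E_Un) (use eq assms D Fn in auto)
    with Suc eq show ?case by simp
  qed
  have "(\<lambda>k. ip M u (E (disjointed F k) v)) sums ip M u (E (\<Union>n. F n) v)"
    using E_sums[of "disjointed F" u v] D assms
    by (auto simp: UN_disjointed_eq disjoint_family_disjointed)
  then have "(\<lambda>n. \<Sum>k<Suc n. ip M u (E (disjointed F k) v)) \<longlonglongrightarrow> ip M u (E (\<Union>n. F n) v)"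
    unfolding sums_def by (rule LIMSEQ_Suc)
  then show ?thesis
    by (simp only: sum)
qed

lemma sets_scalar_measure[simp, measurable_cong]: "sets (scalar_measure M E u) = sets borel"
  and space_scalar_measure[simp]: "space (scalar_measure M E u) = UNIV"
  using sets.sets_measure_of_eq[of "borel :: real measure"] sets.space_measure_of_eq[of "borel :: real measure"]
  by (simp_all add: scalar_measure_def)

lemma emeasure_scalar_measure:
  assumes "u \<in> L2_space M" "S \<in> sets borel"
  shows "emeasure (scalar_measure M E u) S = ennreal ((nrm M (E S u))\<^sup>2)"
proof -
  let ?\<mu> = "\<lambda>S. ennreal (Re (ip M u (E S u)))"
  have "emeasure (scalar_measure M E u) S = ?\<mu> S"
    unfolding scalar_measure_def
  proof (rule emeasure_measure_of_sigma)
    show "sigma_algebra UNIV (sets (borel :: real measure))"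
      using sets.sigma_algebra_axioms[of "borel :: real measure"] by simp
    show "positive (sets borel) ?\<mu>"
      by (simp add: positive_def E_empty assms)
    show "countably_additive (sets borel) ?\<mu>"
      unfolding countably_additive_def
    proof (intro allI impI)
      fix F :: "nat \<Rightarrow> real set"
      assume F: "range F \<subseteq> sets borel" "disjoint_family F"
      have "(\<lambda>k. Re (ip M u (E (F k) u))) sums Re (ip M u (E (\<Union>k. F k) u))"
        using sums_Re[OF E_sums[OF F assms(1,1)]] by simp
      moreover have "0 \<le> Re (ip M u (E (F k) u))" for k
        using F assms by (subst ip_E_self) auto
      ultimately show "(\<Sum>i. ?\<mu> (F i)) = ?\<mu> (\<Union> (range F))"
        by (simp add: suminf_ennreal2 sums_iff)
    qed
  qed fact
  then show ?thesis
    using assms by (simp add: ip_E_self)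
qed

lemma finite_scalar_measure: "u \<in> L2_space M \<Longrightarrow> finite_measure (scalar_measure M E u)"
  by (rule finite_measureI) (simp add: emeasure_scalar_measure)

lemma scalar_measure_cong:
  assumes "u \<in> L2_space M" "v \<in> L2_space M" "\<And>S. S \<in> sets borel \<Longrightarrow> nrm M (E S u) = nrm M (E S v)"
  shows "scalar_measure M E u = scalar_measure M E v"
  by (rule measure_eqI) (use assms in \<open>auto simp: emeasure_scalar_measure\<close>)

lemma scalar_measure_cong_AE:
  assumes "u \<in> L2_space M" "v \<in> L2_space M" "AE x in M. u x = v x"
  shows "scalar_measure M E u = scalar_measure M E v"
  by (intro scalar_measure_cong nrm_cong_AE E_cong) (use assms in auto)

lemma scalar_measure_phase:
  assumes "u \<in> L2_space M" "cmod c = 1"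
  shows "scalar_measure M E (\<lambda>x. c * u x) = scalar_measure M E u"
proof (rule scalar_measure_cong)
  fix S :: "real set" assume S: "S \<in> sets borel"
  have "nrm M (E S (\<lambda>x. c * u x)) = nrm M (\<lambda>x. c * E S u x)"
    using E_lincomb[OF S assms(1) assms(1), of c 0] S assms
    by (intro nrm_cong_AE) (auto intro!: L2_scale E_L2)
  then show "nrm M (E S (\<lambda>x. c * u x)) = nrm M (E S u)"
    using assms by (simp add: nrm_scale)
qed (use assms in \<open>auto intro: L2_scale\<close>)

text \<open>
  Cutting \<open>u\<close> down by a spectral projection restricts its scalar measure. This reduces domain
  questions and quadratic forms on \<open>E S u\<close> to integrals over \<open>S\<close>.
\<close>
lemma scalar_measure_restrict:
  assumes "u \<in> L2_space M" "S \<in> sets borel"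
  shows "scalar_measure M E (E S u) =
    density (scalar_measure M E u) (\<lambda>t. ennreal (indicator S t))"
proof (rule measure_eqI)
  fix T assume "T \<in> sets (scalar_measure M E (E S u))"
  then have T: "T \<in> sets borel" by simp
  have "emeasure (scalar_measure M E (E S u)) T = ennreal ((nrm M (E (T \<inter> S) u))\<^sup>2)"
    using assms T by (simp add: emeasure_scalar_measure nrm_cong_AE[OF E_Int])
  also have "\<dots> = emeasure (scalar_measure M E u) (S \<inter> T)"
    using assms T by (simp add: emeasure_scalar_measure Int_commute)
  also have "\<dots> = emeasure (density (scalar_measure M E u) (\<lambda>t. ennreal (indicator S t))) T"
    using assms T by (simp add: emeasure_restricted ennreal_indicator)
  finally show "emeasure (scalar_measure M E (E S u)) T =
    emeasure (density (scalar_measure M E u) (\<lambda>t. ennreal (indicator S t))) T" .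
qed simp

lemma integrable_restrict:
  fixes f :: "real \<Rightarrow> real"
  assumes "u \<in> L2_space M" "S \<in> sets borel" "f \<in> borel_measurable borel"
  shows "integrable (scalar_measure M E (E S u)) f \<longleftrightarrow>
    integrable (scalar_measure M E u) (\<lambda>t. indicator S t * f t)"
  unfolding scalar_measure_restrict[OF assms(1,2)]
  using assms by (subst integrable_density) auto

lemma integral_restrict:
  fixes f :: "real \<Rightarrow> real"
  assumes "u \<in> L2_space M" "S \<in> sets borel" "f \<in> borel_measurable borel"
  shows "(LINT t|scalar_measure M E (E S u). f t) =
    (LINT t|scalar_measure M E u. indicator S t * f t)"
  unfolding scalar_measure_restrict[OF assms(1,2)]
  using assms by (subst integral_density) auto

lemma indicator_Compl_split:
  fixes f :: "real \<Rightarrow> real"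
  shows "f t = indicator S t * f t + indicator (- S) t * f t"
  by (simp split: split_indicator)

lemma integrable_split:
  fixes f :: "real \<Rightarrow> real"
  assumes "u \<in> L2_space M" "S \<in> sets borel" "f \<in> borel_measurable borel"
    and "integrable (scalar_measure M E (E S u)) f" "integrable (scalar_measure M E (E (- S) u)) f"
  shows "integrable (scalar_measure M E u) f"
proof -
  have "- S \<in> sets borel" using assms(2) by auto
  then have "integrable (scalar_measure M E u) (\<lambda>t. indicator S t * f t + indicator (- S) t * f t)"
    using assms integrable_restrict[of u S f] integrable_restrict[of u "- S" f]
    by (intro Bochner_Integration.integrable_add) blast+
  then show ?thesis by (simp flip: indicator_Compl_split)
qed

lemma integral_split:
  fixes f :: "real \<Rightarrow> real"
  assumes "u \<in> L2_space M" "S \<in> sets borel" "f \<in> borel_measurable borel"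
    and "integrable (scalar_measure M E (E S u)) f" "integrable (scalar_measure M E (E (- S) u)) f"
  shows "(LINT t|scalar_measure M E u. f t) =
    (LINT t|scalar_measure M E (E S u). f t) + (LINT t|scalar_measure M E (E (- S) u). f t)"
proof -
  have S': "- S \<in> sets borel" using assms(2) by auto
  have "(LINT t|scalar_measure M E u. f t) =
      (LINT t|scalar_measure M E u. indicator S t * f t + indicator (- S) t * f t)"
    by (simp flip: indicator_Compl_split)
  also have "\<dots> = (LINT t|scalar_measure M E u. indicator S t * f t) +
      (LINT t|scalar_measure M E u. indicator (- S) t * f t)"
    using assms S' integrable_restrict[of u S f] integrable_restrict[of u "- S" f]
    by (intro Bochner_Integration.integral_add) blast+
  finally show ?thesis
    by (simp only: integral_restrict[OF assms(1-3)] integral_restrict[OF assms(1) S' assms(3)])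
qed

lemma AE_scalar_measure_in:
  assumes "u \<in> L2_space M" "S \<in> sets borel" "AE x in M. E S u x = u x"
  shows "AE t in scalar_measure M E u. t \<in> S"
proof -
  have "AE t in scalar_measure M E (E S u). t \<in> S"
    unfolding scalar_measure_restrict[OF assms(1,2)]
    by (subst AE_density) (use assms(2) in \<open>auto split: split_indicator\<close>)
  moreover have "scalar_measure M E (E S u) = scalar_measure M E u"
    using assms by (intro scalar_measure_cong_AE) auto
  ultimately show ?thesis
    by (simp only:)
qed

lemma measure_scalar_measure_UNIV:
  "u \<in> L2_space M \<Longrightarrow> measure (scalar_measure M E u) UNIV = (nrm M u)\<^sup>2"
  using nrm_cong_AE[OF E_UNIV, of u] by (simp add: measure_def emeasure_scalar_measure)

end

section \<open>Uniqueness of the spectral measure\<close>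

context pvm begin

abbreviation ran :: "real set \<Rightarrow> ('a \<Rightarrow> complex) \<Rightarrow> bool" where
  "ran S u \<equiv> AE x in M. E S u x = u x"

lemma E_eq_0_if_ran:
  assumes "S \<in> sets borel" "T \<in> sets borel" "S \<inter> T = {}" "u \<in> L2_space M" "ran T u"
  shows "AE x in M. E S u x = 0"
proof -
  have "nrm M (E S u) = nrm M (E S (E T u))"
    using assms by (intro nrm_cong_AE E_cong E_L2) auto
  then show ?thesis
    using assms E_disjoint[of S T u] nrm_eq_0_iff[of "E S u" M] by simp
qed

lemma ran_subset:
  assumes "S \<in> sets borel" "T \<in> sets borel" "S \<subseteq> T" "u \<in> L2_space M"
  shows "ran T (E S u)"
  using E_Int[of T S u] assms by (simp add: Int_absorb1)

text \<open>
  A vector is recovered from its projections to bounded spectral intervals; these projections lie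
  in the domain of every operator with spectral measure \<open>E\<close>, which \<open>r\<close> itself need not do.
\<close>
lemma E_eq_0_if_cutoffs:
  assumes "r \<in> L2_space M" "S \<in> sets borel"
    and 0: "\<And>n::nat. ip M r (E ({- real n..real n} \<inter> S) r) = 0"
  shows "AE x in M. E S r x = 0"
proof -
  have "(\<lambda>n::nat. ip M r (E ({- real n..real n} \<inter> S) r)) \<longlonglongrightarrow>
      ip M r (E (\<Union>n::nat. {- real n..real n} \<inter> S) r)"
    using assms by (intro E_continuous) (auto simp: incseq_def)
  moreover have "(\<Union>n::nat. {- real n..real n} \<inter> S) = S"
  proof -
    have "\<exists>n::nat. - real n \<le> x \<and> x \<le> real n" for x :: real
      using real_nat_ceiling_ge[of "\<bar>x\<bar>"] by (intro exI[of _ "nat \<lceil>\<bar>x\<bar>\<rceil>"]) linarith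
    then show ?thesis by auto
  qed
  ultimately have "ip M r (E S r) = 0"
    using 0 LIMSEQ_unique[OF tendsto_const] by fastforce
  then show ?thesis
    using assms ip_E_self[of S r] nrm_eq_0_iff[of "E S r" M] by simp
qed

end

text \<open>
  The choices \<open>c = 1\<close> and \<open>c = \<i>\<close> suffice.
\<close>
lemma phases_separate:
  fixes a b :: complex
  assumes "\<And>c. cmod c = 1 \<Longrightarrow> c * a + cnj c * b = 0"
  shows "a = 0" "b = 0"
proof -
  have 1: "a + b = 0" using assms[of 1] by simp
  have "\<i> * (a - b) = 0" using assms[of \<i>] by (simp add: algebra_simps)
  then have "a = b" by simp
  with 1 show "a = 0" "b = 0" by (simp_all add: mult_2[symmetric])
qed

lemma cancel_square_le:
  fixes a b z :: real
  assumes "a * b\<^sup>2 \<le> b * z" "0 \<le> b" "0 \<le> z"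
  shows "a * b \<le> z"
proof (cases "b = 0")
  case False
  then have "b * (a * b) \<le> b * z" using assms by (simp add: power2_eq_square mult_ac)
  then show ?thesis using False assms by (simp add: mult_le_cancel_left)
qed (use assms in simp)

text \<open>
  The pair of a spectral measure and its operator. Apart from linearity, only the
  quadratic form of \<open>A\<close> is given, so that \<open>A\<close> commutes with \<open>E\<close>, or even respects equality almost everywhere, has to be derived.
\<close>
locale spectral_decomposition = pvm +
  fixes A :: "'a l2op"
  assumes id_integral: "spectral_integral M E (\<lambda>t. t) A"
begin

abbreviation "D \<equiv> fst A"
abbreviation "act \<equiv> snd A"

lemma D_iff: "u \<in> D \<longleftrightarrow> u \<in> L2_space M \<and> integrable (scalar_measure M E u) (\<lambda>t. t\<^sup>2)"
  and act_L2: "u \<in> D \<Longrightarrow> act u \<in> L2_space M"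
  and act_form: "u \<in> D \<Longrightarrow> ip M u (act u) = complex_of_real (LINT t|scalar_measure M E u. t)"
  and act_lincomb: "u \<in> D \<Longrightarrow> v \<in> D \<Longrightarrow>
    AE x in M. act (\<lambda>y. a * u y + b * v y) x = a * act u x + b * act v x"
  using id_integral by (auto simp: spectral_integral_def)

lemma D_L2: "u \<in> D \<Longrightarrow> u \<in> L2_space M"
  by (simp add: D_iff)

lemma integrable_id: "u \<in> D \<Longrightarrow> integrable (scalar_measure M E u) (\<lambda>t. t)"
proof (rule Bochner_Integration.integrable_bound)
  assume u: "u \<in> D"
  then interpret finite_measure "scalar_measure M E u"
    by (intro finite_scalar_measure D_L2)
  show "integrable (scalar_measure M E u) (\<lambda>t. 1 + t\<^sup>2)"
    using u by (simp add: D_iff)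
  have "\<bar>t\<bar> \<le> 1 + t\<^sup>2" for t :: real
    using zero_le_power2[of "\<bar>t\<bar> - 1"] zero_le_power2[of t]
    by (simp only: power2_diff) simp
  then show "AE t in scalar_measure M E u. norm t \<le> norm (1 + t\<^sup>2)"
    by simp
qed simp

lemma D_cong: "u \<in> D \<Longrightarrow> v \<in> L2_space M \<Longrightarrow> AE x in M. u x = v x \<Longrightarrow> v \<in> D"
  using scalar_measure_cong_AE[of u v] by (simp add: D_iff)

lemma form_cong:
  "u \<in> D \<Longrightarrow> v \<in> D \<Longrightarrow> AE x in M. u x = v x \<Longrightarrow> ip M u (act u) = ip M v (act v)"
  using scalar_measure_cong_AE[of u v] by (simp add: act_form D_L2)

lemma D_phase: "u \<in> D \<Longrightarrow> cmod c = 1 \<Longrightarrow> (\<lambda>x. c * u x) \<in> D"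
  by (simp add: D_iff scalar_measure_phase L2_scale)

lemma D_E: "u \<in> D \<Longrightarrow> S \<in> sets borel \<Longrightarrow> E S u \<in> D"
  using integrable_mult_indicator[of S "scalar_measure M E u" "\<lambda>t. t\<^sup>2"]
  by (simp add: D_iff integrable_restrict)

lemma D_bounded:
  assumes "u \<in> L2_space M" "S \<in> sets borel" "S \<subseteq> {c..d}"
  shows "E S u \<in> D"
proof -
  interpret finite_measure "scalar_measure M E u"
    by (intro finite_scalar_measure assms)
  have "integrable (scalar_measure M E u) (\<lambda>t. indicator S t * t\<^sup>2)"
  proof (rule integrable_const_bound)
    have "t\<^sup>2 \<le> (max \<bar>c\<bar> \<bar>d\<bar>)\<^sup>2" if "t \<in> S" for t
    proof -
      have "c \<le> t" "t \<le> d" using that assms(3) by auto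
      then have "\<bar>t\<bar> \<le> max \<bar>c\<bar> \<bar>d\<bar>" by linarith
      then show ?thesis by (intro power2_le_iff_abs_le[THEN iffD2]) auto
    qed
    then show "AE t in scalar_measure M E u. norm (indicator S t * t\<^sup>2) \<le> (max \<bar>c\<bar> \<bar>d\<bar>)\<^sup>2"
      by (auto split: split_indicator)
  qed (use assms in simp)
  then show ?thesis
    using assms by (simp add: D_iff integrable_restrict)
qed

lemma act_form_expand:
  assumes "x \<in> D" "y \<in> D" "(\<lambda>t. x t + c * y t) \<in> D"
  shows "ip M (\<lambda>t. x t + c * y t) (act (\<lambda>t. x t + c * y t)) =
    ip M x (act x) + (c * ip M x (act y) + cnj c * ip M y (act x)) + cnj c * c * ip M y (act y)"
  by (rule form_expand) (use assms act_lincomb[OF assms(1,2), of 1 c] in \<open>auto intro: D_L2 act_L2\<close>)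

text \<open>
  A quadratic form with real values has a symmetric polarization.
\<close>
lemma act_sym:
  assumes "x \<in> D" "y \<in> D" "\<And>c. (\<lambda>t. x t + c * y t) \<in> D"
  shows "ip M x (act y) = ip M (act x) y"
proof -
  have im: "Im (c * ip M x (act y) + cnj c * ip M y (act x)) = 0" if "cmod c = 1" for c
    using arg_cong[OF act_form_expand[OF assms(1,2) assms(3)[of c]], of Im]
      act_form[OF assms(1)] act_form[OF assms(2)] act_form[OF assms(3)[of c]] that
    by (simp add: complex_norm_square[symmetric] mult.commute[of "cnj c" c])
  have "Im (ip M x (act y)) = - Im (ip M y (act x))" "Re (ip M x (act y)) = Re (ip M y (act x))"
    using im[of 1] im[of \<i>] by simp_all
  then have "ip M x (act y) = cnj (ip M y (act x))"
    by (simp add: complex_eq_iff)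
  then show ?thesis
    by (simp add: ip_cnj)
qed

text \<open>
  For \<open>w = x + c y\<close> the scalar measure splits over \<open>S\<close> and its complement into those of \<open>x\<close> and
  \<open>c y\<close>, and a phase \<open>c\<close> does not change the latter. So the quadratic form of \<open>A\<close> at \<open>w\<close> has no mixed
  terms, for any phase.
\<close>
lemma orthogonal_ranges:
  assumes "x \<in> D" "y \<in> D" "S \<in> sets borel" "ran S x" "ran (- S) y"
  shows "ip M x (act y) = 0" "ip M y (act x) = 0"
proof -
  have S': "- S \<in> sets borel" using assms(3) by auto
  have L: "x \<in> L2_space M" "y \<in> L2_space M" using assms by (auto simp: D_L2)
  have main: "c * ip M x (act y) + cnj c * ip M y (act x) = 0" if c: "cmod c = 1" for c
  proof -
    let ?w = "\<lambda>t. x t + c * y t"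
    have w: "?w \<in> L2_space M" using L by (intro L2_add L2_scale)
    have cy: "(\<lambda>t. c * y t) \<in> D" using assms c by (intro D_phase)
    have "AE t in M. E S y t = 0"
      by (rule E_eq_0_if_ran[OF assms(3) S' _ L(2) assms(5)]) auto
    moreover have "AE t in M. E (- S) x t = 0"
      by (rule E_eq_0_if_ran[OF S' assms(3) _ L(1) assms(4)]) auto
    ultimately have e1: "AE t in M. E S ?w t = x t" and e2: "AE t in M. E (- S) ?w t = c * y t"
      using E_lincomb[OF assms(3) L, of 1 c] E_lincomb[OF S' L, of 1 c] assms(4,5) by auto
    have E1: "scalar_measure M E (E S ?w) = scalar_measure M E x"
      by (rule scalar_measure_cong_AE) (use e1 w L assms in auto)
    have E2: "scalar_measure M E (E (- S) ?w) = scalar_measure M E y"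
      using scalar_measure_cong_AE[OF _ _ e2] scalar_measure_phase[OF L(2) c] w L S'
      by (simp add: L2_scale)
    have i1: "integrable (scalar_measure M E (E S ?w)) (\<lambda>t. t\<^sup>2)"
        "integrable (scalar_measure M E (E (- S) ?w)) (\<lambda>t. t\<^sup>2)"
      unfolding E1 E2 using assms by (simp_all add: D_iff)
    have i2: "integrable (scalar_measure M E (E S ?w)) (\<lambda>t. t)"
        "integrable (scalar_measure M E (E (- S) ?w)) (\<lambda>t. t)"
      unfolding E1 E2 using assms by (simp_all add: integrable_id)
    have wD: "?w \<in> D"
      using integrable_split[OF w assms(3) _ i1] w by (simp add: D_iff)
    have "ip M ?w (act ?w) = ip M x (act x) + ip M y (act y)"
      using integral_split[OF w assms(3) _ i2] wD assms(1,2) by (simp add: act_form E1 E2)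
    then show ?thesis
      using act_form_expand[OF assms(1,2) wD] c
      by (simp add: complex_norm_square[symmetric] mult.commute[of "cnj c" c])
  qed
  show "ip M x (act y) = 0" "ip M y (act x) = 0"
    using phases_separate[OF main] by auto
qed

text \<open>
  The difference \<open>z\<close> of \<open>x\<close> and \<open>y\<close> vanishes almost everywhere, hence adding \<open>c z\<close> to a vector \<open>p\<close> of
  the domain leaves the quadratic form unchanged, and \<open>\<langle>p, A z\<rangle> = 0\<close> follows. Spectral cutoffs of
  \<open>A z\<close> are admissible choices of \<open>p\<close>.
\<close>
lemma act_cong:
  assumes "x \<in> D" "y \<in> D" "AE t in M. x t = y t"
  shows "AE t in M. act x t = act y t"
proof -
  let ?z = "\<lambda>t. 1 * x t + (- 1) * y t"
  have L: "x \<in> L2_space M" "y \<in> L2_space M" "act x \<in> L2_space M" "act y \<in> L2_space M"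
    using assms by (auto simp: D_L2 act_L2)
  have zL: "?z \<in> L2_space M" using L by (intro L2_lincomb)
  have z0: "AE t in M. ?z t = 0" using assms(3) by auto
  \<comment> \<open>A function vanishing almost everywhere belongs to the domain because \<open>E {} x\<close> does.\<close>
  have "E {} x \<in> D" using D_E[OF assms(1), of "{}"] by simp
  moreover have "AE t in M. E {} x t = 0"
    by (rule AE_eq_by_ip) (use L in \<open>auto simp: E_empty ip_zero_right L2_zero\<close>)
  with z0 have "AE t in M. E {} x t = ?z t" by auto
  ultimately have zD: "?z \<in> D" using D_cong zL by blast
  have z_left: "ip M ?z v = 0" if "v \<in> L2_space M" for v
    using ip_cong_AE[of ?z "\<lambda>_. 0" M v v] z0 zL that by (simp add: L2_zero ip_zero_left)
  have p0: "ip M p (act ?z) = 0" if p: "p \<in> D" for p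
  proof (rule phases_separate(1))
    fix c :: complex assume "cmod c = 1"
    have "(\<lambda>t. p t + c * ?z t) \<in> L2_space M"
      by (rule L2_add[OF D_L2[OF p] L2_scale[OF zL]])
    moreover have pz: "AE t in M. p t = p t + c * ?z t"
      using z0 by eventually_elim simp
    ultimately have pzD: "(\<lambda>t. p t + c * ?z t) \<in> D"
      using D_cong p by blast
    show "c * ip M p (act ?z) + cnj c * ip M ?z (act p) = 0"
      using act_form_expand[OF p zD pzD] form_cong[OF p pzD pz] z_left act_L2[OF zD] by simp
  qed
  have aL: "act ?z \<in> L2_space M" using zD by (rule act_L2)
  have "AE t in M. E UNIV (act ?z) t = 0"
  proof (rule E_eq_0_if_cutoffs)
    fix n :: nat
    have "E ({- real n..real n} \<inter> UNIV) (act ?z) \<in> D"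
      using aL by (intro D_bounded) auto
    from p0[OF this] show "ip M (act ?z) (E ({- real n..real n} \<inter> UNIV) (act ?z)) = 0"
      by (metis complex_cnj_zero ip_cnj)
  qed (use aL in auto)
  with E_UNIV[OF aL] have "AE t in M. act ?z t = 0" by auto
  with act_lincomb[OF assms(1,2), of 1 "- 1"] show ?thesis
    by auto
qed

text \<open>
  The component of \<open>A x\<close> outside the range of \<open>E S\<close> is tested against its own spectral cutoffs,
  to which \<open>A x\<close> is orthogonal.
\<close>
lemma ran_act:
  assumes "x \<in> D" "S \<in> sets borel" "ran S x"
  shows "ran S (act x)"
proof -
  have aL: "act x \<in> L2_space M" using assms by (simp add: act_L2)
  have S': "- S \<in> sets borel" using assms by auto
  have "AE t in M. E (- S) (act x) t = 0"
  proof (rule E_eq_0_if_cutoffs)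
    fix n :: nat
    let ?p = "E ({- real n..real n} \<inter> - S) (act x)"
    have "?p \<in> D" using aL S' by (intro D_bounded) auto
    moreover have "ran (- S) ?p" using aL S' by (intro ran_subset) auto
    ultimately have "ip M ?p (act x) = 0"
      using orthogonal_ranges(2)[OF assms(1) _ assms(2,3)] by blast
    then show "ip M (act x) ?p = 0"
      by (metis complex_cnj_zero ip_cnj)
  qed (use aL S' in auto)
  with E_Compl[OF assms(2) aL] show ?thesis
    by auto
qed

lemma act_commute:
  assumes "u \<in> D" "S \<in> sets borel"
  shows "AE x in M. act (E S u) x = E S (act u) x"
proof -
  have S': "- S \<in> sets borel" using assms by auto
  let ?y = "E S u" and ?z = "E (- S) u"
  have D: "?y \<in> D" "?z \<in> D" using assms S' by (auto intro: D_E)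
  have L: "u \<in> L2_space M" "?y \<in> L2_space M" "?z \<in> L2_space M"
      "act ?y \<in> L2_space M" "act ?z \<in> L2_space M" "act u \<in> L2_space M"
    using assms D by (auto simp: D_L2 act_L2)
  let ?s = "\<lambda>x. 1 * ?y x + 1 * ?z x"
  have sL: "?s \<in> L2_space M" using L by (intro L2_lincomb)
  have us: "AE x in M. u x = ?s x" using E_Compl[OF assms(2) L(1)] by simp
  have sD: "?s \<in> D" using D_cong[OF assms(1) sL us] .
  have "AE x in M. act u x = act ?s x" by (rule act_cong) fact+
  with act_lincomb[OF D, of 1 1]
  have "AE x in M. act u x = 1 * act ?y x + 1 * act ?z x" by auto
  then have "AE x in M. E S (act u) x = E S (\<lambda>x. 1 * act ?y x + 1 * act ?z x) x"
    using L assms by (intro E_cong L2_lincomb) auto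
  moreover have "AE x in M. E S (\<lambda>x. 1 * act ?y x + 1 * act ?z x) x =
      1 * E S (act ?y) x + 1 * E S (act ?z) x"
    using L assms by (intro E_lincomb)
  moreover have "ran S (act ?y)"
    using assms D L by (intro ran_act ran_subset) auto
  moreover have "AE x in M. E S (act ?z) x = 0"
  proof (rule E_eq_0_if_ran)
    show "ran (- S) (act ?z)"
      using S' D L by (intro ran_act ran_subset) auto
  qed (use assms S' L in auto)
  ultimately show ?thesis by auto
qed

lemma form_shifted:
  assumes "w \<in> D"
  shows "Re (ip M w (\<lambda>t. act w t - complex_of_real c * w t)) = (LINT t|scalar_measure M E w. t - c)"
proof -
  interpret finite_measure "scalar_measure M E w"
    using assms by (intro finite_scalar_measure D_L2)
  have "ip M w (\<lambda>t. act w t - complex_of_real c * w t) =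
      ip M w (act w) - complex_of_real c * ip M w w"
    using ip_lincomb_right[of w M "act w" w 1 "- complex_of_real c"] assms
    by (simp add: D_L2 act_L2)
  then show ?thesis
    using assms integrable_id[OF assms]
    by (simp add: act_form ip_self_nrm measure_scalar_measure_UNIV[symmetric] D_L2)
qed

lemma form_bounds:
  assumes "w \<in> D" "S \<in> sets borel" "ran S w"
  shows "(\<And>t. t \<in> S \<Longrightarrow> e \<le> t) \<Longrightarrow>
      (e - c) * (nrm M w)\<^sup>2 \<le> Re (ip M w (\<lambda>t. act w t - complex_of_real c * w t))"
    and "(\<And>t. t \<in> S \<Longrightarrow> t \<le> d) \<Longrightarrow>
      Re (ip M w (\<lambda>t. act w t - complex_of_real c * w t)) \<le> (d - c) * (nrm M w)\<^sup>2"
proof -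
  interpret finite_measure "scalar_measure M E w"
    using assms by (intro finite_scalar_measure D_L2)
  have const: "(LINT t|scalar_measure M E w. b) = b * (nrm M w)\<^sup>2" for b :: real
    using assms by (simp add: measure_scalar_measure_UNIV D_L2 mult.commute)
  have ae: "AE t in scalar_measure M E w. t \<in> S"
    using assms by (intro AE_scalar_measure_in) (auto simp: D_L2)
  have int: "integrable (scalar_measure M E w) (\<lambda>t. t - c)"
    using integrable_id[OF assms(1)] by simp
  show "(e - c) * (nrm M w)\<^sup>2 \<le> Re (ip M w (\<lambda>t. act w t - complex_of_real c * w t))"
    if "\<And>t. t \<in> S \<Longrightarrow> e \<le> t"
    unfolding form_shifted[OF assms(1)] const[symmetric]
    using ae that by (intro integral_mono_AE int) auto
  show "Re (ip M w (\<lambda>t. act w t - complex_of_real c * w t)) \<le> (d - c) * (nrm M w)\<^sup>2"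
    if "\<And>t. t \<in> S \<Longrightarrow> t \<le> d"
    unfolding form_shifted[OF assms(1)] const[symmetric]
    using ae that by (intro integral_mono_AE int) auto
qed

text \<open>
  On the range of \<open>E[c,d]\<close> the form \<open>q\<close> of \<open>A - c\<close> satisfies \<open>0 \<le> q(w) \<le> (d - c) \<parallel>w\<parallel>\<^sup>2\<close>. With
  \<open>y = (A - c) x\<close>, positivity of \<open>q\<close> at \<open>x - y / (d - c)\<close> yields \<open>\<parallel>y\<parallel>\<^sup>2 \<le> (d - c) q(x)\<close>.
\<close>
lemma nrm_shifted_le:
  assumes "c < d" "x \<in> L2_space M" "ran {c..d} x"
  shows "x \<in> D"
    and "ran {c..d} (\<lambda>t. act x t - complex_of_real c * x t)"
    and "nrm M (\<lambda>t. act x t - complex_of_real c * x t) \<le> (d - c) * nrm M x"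
proof -
  let ?I = "{c..d}"
  have dom: "z \<in> D" if "z \<in> L2_space M" "ran ?I z" for z
    using D_cong[OF D_bounded[of z ?I c d]] that by auto
  have comb: "ran ?I (\<lambda>t. z t + a * z' t)"
    if "z \<in> L2_space M" "ran ?I z" "z' \<in> L2_space M" "ran ?I z'" for z z' a
    using E_lincomb[of ?I z z' 1 a] that by auto
  show xD: "x \<in> D" using dom assms by blast
  define y where "y = (\<lambda>t. act x t - complex_of_real c * x t)"
  have ax: "act x \<in> L2_space M" "ran ?I (act x)"
    using xD ran_act[OF xD _ assms(3)] by (auto simp: act_L2)
  have yL: "y \<in> L2_space M"
    unfolding y_def using ax assms by (intro L2_diff L2_scale)
  have y: "ran ?I y"
    using comb[OF ax assms(2,3), of "- complex_of_real c"] by (simp add: y_def)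
  then show "ran {c..d} (\<lambda>t. act x t - complex_of_real c * x t)"
    by (simp add: y_def)
  have yD: "y \<in> D" using dom yL y by blast
  define q where "q z = Re (ip M z (\<lambda>t. act z t - complex_of_real c * z t))" for z
  have q: "0 \<le> q z" "q z \<le> (d - c) * (nrm M z)\<^sup>2" if "z \<in> L2_space M" "ran ?I z" for z
  proof -
    have "(c - c) * (nrm M z)\<^sup>2 \<le> q z"
      unfolding q_def by (rule form_bounds(1)[OF dom[OF that] _ that(2)]) auto
    then show "0 \<le> q z" by simp
    show "q z \<le> (d - c) * (nrm M z)\<^sup>2"
      unfolding q_def by (rule form_bounds(2)[OF dom[OF that] _ that(2)]) auto
  qed
  have sym: "ip M x (act y) = ip M (act x) y"
    by (intro act_sym[OF xD yD] dom L2_add[OF assms(2) L2_scale[OF yL]] comb[OF assms(2,3) yL y])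
  \<comment> \<open>This \<open>s\<close> minimizes the bound \<open>q x + 2 s \<parallel>y\<parallel>\<^sup>2 + s\<^sup>2 (d - c) \<parallel>y\<parallel>\<^sup>2\<close> for \<open>q (x + s y)\<close>.\<close>
  define s where "s = - 1 / (d - c)"
  let ?w = "\<lambda>t. x t + complex_of_real s * y t"
  have wL: "?w \<in> L2_space M" and w: "ran ?I ?w"
    by (intro L2_add[OF assms(2) L2_scale[OF yL]] comb[OF assms(2,3) yL y])+
  have wD: "?w \<in> D" using dom wL w by blast
  have form: "q z = Re (ip M z (act z)) - c * (nrm M z)\<^sup>2" if "z \<in> D" for z
    using ip_lincomb_right[of z M "act z" z 1 "- complex_of_real c"] that
    by (simp add: q_def D_L2 act_L2 ip_self_nrm)
  have cross: "Re (ip M x (act y)) = (nrm M y)\<^sup>2 + c * Re (ip M x y)"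
  proof -
    have "ip M y y = ip M (act x) y - complex_of_real c * ip M x y"
      using ip_lincomb_left[of y M "act x" x 1 "- complex_of_real c"] yL ax assms
      by (simp add: y_def)
    from arg_cong[OF this, of Re] show ?thesis
      by (simp add: ip_self_nrm sym)
  qed
  have "q ?w = q x + 2 * s * (nrm M y)\<^sup>2 + s\<^sup>2 * q y"
  proof -
    have "Re (ip M y (act x)) = Re (ip M x (act y))"
      using arg_cong[OF ip_cnj[of M y "act x"], of Re] by (simp add: sym)
    then have "Re (ip M ?w (act ?w)) = Re (ip M x (act x)) + 2 * s * Re (ip M x (act y))
        + s\<^sup>2 * Re (ip M y (act y))"
      using arg_cong[OF act_form_expand[OF xD yD wD], of Re] by (simp add: power2_eq_square)
    moreover have "(nrm M ?w)\<^sup>2 = (nrm M x)\<^sup>2 + 2 * s * Re (ip M x y) + s\<^sup>2 * (nrm M y)\<^sup>2"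
      using assms yL nrm_add_sq[of x M "\<lambda>t. complex_of_real s * y t"]
      by (simp add: L2_scale ip_scale_right nrm_scale power_mult_distrib)
    ultimately show ?thesis
      by (simp add: form wD xD yD cross algebra_simps)
  qed
  with q(1)[OF wL w] have 0: "0 \<le> q x + 2 * s * (nrm M y)\<^sup>2 + s\<^sup>2 * q y" by simp
  have "s\<^sup>2 * q y \<le> s\<^sup>2 * ((d - c) * (nrm M y)\<^sup>2)"
    by (intro mult_left_mono q yL y) simp
  also have "\<dots> = - s * (nrm M y)\<^sup>2"
    using assms by (simp add: s_def power2_eq_square)
  finally have "- s * (nrm M y)\<^sup>2 \<le> q x"
    using 0 by linarith
  then have "(nrm M y)\<^sup>2 \<le> (d - c) * q x"
    using assms by (simp add: s_def field_simps)
  also have "\<dots> \<le> (d - c) * ((d - c) * (nrm M x)\<^sup>2)"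
    using assms by (intro mult_left_mono q) auto
  also have "\<dots> = ((d - c) * nrm M x)\<^sup>2"
    by (simp add: power2_eq_square)
  finally have "nrm M y \<le> (d - c) * nrm M x"
    by (rule power2_le_imp_le) (use assms in simp)
  then show "nrm M (\<lambda>t. act x t - complex_of_real c * x t) \<le> (d - c) * nrm M x"
    by (simp add: y_def)
qed

lemma nrm_shifted_ge:
  assumes "y \<in> D" "ran {e..} y"
  shows "(e - c) * nrm M y \<le> nrm M (\<lambda>t. act y t - complex_of_real c * y t)"
proof -
  let ?z = "\<lambda>t. act y t - complex_of_real c * y t"
  have L: "y \<in> L2_space M" "?z \<in> L2_space M"
    using assms by (auto intro!: L2_diff L2_scale act_L2 intro: D_L2)
  have "(e - c) * (nrm M y)\<^sup>2 \<le> Re (ip M y ?z)"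
    using form_bounds(1)[OF assms(1) _ assms(2), of e c] by simp
  also have "\<dots> \<le> nrm M y * nrm M ?z"
    using Cauchy_Schwarz_L2[OF L] complex_Re_le_cmod order_trans by blast
  finally show ?thesis
    by (rule cancel_square_le) simp_all
qed

end

lemma power_le_imp_zero:
  fixes a b p q :: real
  assumes "0 < p" "p < q" "0 \<le> a" "\<And>k. q ^ k * a \<le> p ^ k * b"
  shows "a = 0"
proof (rule ccontr)
  assume "a \<noteq> 0"
  with assms have a: "a > 0" by simp
  obtain k where k: "b / a < (q / p) ^ k"
    using real_arch_pow[of "q / p" "b / a"] assms by auto
  have "p ^ k * b < q ^ k * a"
    using k a assms by (simp add: power_divide field_simps)
  with assms(4)[of k] show False by simp
qed

text \<open>
  The iterates \<open>(A - c)\<^sup>k x\<close> stay in the range of \<open>E[c,d]\<close> and grow at most like \<open>(d - c)\<^sup>k\<close>. Because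
  \<open>F\<close> commutes with \<open>A\<close>, their projections by \<open>F[e,\<infinity>)\<close> are the iterates of \<open>F[e,\<infinity>) x\<close>, which grow at
  least like \<open>(e - c)\<^sup>k\<close>.
\<close>
lemma spectral_ranges_separated:
  assumes "spectral_decomposition M E A" "spectral_decomposition M F A"
    and "c < d" "d < e" "x \<in> L2_space M" "AE t in M. E {c..d} x t = x t"
  shows "AE t in M. F {e..} x t = 0"
proof -
  interpret E: spectral_decomposition M E A by fact
  interpret F: spectral_decomposition M F A by fact
  define X where "X k = ((\<lambda>w t. E.act w t - complex_of_real c * w t) ^^ k) x" for k
  have X_Suc: "X (Suc k) = (\<lambda>t. E.act (X k) t - complex_of_real c * X k t)" for k
    by (simp add: X_def)
  have X0: "X 0 = x" by (simp add: X_def)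
  have X: "X k \<in> L2_space M \<and> E.ran {c..d} (X k) \<and> X k \<in> E.D \<and> nrm M (X k) \<le> (d - c) ^ k * nrm M x" for k
  proof (induction k)
    case 0
    show ?case using assms E.nrm_shifted_le(1) by (simp add: X0)
  next
    case (Suc k)
    then have L: "X (Suc k) \<in> L2_space M"
      unfolding X_Suc by (auto intro!: L2_diff L2_scale E.act_L2)
    moreover have r: "E.ran {c..d} (X (Suc k))"
      unfolding X_Suc using Suc assms by (intro E.nrm_shifted_le) auto
    moreover have "nrm M (X (Suc k)) \<le> (d - c) * nrm M (X k)"
      unfolding X_Suc using Suc assms by (intro E.nrm_shifted_le) auto
    moreover have "\<dots> \<le> (d - c) * ((d - c) ^ k * nrm M x)"
      using Suc assms by (intro mult_left_mono) auto
    ultimately show ?case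
      using E.nrm_shifted_le(1)[OF assms(3) L r] by simp
  qed
  have F: "(e - c) ^ k * nrm M (F {e..} x) \<le> nrm M (F {e..} (X k))" for k
  proof (induction k)
    case 0
    show ?case by (simp add: X0)
  next
    case (Suc k)
    let ?y = "F {e..} (X k)"
    have D: "X k \<in> F.D" "?y \<in> F.D" and L: "X k \<in> L2_space M" "F.act (X k) \<in> L2_space M"
      using X[of k] by (auto intro: F.D_E F.act_L2)
    have "(e - c) ^ Suc k * nrm M (F {e..} x) \<le> (e - c) * nrm M ?y"
      using Suc assms by (simp add: mult.assoc mult_left_mono)
    also have "\<dots> \<le> nrm M (\<lambda>t. F.act ?y t - complex_of_real c * ?y t)"
      using D L by (intro F.nrm_shifted_ge F.ran_subset) auto
    also have "\<dots> = nrm M (F {e..} (X (Suc k)))"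
    proof (rule nrm_cong_AE)
      show "AE t in M. F.act ?y t - complex_of_real c * ?y t = F {e..} (X (Suc k)) t"
        using F.act_commute[OF D(1), of "{e..}"] F.E_lincomb[OF _ L(2,1), of "{e..}" 1 "- complex_of_real c"]
        by (auto simp: X_Suc)
    qed (use X[of "Suc k"] D L in \<open>auto intro!: L2_diff L2_scale F.act_L2\<close>)
    finally show ?case .
  qed
  have "nrm M (F {e..} x) = 0"
  proof (rule power_le_imp_zero[of "d - c" "e - c"])
    fix k
    have "nrm M (F {e..} (X k)) \<le> nrm M (X k)"
      by (rule F.E_contraction) (use X[of k] in auto)
    with F[of k] X[of k] show "(e - c) ^ k * nrm M (F {e..} x) \<le> (d - c) ^ k * nrm M x"
      by linarith
  qed (use assms(3,4) in auto)
  then show ?thesis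
    using nrm_eq_0_iff[of "F {e..} x" M] assms(5) by simp
qed

text \<open>
  Exhausting \<open>(-\<infinity>,d]\<close> by the intervals \<open>[d - 1 - n,d]\<close> and \<open>(d,\<infinity>)\<close> by \<open>[d + 1/(n+1),\<infinity>)\<close> reduces the
  claim to separated intervals.
\<close>
lemma spectral_projections_orthogonal:
  assumes "spectral_decomposition M E A" "spectral_decomposition M F A"
    and "u \<in> L2_space M" "v \<in> L2_space M"
  shows "ip M (E {..d} u) (F {d<..} v) = 0"
proof -
  interpret E: spectral_decomposition M E A by fact
  interpret F: spectral_decomposition M F A by fact
  have 1: "ip M (F {e..} v) (E {c..d} u) = 0" if "c < d" "d < e" for c e
  proof -
    have "AE t in M. F {e..} (E {c..d} u) t = 0"
      by (rule spectral_ranges_separated[OF assms(1,2) that E.E_L2 E.E_idem]) (simp_all add: assms(3))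
    then have "ip M v (F {e..} (E {c..d} u)) = ip M v (\<lambda>_. 0)"
      using assms(3,4) by (intro ip_cong_AE) (auto simp: L2_zero)
    then show ?thesis
      using assms(3,4) by (simp add: F.E_sym ip_zero_right)
  qed
  have 2: "ip M (F {e..} v) (E {..d} u) = 0" if "d < e" for e
  proof -
    have "(\<lambda>n::nat. ip M (F {e..} v) (E {d - 1 - real n..d} u)) \<longlonglongrightarrow>
        ip M (F {e..} v) (E (\<Union>n::nat. {d - 1 - real n..d}) u)"
      using assms(3,4) by (intro E.E_continuous) (auto simp: incseq_def)
    moreover have "(\<Union>n::nat. {d - 1 - real n..d}) = {..d}"
    proof -
      have "\<exists>n::nat. d - 1 - real n \<le> x" for x
        using real_nat_ceiling_ge[of "d - 1 - x"] by (intro exI[of _ "nat \<lceil>d - 1 - x\<rceil>"]) linarith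
      then show ?thesis by auto
    qed
    ultimately show ?thesis
      using 1[OF _ that] by (simp add: LIMSEQ_const_iff)
  qed
  have "(\<lambda>n::nat. ip M (E {..d} u) (F {d + 1 / real (Suc n)..} v)) \<longlonglongrightarrow>
      ip M (E {..d} u) (F (\<Union>n::nat. {d + 1 / real (Suc n)..}) v)"
    using assms(3,4) by (intro F.E_continuous) (auto simp: incseq_def intro: order_trans[rotated] divide_left_mono)
  moreover have "(\<Union>n::nat. {d + 1 / real (Suc n)..}) = {d<..}"
  proof -
    have "\<exists>n. d + 1 / real (Suc n) \<le> x" if x: "d < x" for x
    proof -
      obtain n where "inverse (real (Suc n)) < x - d"
        using reals_Archimedean[of "x - d"] x by (auto simp del: of_nat_Suc)
      then have "d + 1 / real (Suc n) \<le> x"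
        unfolding inverse_eq_divide by linarith
      then show ?thesis ..
    qed
    moreover have "d < x" if "d + 1 / real (Suc n) \<le> x" for x n
      using that by (rule less_le_trans[rotated]) simp
    ultimately show ?thesis by (auto simp del: of_nat_Suc)
  qed
  moreover have "ip M (E {..d} u) (F {d + 1 / real (Suc n)..} v) = 0" for n
    using 2[of "d + 1 / real (Suc n)"] by (metis complex_cnj_zero ip_cnj less_add_same_cancel1 of_nat_0_less_iff zero_less_Suc zero_less_divide_1_iff)
  ultimately show ?thesis
    by (simp add: LIMSEQ_const_iff)
qed

text \<open>
  By orthogonality of \<open>E(-\<infinity>,d]\<close> and \<open>F(d,\<infinity>)\<close>, and with \<open>E\<close> and \<open>F\<close> exchanged,
  \<open>\<langle>u, F(d,\<infinity>) u\<rangle> = \<langle>E(d,\<infinity>) u, F(d,\<infinity>) u\<rangle> = \<langle>E(d,\<infinity>) u, u\<rangle>\<close>. Half-lines determine a finite measure.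
\<close>
theorem scalar_measure_unique:
  assumes "spectral_decomposition M E A" "spectral_decomposition M F A" "u \<in> L2_space M"
  shows "scalar_measure M E u = scalar_measure M F u"
proof (rule measure_eqI_lessThan)
  interpret E: spectral_decomposition M E A by fact
  interpret F: spectral_decomposition M F A by fact
  fix d :: real
  note u = assms(3)
  have C: "- {d<..} = {..d}" by auto
  have uE: "AE x in M. u x = E {d<..} u x + E {..d} u x"
    and uF: "AE x in M. u x = F {d<..} u x + F {..d} u x"
    using E.E_Compl[of "{d<..}" u] F.E_Compl[of "{d<..}" u] u by (simp_all add: C)
  have "ip M u (F {d<..} u) = ip M (\<lambda>x. 1 * E {d<..} u x + 1 * E {..d} u x) (F {d<..} u)"
    using u uE by (intro ip_cong_AE) (auto intro!: L2_lincomb L2_add)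
  also have "\<dots> = ip M (E {d<..} u) (F {d<..} u)"
    using u spectral_projections_orthogonal[OF assms(1,2) u u] by (subst ip_lincomb_left) auto
  also have "\<dots> = ip M (E {d<..} u) (\<lambda>x. 1 * F {d<..} u x + 1 * F {..d} u x)"
    using u spectral_projections_orthogonal[OF assms(2,1) u u, of d, THEN arg_cong[where f=cnj]]
    by (subst ip_lincomb_right) (auto simp: ip_cnj)
  also have "\<dots> = ip M (E {d<..} u) u"
    using u uF by (intro ip_cong_AE) (auto intro!: L2_lincomb L2_add)
  also have "\<dots> = ip M u (E {d<..} u)"
    using u by (simp add: E.E_sym)
  finally show "emeasure (scalar_measure M E u) {d<..} = emeasure (scalar_measure M F u) {d<..}"
    using u by (simp add: E.emeasure_scalar_measure F.emeasure_scalar_measure E.ip_E_self F.ip_E_self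
        flip: of_real_power)
  show "emeasure (scalar_measure M E u) {d<..} < \<infinity>"
    using u by (simp add: E.emeasure_scalar_measure)
  show "sets (scalar_measure M E u) = sets borel" "sets (scalar_measure M F u) = sets borel"
    by simp_all
qed

section \<open>Functions of diagonalized operators\<close>

text \<open>
  Spectral integrals refer to \<open>E\<close> only through the scalar measures, which do not depend on the choice
  of \<open>E\<close>. An everywhere defined linear operator is determined by its quadratic form.
\<close>
lemma op_fun_eqI:
  assumes "spectral_measure M A E" "spectral_integral M E f B" "fst B = L2_space M"
  shows "op_eq M (op_fun M A f) B"
    and "u \<in> L2_space M \<Longrightarrow> snd (op_fun M A f) u \<in> L2_space M"
proof -
  define B' where "B' = op_fun M A f"
  have "\<exists>E. spectral_measure M A E \<and> spectral_integral M E f B'"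
    unfolding B'_def op_fun_def by (rule someI[where x=B]) (use assms in blast)
  then obtain E' where E': "spectral_measure M A E'" "spectral_integral M E' f B'"
    by blast
  have sd: "spectral_decomposition M E A" "spectral_decomposition M E' A"
    using assms(1) E'(1) by (auto simp: spectral_measure_def spectral_decomposition_def pvm_def
        spectral_decomposition_axioms_def)
  have eq: "scalar_measure M E' u = scalar_measure M E u" if "u \<in> L2_space M" for u
    using scalar_measure_unique[OF sd(2,1) that] .
  have fst: "fst B' = L2_space M"
    using assms(2,3) E'(2) eq by (auto simp: spectral_integral_def)
  have L: "snd B u \<in> L2_space M" "snd B' u \<in> L2_space M" if "u \<in> L2_space M" for u
    using that assms(2,3) E'(2) fst by (auto simp: spectral_integral_def)
  have form: "ip M u (snd B' u) = ip M u (snd B u)" if "u \<in> L2_space M" for u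
    using that assms(2,3) E'(2) fst eq by (auto simp: spectral_integral_def)
  have expand: "ip M (\<lambda>x. u x + c * v x) (snd C (\<lambda>x. u x + c * v x)) = ip M u (snd C u) +
      (c * ip M u (snd C v) + cnj c * ip M v (snd C u)) + cnj c * c * ip M v (snd C v)"
    if uv: "u \<in> L2_space M" "v \<in> L2_space M" and C: "C = B \<or> C = B'" for u v c C
  proof (rule form_expand)
    have w: "(\<lambda>x. u x + c * v x) \<in> L2_space M" using uv by (intro L2_add L2_scale)
    show "snd C u \<in> L2_space M" "snd C v \<in> L2_space M" "snd C (\<lambda>x. u x + c * v x) \<in> L2_space M"
      using C L uv w by auto
    have "\<forall>u\<in>fst C. \<forall>v\<in>fst C. \<forall>a b. AE x in M.
        snd C (\<lambda>y. a * u y + b * v y) x = a * snd C u x + b * snd C v x"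
      using C assms(2) E'(2) by (auto simp: spectral_integral_def)
    from this[rule_format, of u v 1 c]
    show "AE x in M. snd C (\<lambda>x. u x + c * v x) x = snd C u x + c * snd C v x"
      using uv C assms(3) fst by auto
  qed (rule uv)+
  have "AE x in M. snd B' v x = snd B v x" if v: "v \<in> L2_space M" for v
  proof (rule AE_eq_by_ip)
    fix u assume u: "u \<in> L2_space M"
    have "ip M u (snd B' v) - ip M u (snd B v) = 0"
    proof (rule phases_separate(1))
      fix c :: complex
      have "(\<lambda>x. u x + c * v x) \<in> L2_space M" using u v by (intro L2_add L2_scale)
      from form[OF this] form[OF u] form[OF v]
      show "c * (ip M u (snd B' v) - ip M u (snd B v)) +
          cnj c * (ip M v (snd B' u) - ip M v (snd B u)) = 0"
        using expand[OF u v, of B c] expand[OF u v, of B' c] by (simp add: algebra_simps)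
    qed
    then show "ip M u (snd B' v) = ip M u (snd B v)" by simp
  qed (use v L in auto)
  then show "op_eq M (op_fun M A f) B"
    using fst assms(3) by (simp add: op_eq_def B'_def)
  show "u \<in> L2_space M \<Longrightarrow> snd (op_fun M A f) u \<in> L2_space M"
    using L(2) by (simp add: B'_def)
qed

text \<open>
  The map \<open>V\<close> is unitary with inverse \<open>W\<close>, and multiplication by \<open>h\<close> is the diagonal form of the
  operator under consideration. Linearity of \<open>V\<close> and \<open>W\<close>, and compatibility with equality almost
  everywhere, follow from \<open>V\<close> and \<open>W\<close> being adjoint. The functional calculus \<open>\<Phi>\<close> below admits complex
  functions, since resolvents are needed.
\<close>
locale diagonalization =
  fixes M :: "'a measure" and N :: "'b measure"
    and V :: "('a \<Rightarrow> complex) \<Rightarrow> 'b \<Rightarrow> complex" and W :: "('b \<Rightarrow> complex) \<Rightarrow> 'a \<Rightarrow> complex"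
    and h :: "'b \<Rightarrow> real"
  assumes V_L2[simp]: "u \<in> L2_space M \<Longrightarrow> V u \<in> L2_space N"
    and W_L2[simp]: "v \<in> L2_space N \<Longrightarrow> W v \<in> L2_space M"
    and adjoint: "u \<in> L2_space M \<Longrightarrow> v \<in> L2_space N \<Longrightarrow> ip N (V u) v = ip M u (W v)"
    and WV: "u \<in> L2_space M \<Longrightarrow> AE x in M. W (V u) x = u x"
    and VW: "v \<in> L2_space N \<Longrightarrow> AE x in N. V (W v) x = v x"
    and h_measurable[measurable]: "h \<in> borel_measurable N"
begin

lemma W_cong:
  assumes "u \<in> L2_space N" "v \<in> L2_space N" "AE x in N. u x = v x"
  shows "AE x in M. W u x = W v x"
proof (rule AE_eq_by_ip)
  fix w assume "w \<in> L2_space M"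
  then show "ip M w (W u) = ip M w (W v)"
    using assms ip_cong_AE[of "V w" "V w" N u v] by (simp flip: adjoint)
qed (use assms in auto)

lemma W_lincomb:
  assumes "u \<in> L2_space N" "v \<in> L2_space N"
  shows "AE x in M. W (\<lambda>x. a * u x + b * v x) x = a * W u x + b * W v x"
  by (rule AE_eq_by_ip) (use assms in \<open>auto simp: L2_lincomb ip_lincomb_right simp flip: adjoint\<close>)

lemma adjoint': 
  assumes "u \<in> L2_space M" "v \<in> L2_space N"
  shows "ip N v (V u) = ip M (W v) u"
  using arg_cong[OF adjoint[OF assms], of cnj] by (simp add: ip_cnj)

lemma V_lincomb:
  assumes "u \<in> L2_space M" "v \<in> L2_space M"
  shows "AE x in N. V (\<lambda>x. a * u x + b * v x) x = a * V u x + b * V v x"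
  by (rule AE_eq_by_ip) (use assms in \<open>auto simp: L2_lincomb ip_lincomb_right adjoint'\<close>)

lemma V_cong:
  assumes "u \<in> L2_space M" "v \<in> L2_space M" "AE x in M. u x = v x"
  shows "AE x in N. V u x = V v x"
proof (rule AE_eq_by_ip)
  fix w assume "w \<in> L2_space N"
  then show "ip N w (V u) = ip N w (V v)"
    using assms ip_cong_AE[of "W w" "W w" M u v] by (simp add: adjoint')
qed (use assms in auto)

lemma ip_V: 
  assumes "u \<in> L2_space M" "v \<in> L2_space M" shows "ip N (V u) (V v) = ip M u v"
proof -
  have "ip M u (W (V v)) = ip M u v"
    using assms by (intro ip_cong_AE) (auto intro: WV)
  then show ?thesis using assms by (simp add: adjoint)
qed

lemma nrm_V: "u \<in> L2_space M \<Longrightarrow> nrm N (V u) = nrm M u"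
  by (simp add: nrm_def ip_V)

lemma nrm_W: "v \<in> L2_space N \<Longrightarrow> nrm M (W v) = nrm N v"
  using nrm_V[of "W v"] nrm_cong_AE[OF VW, of v] by simp

definition \<Phi> :: "(real \<Rightarrow> complex) \<Rightarrow> ('a \<Rightarrow> complex) \<Rightarrow> 'a \<Rightarrow> complex" where
  "\<Phi> f u = W (\<lambda>x. f (h x) * V u x)"

lemma bounded_mult_L2:
  assumes "f \<in> borel_measurable borel" "\<And>t. cmod (f t) \<le> C" "v \<in> L2_space N"
  shows "(\<lambda>x. f (h x) * v x) \<in> L2_space N"
    and "nrm N (\<lambda>x. f (h x) * v x) \<le> C * nrm N v"
proof -
  have C: "0 \<le> C" using assms(2)[of 0] norm_ge_zero order_trans by blast
  have m: "(\<lambda>x. f (h x) * v x) \<in> borel_measurable N"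
    using assms by (auto dest: L2_measurable intro!: borel_measurable_times measurable_compose[OF h_measurable])
  have le: "cmod (f (h x) * v x) \<le> cmod (of_real C * v x)" for x
    using assms(2) C by (simp add: norm_mult mult_right_mono)
  have Cv: "(\<lambda>x. complex_of_real C * v x) \<in> L2_space N"
    using assms by (intro L2_scale)
  show "(\<lambda>x. f (h x) * v x) \<in> L2_space N"
    by (rule L2_dominated[OF m L2_integrable_sq[OF Cv]]) (use le in \<open>auto intro: power_mono\<close>)
  have "nrm N (\<lambda>x. f (h x) * v x) \<le> nrm N (\<lambda>x. complex_of_real C * v x)"
    using le by (intro nrm_mono Cv m) auto
  then show "nrm N (\<lambda>x. f (h x) * v x) \<le> C * nrm N v"
    using C by (simp add: nrm_scale)
qed

lemma \<Phi>_L2: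
  assumes "f \<in> borel_measurable borel" "\<And>t. cmod (f t) \<le> C" "u \<in> L2_space M"
  shows "\<Phi> f u \<in> L2_space M"
  unfolding \<Phi>_def by (intro W_L2 bounded_mult_L2[OF assms(1,2)] V_L2 assms)

lemma nrm_\<Phi>_le:
  assumes "f \<in> borel_measurable borel" "\<And>t. cmod (f t) \<le> C" "u \<in> L2_space M"
  shows "nrm M (\<Phi> f u) \<le> C * nrm M u"
  using bounded_mult_L2[OF assms(1,2) V_L2[OF assms(3)]] assms(3) by (simp add: \<Phi>_def nrm_W nrm_V)

lemma V_\<Phi>:
  assumes "f \<in> borel_measurable borel" "\<And>t. cmod (f t) \<le> C" "u \<in> L2_space M"
  shows "AE x in N. V (\<Phi> f u) x = f (h x) * V u x"
  unfolding \<Phi>_def by (intro VW bounded_mult_L2[OF assms(1,2)] V_L2 assms)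

lemma \<Phi>_mult:
  assumes f: "f \<in> borel_measurable borel" "\<And>t. cmod (f t) \<le> C"
    and g: "g \<in> borel_measurable borel" "\<And>t. cmod (g t) \<le> C'" and "u \<in> L2_space M"
  shows "AE x in M. \<Phi> f (\<Phi> g u) x = \<Phi> (\<lambda>t. f t * g t) u x"
proof -
  have fg: "(\<lambda>x. f (h x) * (g (h x) * V u x)) \<in> L2_space N"
    by (intro bounded_mult_L2[OF f] bounded_mult_L2[OF g] V_L2 assms)
  have "AE x in M. W (\<lambda>x. f (h x) * V (\<Phi> g u) x) x = W (\<lambda>x. f (h x) * (g (h x) * V u x)) x"
  proof (rule W_cong[OF _ fg])
    show "(\<lambda>x. f (h x) * V (\<Phi> g u) x) \<in> L2_space N"
      by (intro bounded_mult_L2[OF f] V_L2 \<Phi>_L2[OF g] assms)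
    show "AE x in N. f (h x) * V (\<Phi> g u) x = f (h x) * (g (h x) * V u x)"
      using V_\<Phi>[OF g assms(5)] by eventually_elim simp
  qed
  then show ?thesis
    by (simp add: \<Phi>_def mult.assoc)
qed

lemma \<Phi>_lincomb:
  assumes f: "f \<in> borel_measurable borel" "\<And>t. cmod (f t) \<le> C"
    and g: "g \<in> borel_measurable borel" "\<And>t. cmod (g t) \<le> C'" and "u \<in> L2_space M"
  shows "AE x in M. \<Phi> (\<lambda>t. a * f t + b * g t) u x = a * \<Phi> f u x + b * \<Phi> g u x"
  using W_lincomb[OF bounded_mult_L2(1)[OF f V_L2[OF assms(5)]] bounded_mult_L2(1)[OF g V_L2[OF assms(5)]], of a b]
  by (simp add: \<Phi>_def algebra_simps)

lemma ip_\<Phi>: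
  assumes "f \<in> borel_measurable borel" "\<And>t. cmod (f t) \<le> C" "u \<in> L2_space M" "v \<in> L2_space M"
  shows "ip M u (\<Phi> f v) = (LINT x|N. f (h x) * (cnj (V u x) * V v x))"
proof -
  have "ip M u (\<Phi> f v) = ip N (V u) (\<lambda>x. f (h x) * V v x)"
    unfolding \<Phi>_def by (intro adjoint[symmetric] bounded_mult_L2[OF assms(1,2)] V_L2 assms)
  then show ?thesis
    by (simp add: ip_def mult_ac)
qed

abbreviation P :: "real set \<Rightarrow> ('a \<Rightarrow> complex) \<Rightarrow> 'a \<Rightarrow> complex" where
  "P S \<equiv> \<Phi> (indicator S)"

lemma indicator_bounded: "cmod (indicator S t) \<le> 1"
  by (simp split: split_indicator)

lemma pvm_P: "projection_valued_measure M P"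
  unfolding projection_valued_measure_def
proof (intro conjI ballI allI impI)
  fix S :: "real set" and u assume S: "S \<in> sets borel" and u: "u \<in> L2_space M"
  have m: "(indicator S :: real \<Rightarrow> complex) \<in> borel_measurable borel" using S by simp
  note b = m indicator_bounded
  show "P S u \<in> L2_space M" by (intro \<Phi>_L2[OF b] u)
  have "(\<lambda>t. indicator S t * indicator S t :: complex) = indicator S"
    by (auto split: split_indicator)
  then show "AE x in M. P S (P S u) x = P S u x"
    using \<Phi>_mult[OF b b u] by simp
  fix v assume v: "v \<in> L2_space M"
  have "cnj (ip M v (P S u)) = (LINT x|N. cnj (indicator S (h x) * (cnj (V v x) * V u x)))"
    by (subst ip_\<Phi>[OF b v u]) (rule Bochner_Integration.integral_cnj[symmetric])
  also have "\<dots> = ip M u (P S v)"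
    by (subst ip_\<Phi>[OF b u v]) (auto intro!: Bochner_Integration.integral_cong split: split_indicator)
  finally show "ip M u (P S v) = ip M (P S u) v"
    by (simp add: ip_cnj)
next
  fix u assume u: "u \<in> L2_space M"
  then show "AE x in M. P UNIV u x = u x"
    using WV by (simp add: \<Phi>_def)
next
  fix F :: "nat \<Rightarrow> real set" and u v
  assume F: "range F \<subseteq> sets borel" "disjoint_family F" and u: "u \<in> L2_space M" and v: "v \<in> L2_space M"
  have Fk: "F k \<in> sets borel" for k using F by auto
  let ?G = "\<lambda>x. cnj (V u x) * V v x"
  have G: "integrable N ?G" using u v by (intro L2_integrable_prod) auto
  have ipP: "ip M u (P S v) = (LINT x|N. indicator S (h x) * ?G x)" if "S \<in> sets borel" for S
    by (rule ip_\<Phi>[OF _ indicator_bounded u v]) (use that in simp)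
  have int: "integrable N (\<lambda>x. indicator S (h x) * ?G x)" if "S \<in> sets borel" for S
  proof (rule Bochner_Integration.integrable_bound[OF G])
    show "(\<lambda>x. indicator S (h x) * ?G x) \<in> borel_measurable N"
      by (rule borel_measurable_times[OF measurable_compose[OF h_measurable] borel_measurable_integrable[OF G]])
        (use that in simp)
  qed (auto split: split_indicator)
  have "(\<lambda>n. LINT x|N. indicator (\<Union>k<n. F k) (h x) * ?G x) \<longlonglongrightarrow>
      (LINT x|N. indicator (\<Union>k. F k) (h x) * ?G x)"
  proof (rule integral_dominated_convergence[where w = "\<lambda>x. cmod (?G x)"])
    show "AE x in N. (\<lambda>n. indicator (\<Union>k<n. F k) (h x) * ?G x) \<longlonglongrightarrow>
        indicator (\<Union>k. F k) (h x) * ?G x"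
      by (intro AE_I2 tendsto_mult LIMSEQ_indicator_UN tendsto_const)
  qed (use Fk int G in \<open>auto split: split_indicator intro!: borel_measurable_integrable\<close>)
  moreover have "(LINT x|N. indicator (\<Union>k<n. F k) (h x) * ?G x) = (\<Sum>k<n. ip M u (P (F k) v))" for n
  proof -
    have "disjoint_family_on F {..<n}" using F(2) disjoint_family_on_mono by blast
    then have "(LINT x|N. indicator (\<Union>k<n. F k) (h x) * ?G x) =
        (LINT x|N. (\<Sum>k<n. indicator (F k) (h x) * ?G x))"
      by (simp add: indicator_UN_disjoint sum_distrib_right)
    also have "\<dots> = (\<Sum>k<n. ip M u (P (F k) v))"
      using int Fk by (subst Bochner_Integration.integral_sum) (auto simp: ipP)
    finally show ?thesis .
  qed
  ultimately show "(\<lambda>k. ip M u (P (F k) v)) sums ip M u (P (\<Union>k. F k) v)"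
    unfolding sums_def using Fk by (simp add: ipP)
qed

text \<open>
  The scalar measure of \<open>u\<close> is the distribution of \<open>h\<close> under the density \<open>\<bar>V u\<bar>\<^sup>2\<close>, so spectral
  integrals become integrals over the diagonalizing space.
\<close>
lemma scalar_measure_P:
  assumes "u \<in> L2_space M"
  shows "scalar_measure M P u = distr (density N (\<lambda>x. ennreal ((cmod (V u x))\<^sup>2))) borel h"
proof (rule measure_eqI)
  interpret P: pvm M P by unfold_locales (rule pvm_P)
  have Vm[measurable]: "V u \<in> borel_measurable N" using assms by (simp add: L2_measurable)
  show "sets (scalar_measure M P u) =
    sets (distr (density N (\<lambda>x. ennreal ((cmod (V u x))\<^sup>2))) borel h)" by simp
  fix S assume "S \<in> sets (scalar_measure M P u)"
  then have S[measurable]: "S \<in> sets borel" by simp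
  have b: "(indicator S :: real \<Rightarrow> complex) \<in> borel_measurable borel" using S by simp
  have L: "(\<lambda>x. indicator S (h x) * V u x) \<in> L2_space N"
    by (intro bounded_mult_L2[OF b indicator_bounded] V_L2 assms)
  have "emeasure (distr (density N (\<lambda>x. ennreal ((cmod (V u x))\<^sup>2))) borel h) S =
      emeasure (density N (\<lambda>x. ennreal ((cmod (V u x))\<^sup>2))) (h -` S \<inter> space N)"
    by (subst emeasure_distr) auto
  also have "\<dots> = (\<integral>\<^sup>+x. ennreal ((cmod (V u x))\<^sup>2) * indicator (h -` S \<inter> space N) x \<partial>N)"
    by (rule emeasure_density) auto
  also have "\<dots> = (\<integral>\<^sup>+x. ennreal ((cmod (indicator S (h x) * V u x))\<^sup>2) \<partial>N)"
    by (rule nn_integral_cong) (auto split: split_indicator)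
  also have "\<dots> = ennreal (LINT x|N. (cmod (indicator S (h x) * V u x))\<^sup>2)"
    using L by (intro nn_integral_eq_integral L2_integrable_sq) auto
  also have "\<dots> = ennreal ((nrm M (P S u))\<^sup>2)"
    using L by (simp add: \<Phi>_def nrm_W flip: nrm_sq)
  finally show "emeasure (scalar_measure M P u) S =
    emeasure (distr (density N (\<lambda>x. ennreal ((cmod (V u x))\<^sup>2))) borel h) S"
    using assms by (simp add: P.emeasure_scalar_measure)
qed

lemma integral_scalar_measure_P:
  fixes f :: "real \<Rightarrow> real"
  assumes u: "u \<in> L2_space M" and f: "f \<in> borel_measurable borel"
  shows "integrable (scalar_measure M P u) f \<longleftrightarrow> integrable N (\<lambda>x. (cmod (V u x))\<^sup>2 * f (h x))"
    and "(LINT t|scalar_measure M P u. f t) = (LINT x|N. (cmod (V u x))\<^sup>2 * f (h x))"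
proof -
  have [measurable]: "V u \<in> borel_measurable N" using assms by (simp add: L2_measurable)
  note f[measurable]
  show "integrable (scalar_measure M P u) f \<longleftrightarrow> integrable N (\<lambda>x. (cmod (V u x))\<^sup>2 * f (h x))"
    unfolding scalar_measure_P[OF u]
    by (subst integrable_distr_eq) (auto simp: integrable_density)
  show "(LINT t|scalar_measure M P u. f t) = (LINT x|N. (cmod (V u x))\<^sup>2 * f (h x))"
    unfolding scalar_measure_P[OF u]
    by (subst integral_distr) (auto simp: integral_density)
qed

definition represents :: "(real \<Rightarrow> real) \<Rightarrow> 'a l2op \<Rightarrow> bool" where
  "represents f A \<longleftrightarrow>
     fst A = {u \<in> L2_space M. (\<lambda>x. complex_of_real (f (h x)) * V u x) \<in> L2_space N} \<and>
     (\<forall>u\<in>fst A. snd A u \<in> L2_space M \<and>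
        (AE x in M. snd A u x = W (\<lambda>x. complex_of_real (f (h x)) * V u x) x))"

lemma spectral_integral_if_represents:
  assumes f: "f \<in> borel_measurable borel" and A: "represents f A"
  shows "spectral_integral M P f A"
  unfolding spectral_integral_def
proof (intro conjI ballI allI)
  have fst: "fst A = {u \<in> L2_space M. (\<lambda>x. complex_of_real (f (h x)) * V u x) \<in> L2_space N}"
    and L: "\<And>u. u \<in> fst A \<Longrightarrow> snd A u \<in> L2_space M"
    and AE: "\<And>u. u \<in> fst A \<Longrightarrow> AE x in M. snd A u x = W (\<lambda>x. complex_of_real (f (h x)) * V u x) x"
    using A by (auto simp: represents_def)
  note f[measurable]
  have "(\<lambda>x. complex_of_real (f (h x)) * V u x) \<in> L2_space N \<longleftrightarrow>
      integrable (scalar_measure M P u) (\<lambda>t. (f t)\<^sup>2)" if u: "u \<in> L2_space M" for u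
  proof -
    have [measurable]: "V u \<in> borel_measurable N" using u by (simp add: L2_measurable)
    show ?thesis
      using u by (subst integral_scalar_measure_P)
        (auto simp: L2_space_def norm_mult power_mult_distrib mult.commute)
  qed
  then show "fst A = {u \<in> L2_space M. integrable (scalar_measure M P u) (\<lambda>t. (f t)\<^sup>2)}"
    by (auto simp: fst)
  fix u assume u: "u \<in> fst A"
  show "snd A u \<in> L2_space M" using L u .
  let ?fV = "\<lambda>x. complex_of_real (f (h x)) * V u x"
  have uL: "u \<in> L2_space M" "?fV \<in> L2_space N" using u by (auto simp: fst)
  have "ip M u (snd A u) = ip M u (W ?fV)"
    using L[OF u] AE[OF u] uL by (intro ip_cong_AE) auto
  also have "\<dots> = ip N (V u) ?fV" using uL by (simp add: adjoint)
  also have "\<dots> = (LINT x|N. complex_of_real ((cmod (V u x))\<^sup>2 * f (h x)))"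
    unfolding ip_def
    by (rule Bochner_Integration.integral_cong) (simp_all only: of_real_mult complex_norm_square mult_ac)
  also have "\<dots> = complex_of_real (LINT t|scalar_measure M P u. f t)"
    unfolding integral_complex_of_real using uL f by (simp add: integral_scalar_measure_P)
  finally show "ip M u (snd A u) = complex_of_real (LINT t|scalar_measure M P u. f t)" .
  fix v a b assume v: "v \<in> fst A"
  let ?fv = "\<lambda>x. complex_of_real (f (h x)) * V v x"
  have vL: "v \<in> L2_space M" "?fv \<in> L2_space N" using v by (auto simp: fst)
  let ?w = "\<lambda>y. a * u y + b * v y"
  let ?fw = "\<lambda>x. complex_of_real (f (h x)) * V ?w x" and ?fw' = "\<lambda>x. a * ?fV x + b * ?fv x"
  have wL: "?w \<in> L2_space M" using uL vL by (intro L2_lincomb)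
  have [measurable]: "V ?w \<in> borel_measurable N" using wL by (intro L2_measurable V_L2)
  have ww: "AE x in N. ?fw' x = ?fw x"
    using V_lincomb[OF uL(1) vL(1), of a b] by eventually_elim (simp add: algebra_simps)
  have fw'L: "?fw' \<in> L2_space N" using uL vL by (intro L2_lincomb)
  have fwL: "?fw \<in> L2_space N"
    by (rule L2_cong_AE[OF fw'L ww]) simp
  then have w: "?w \<in> fst A" using wL by (simp add: fst)
  from AE[OF w] AE[OF u] AE[OF v] W_cong[OF fw'L fwL ww] W_lincomb[OF uL(2) vL(2), of a b]
  show "AE x in M. snd A ?w x = a * snd A u x + b * snd A v x"
    by eventually_elim simp
qed

lemma op_fun_diagonalized:
  assumes A: "represents (\<lambda>t. t) A" and f: "f \<in> borel_measurable borel" "bounded (range f)"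
  shows "op_eq M (op_fun M A f) (L2_space M, \<Phi> (\<lambda>t. complex_of_real (f t)))"
    and "u \<in> L2_space M \<Longrightarrow> snd (op_fun M A f) u \<in> L2_space M"
proof -
  have E: "spectral_measure M A P"
    unfolding spectral_measure_def
    by (intro conjI pvm_P spectral_integral_if_represents A) simp
  obtain C where C: "\<And>t. \<bar>f t\<bar> \<le> C" using f(2) by (auto simp: bounded_iff)
  have b: "(\<lambda>t. complex_of_real (f t)) \<in> borel_measurable borel" "\<And>t. cmod (complex_of_real (f t)) \<le> C"
    using f(1) C by auto
  have B: "spectral_integral M P f (L2_space M, \<Phi> (\<lambda>t. complex_of_real (f t)))"
  proof (rule spectral_integral_if_represents[OF f(1)])
    show "represents f (L2_space M, \<Phi> (\<lambda>t. complex_of_real (f t)))"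
      using bounded_mult_L2(1)[OF b] \<Phi>_L2[OF b] by (auto simp: represents_def \<Phi>_def)
  qed
  show "op_eq M (op_fun M A f) (L2_space M, \<Phi> (\<lambda>t. complex_of_real (f t)))"
    by (rule op_fun_eqI(1)[OF E B]) simp
  show "u \<in> L2_space M \<Longrightarrow> snd (op_fun M A f) u \<in> L2_space M"
    by (rule op_fun_eqI(2)[OF E B]) simp_all
qed

end

section \<open>Completeness and orthonormal bases\<close>

lemma nn_integral_cmod_sq:
  assumes "u \<in> L2_space M"
  shows "(\<integral>\<^sup>+x. ennreal ((cmod (u x))\<^sup>2) \<partial>M) = ennreal ((nrm M u)\<^sup>2)"
  using L2_integrable_sq[OF assms] by (simp add: nn_integral_eq_integral nrm_sq)

lemma L2_if_nn_integral:
  assumes "u \<in> borel_measurable M" "(\<integral>\<^sup>+x. ennreal ((cmod (u x))\<^sup>2) \<partial>M) \<le> ennreal (C\<^sup>2)" "0 \<le> C"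
  shows "u \<in> L2_space M" "nrm M u \<le> C"
proof -
  have "integrable M (\<lambda>x. (cmod (u x))\<^sup>2)"
  proof (rule integrableI_bounded)
    have "(\<integral>\<^sup>+x. ennreal (norm ((cmod (u x))\<^sup>2)) \<partial>M) \<le> ennreal (C\<^sup>2)"
      using assms(2) by simp
    also have "\<dots> < \<infinity>" by simp
    finally show "(\<integral>\<^sup>+x. ennreal (norm ((cmod (u x))\<^sup>2)) \<partial>M) < \<infinity>" .
  qed (use assms(1) in simp)
  with assms(1) show u: "u \<in> L2_space M" by (rule L2_spaceI)
  have "(nrm M u)\<^sup>2 \<le> C\<^sup>2"
    using assms(2) by (simp add: nn_integral_cmod_sq[OF u])
  then show "nrm M u \<le> C" using assms(3) by (rule power2_le_imp_le)
qed

text \<open>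
  The weights \<open>2\<^sup>k\<close> leave \<open>\<Sum> 2\<^sup>k \<parallel>d\<^sub>k\<parallel>\<^sup>2\<close> finite, so \<open>\<Sum> 2\<^sup>k \<bar>d\<^sub>k(x)\<bar>\<^sup>2\<close> is finite for almost every \<open>x\<close>; and
  \<open>\<bar>d\<bar> \<le> 2\<^sup>k \<bar>d\<bar>\<^sup>2 + 2\<^sup>-\<^sup>k\<close> turns this into absolute summability.
\<close>
lemma AE_summable_if_geometric:
  assumes d: "\<And>k. d k \<in> L2_space M" "\<And>k. nrm M (d k) \<le> (1/2) ^ k"
  shows "AE x in M. summable (\<lambda>k. d k x)"
proof -
  have [measurable]: "d k \<in> borel_measurable M" for k
    using d(1) by (rule L2_measurable)
  let ?e = "\<lambda>k x. 2 ^ k * (cmod (d k x))\<^sup>2"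
  have "(\<integral>\<^sup>+x. ennreal (?e k x) \<partial>M) \<le> ennreal ((1/2) ^ k)" for k
  proof -
    have "(\<integral>\<^sup>+x. ennreal (?e k x) \<partial>M) = ennreal (2 ^ k) * ennreal ((nrm M (d k))\<^sup>2)"
      unfolding nn_integral_cmod_sq[OF d(1), symmetric]
      by (subst nn_integral_cmult[symmetric]) (auto simp: ennreal_mult)
    also have "\<dots> \<le> ennreal (2 ^ k) * ennreal (((1/2) ^ k)\<^sup>2)"
      by (intro mult_left_mono ennreal_leI power_mono d) auto
    also have "\<dots> = ennreal ((1/2) ^ k)"
      by (subst ennreal_mult[symmetric]) (auto simp: power2_eq_square power_mult_distrib[symmetric] mult.assoc[symmetric])
    finally show ?thesis .
  qed
  then have "(\<Sum>k. \<integral>\<^sup>+x. ennreal (?e k x) \<partial>M) \<le> (\<Sum>k. ennreal ((1/2) ^ k))"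
    by (intro suminf_le) auto
  also have "\<dots> = ennreal (\<Sum>k. (1/2) ^ k)"
    by (intro suminf_ennreal2) auto
  finally have "(\<integral>\<^sup>+x. (\<Sum>k. ennreal (?e k x)) \<partial>M) \<noteq> \<infinity>"
    by (subst nn_integral_suminf) (auto simp: top_unique)
  then have "AE x in M. (\<Sum>k. ennreal (?e k x)) \<noteq> \<infinity>"
    by (intro nn_integral_PInf_AE) auto
  then show ?thesis
  proof eventually_elim
    fix x assume "(\<Sum>k. ennreal (?e k x)) \<noteq> \<infinity>"
    then have "summable (\<lambda>k. ?e k x)"
      by (intro summable_suminf_not_top) auto
    then have s: "summable (\<lambda>k. ?e k x + (1/2) ^ k)"
      by (intro summable_add summable_geometric) auto
    have "cmod (d k x) \<le> ?e k x + (1/2) ^ k" for k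
    proof (rule ccontr)
      assume "\<not> cmod (d k x) \<le> ?e k x + (1/2) ^ k"
      moreover have "0 \<le> ?e k x" by simp
      ultimately have 1: "(1/2) ^ k < cmod (d k x)" and 2: "?e k x < cmod (d k x)"
        using zero_le_power[of "1/2::real" k] by linarith+
      have "1 = 2 ^ k * (1/2::real) ^ k" by (simp flip: power_mult_distrib)
      also have "\<dots> < 2 ^ k * cmod (d k x)" using 1 by simp
      finally have "1 * cmod (d k x) \<le> 2 ^ k * cmod (d k x) * cmod (d k x)"
        by (intro mult_right_mono) auto
      with 2 show False by (simp add: power2_eq_square)
    qed
    then show "summable (\<lambda>k. d k x)"
      by (intro summable_comparison_test[OF _ s]) auto
  qed
qed

text \<open>
  A rapidly converging subsequence converges almost everywhere; Fatou's lemma carries the Cauchy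
  estimates over to its limit.
\<close>
theorem L2_complete:
  assumes u: "\<And>n::nat. u n \<in> L2_space M"
    and Cauchy: "\<And>e. 0 < e \<Longrightarrow> \<exists>N. \<forall>m\<ge>N. \<forall>n\<ge>N. nrm M (\<lambda>x. u m x - u n x) \<le> e"
  obtains v where "v \<in> L2_space M" "(\<lambda>n. nrm M (\<lambda>x. u n x - v x)) \<longlonglongrightarrow> 0"
proof -
  have "\<exists>N. \<forall>m\<ge>N. \<forall>n\<ge>N. nrm M (\<lambda>x. u m x - u n x) \<le> (1/2) ^ k" for k
    using Cauchy[of "(1/2) ^ k"] by simp
  then obtain N where N: "\<And>k m n. N k \<le> m \<Longrightarrow> N k \<le> n \<Longrightarrow> nrm M (\<lambda>x. u m x - u n x) \<le> (1/2) ^ k"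
    by metis
  \<comment> \<open>Adding up all \<open>N k\<close> makes the index exceed each of them; the summand \<open>n\<close> lets it tend to infinity.\<close>
  define r where "r n = n + (\<Sum>k\<le>n. N k)" for n
  have rN: "N k \<le> r n" if "k \<le> n" for k n
    using that member_le_sum[of k "{..n}" N] by (simp add: r_def)
  have r_ge: "n \<le> r n" for n by (simp add: r_def)
  define d where "d k x = u (r (Suc k)) x - u (r k) x" for k x
  have "AE x in M. summable (\<lambda>k. d k x)"
    by (rule AE_summable_if_geometric) (use u rN in \<open>auto simp: d_def intro!: L2_diff N\<close>)
  then have conv: "AE x in M. (\<lambda>n. u (r n) x) \<longlonglongrightarrow> lim (\<lambda>n. u (r n) x)"
  proof eventually_elim
    fix x assume "summable (\<lambda>k. d k x)"
    then have "convergent (\<lambda>n. u (r 0) x + (\<Sum>k<n. d k x))"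
      by (intro convergent_add convergent_const) (simp add: summable_iff_convergent)
    also have "(\<lambda>n. u (r 0) x + (\<Sum>k<n. d k x)) = (\<lambda>n. u (r n) x)"
      by (simp add: d_def sum_lessThan_telescope[of "\<lambda>k. u (r k) x"])
    finally show "(\<lambda>n. u (r n) x) \<longlonglongrightarrow> lim (\<lambda>n. u (r n) x)"
      by (simp add: convergent_LIMSEQ_iff)
  qed
  define v where "v x = lim (\<lambda>n. u (r n) x)" for x
  have [measurable]: "u n \<in> borel_measurable M" for n
    using u by (rule L2_measurable)
  have [measurable]: "v \<in> borel_measurable M"
    unfolding v_def by (intro borel_measurable_lim_metric) auto
  have bound: "(\<lambda>x. u m x - v x) \<in> L2_space M" "nrm M (\<lambda>x. u m x - v x) \<le> e"
    if "0 < e" and K: "\<And>n. n \<ge> K \<Longrightarrow> nrm M (\<lambda>x. u m x - u n x) \<le> e" for e m K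
  proof -
    have "(\<integral>\<^sup>+x. ennreal ((cmod (u m x - v x))\<^sup>2) \<partial>M) =
        (\<integral>\<^sup>+x. liminf (\<lambda>n. ennreal ((cmod (u m x - u (r n) x))\<^sup>2)) \<partial>M)"
    proof (rule nn_integral_cong_AE, use conv in eventually_elim)
      fix x assume "(\<lambda>n. u (r n) x) \<longlonglongrightarrow> lim (\<lambda>n. u (r n) x)"
      then have "(\<lambda>n. ennreal ((cmod (u m x - u (r n) x))\<^sup>2)) \<longlonglongrightarrow> ennreal ((cmod (u m x - v x))\<^sup>2)"
        unfolding v_def by (intro tendsto_intros)
      then show "ennreal ((cmod (u m x - v x))\<^sup>2) = liminf (\<lambda>n. ennreal ((cmod (u m x - u (r n) x))\<^sup>2))"
        by (rule lim_imp_Liminf[OF trivial_limit_sequentially, symmetric])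
    qed
    also have "\<dots> \<le> liminf (\<lambda>n. \<integral>\<^sup>+x. ennreal ((cmod (u m x - u (r n) x))\<^sup>2) \<partial>M)"
      by (rule nn_integral_liminf) auto
    also have "\<dots> \<le> ennreal (e\<^sup>2)"
    proof (rule Liminf_le)
      show "\<forall>\<^sub>F n in sequentially. (\<integral>\<^sup>+x. ennreal ((cmod (u m x - u (r n) x))\<^sup>2) \<partial>M) \<le> ennreal (e\<^sup>2)"
      proof (rule eventually_sequentiallyI)
        fix n assume "n \<ge> K"
        then have "nrm M (\<lambda>x. u m x - u (r n) x) \<le> e" using K r_ge order_trans by blast
        then show "(\<integral>\<^sup>+x. ennreal ((cmod (u m x - u (r n) x))\<^sup>2) \<partial>M) \<le> ennreal (e\<^sup>2)"
          using u by (subst nn_integral_cmod_sq) (auto intro!: L2_diff ennreal_leI power_mono)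
      qed
    qed auto
    finally show "(\<lambda>x. u m x - v x) \<in> L2_space M" "nrm M (\<lambda>x. u m x - v x) \<le> e"
      using L2_if_nn_integral[of "\<lambda>x. u m x - v x" M e] \<open>0 < e\<close> by auto
  qed
  show ?thesis
  proof
    have "(\<lambda>x. u (N 0) x - v x) \<in> L2_space M"
      by (rule bound(1)[of 1 "N 0"]) (use N[of 0 "N 0"] in auto)
    from L2_diff[OF u[of "N 0"] this] show "v \<in> L2_space M" by simp
    show "(\<lambda>n. nrm M (\<lambda>x. u n x - v x)) \<longlonglongrightarrow> 0"
    proof (rule LIMSEQ_I)
      fix e :: real assume "0 < e"
      then obtain K where K: "\<And>m n. m \<ge> K \<Longrightarrow> n \<ge> K \<Longrightarrow> nrm M (\<lambda>x. u m x - u n x) \<le> e / 2"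
        using Cauchy[of "e / 2"] by auto
      have "nrm M (\<lambda>x. u n x - v x) \<le> e / 2" if "n \<ge> K" for n
        by (rule bound(2)[of _ K]) (use K that \<open>0 < e\<close> in auto)
      then show "\<exists>K. \<forall>n\<ge>K. norm (nrm M (\<lambda>x. u n x - v x) - 0) < e"
        using \<open>0 < e\<close> by (intro exI[of _ K]) fastforce
    qed
  qed
qed

lemma ell2_iff: "u \<in> L2_space ell2 \<longleftrightarrow> summable (\<lambda>i. (cmod (u i))\<^sup>2)"
  by (simp add: L2_space_def integrable_count_space_nat_iff)

lemma nrm_ell2_sums: "u \<in> L2_space ell2 \<Longrightarrow> (\<lambda>i. (cmod (u i))\<^sup>2) sums (nrm ell2 u)\<^sup>2"
  by (simp add: nrm_sq sums_integral_count_space_nat L2_integrable_sq)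

lemma infsum_ip_ell2:
  assumes "a \<in> L2_space ell2" "v \<in> L2_space ell2"
  shows "(\<lambda>j. cnj (a j) * v j) summable_on UNIV" "(\<Sum>\<^sub>\<infinity>j. cnj (a j) * v j) = ip ell2 a v"
proof -
  have i: "integrable ell2 (\<lambda>j. cnj (a j) * v j)"
    using assms by (rule L2_integrable_prod)
  then have "((\<lambda>j. cnj (a j) * v j) has_sum ip ell2 a v) UNIV"
    unfolding ip_def
    by (intro norm_summable_imp_has_sum sums_integral_count_space_nat)
      (auto simp: integrable_count_space_nat_iff)
  then show "(\<lambda>j. cnj (a j) * v j) summable_on UNIV" "(\<Sum>\<^sub>\<infinity>j. cnj (a j) * v j) = ip ell2 a v"
    by (auto simp: summable_on_def infsumI)
qed

text \<open>
  The index set \<open>I\<close> is a parameter so that the same Bessel computation serves infinite bases and the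
  finite families of eigenvectors of a Hermitian matrix.
\<close>
locale orthonormal_family =
  fixes M :: "'a measure" and I :: "nat set" and \<phi> :: "nat \<Rightarrow> 'a \<Rightarrow> complex"
  assumes \<phi>_L2[simp]: "i \<in> I \<Longrightarrow> \<phi> i \<in> L2_space M"
    and ip_\<phi>: "i \<in> I \<Longrightarrow> j \<in> I \<Longrightarrow> ip M (\<phi> i) (\<phi> j) = (if i = j then 1 else 0)"
begin

definition coef :: "('a \<Rightarrow> complex) \<Rightarrow> nat \<Rightarrow> complex" where
  "coef u i = ip M (\<phi> i) u"

lemma comb_L2[simp]: "J \<subseteq> I \<Longrightarrow> (\<lambda>x. \<Sum>i\<in>J. c i * \<phi> i x) \<in> L2_space M"
  by (intro L2_sum L2_scale \<phi>_L2) auto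

lemma ip_comb:
  assumes "J \<subseteq> I" "u \<in> L2_space M"
  shows "ip M u (\<lambda>x. \<Sum>i\<in>J. c i * \<phi> i x) = (\<Sum>i\<in>J. c i * cnj (coef u i))"
  using assms by (subst ip_sum_right) (auto simp: coef_def ip_cnj)

lemma coef_comb:
  assumes "finite J" "J \<subseteq> I" "j \<in> I"
  shows "coef (\<lambda>x. \<Sum>i\<in>J. c i * \<phi> i x) j = (if j \<in> J then c j else 0)"
proof -
  have "coef (\<lambda>x. \<Sum>i\<in>J. c i * \<phi> i x) j = (\<Sum>i\<in>J. c i * ip M (\<phi> j) (\<phi> i))"
    unfolding coef_def using assms by (intro ip_sum_right) auto
  also have "\<dots> = (\<Sum>i\<in>J. if i = j then c j else 0)"
    using assms by (intro sum.cong) (auto simp: ip_\<phi>)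
  finally show ?thesis using assms by simp
qed

lemma nrm_comb_sq:
  assumes "finite J" "J \<subseteq> I"
  shows "(nrm M (\<lambda>x. \<Sum>i\<in>J. c i * \<phi> i x))\<^sup>2 = (\<Sum>i\<in>J. (cmod (c i))\<^sup>2)"
proof -
  have "complex_of_real ((nrm M (\<lambda>x. \<Sum>i\<in>J. c i * \<phi> i x))\<^sup>2) = (\<Sum>i\<in>J. c i * cnj (c i))"
    unfolding ip_self_nrm[symmetric] using assms
    by (subst ip_comb) (auto simp: coef_comb subset_iff intro!: sum.cong)
  also have "\<dots> = complex_of_real (\<Sum>i\<in>J. (cmod (c i))\<^sup>2)"
    by (simp only: of_real_sum complex_norm_square)
  finally show ?thesis by (simp only: of_real_eq_iff)
qed

lemma nrm_diff_comb_sq: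
  assumes "finite J" "J \<subseteq> I" "u \<in> L2_space M"
  shows "(nrm M (\<lambda>x. u x - (\<Sum>i\<in>J. c i * \<phi> i x)))\<^sup>2 =
    (nrm M u)\<^sup>2 - (\<Sum>i\<in>J. (cmod (coef u i))\<^sup>2) + (\<Sum>i\<in>J. (cmod (coef u i - c i))\<^sup>2)"
proof -
  have "(cmod (a - b))\<^sup>2 = (cmod a)\<^sup>2 - 2 * Re (b * cnj a) + (cmod b)\<^sup>2" for a b
    by (simp add: cmod_power2 power2_diff)
  then show ?thesis
    using assms by (simp add: nrm_diff_sq nrm_comb_sq ip_comb sum.distrib sum_subtractf Re_sum sum_distrib_left)
qed

end

locale orthonormal_basis = orthonormal_family M UNIV \<phi> for M :: "'a measure" and \<phi> +
  assumes dense: "dense_in_L2 M (lin_span \<phi>)"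
begin

lemma coef_lincomb:
  "u \<in> L2_space M \<Longrightarrow> v \<in> L2_space M \<Longrightarrow>
    coef (\<lambda>x. a * u x + b * v x) = (\<lambda>i. a * coef u i + b * coef v i)"
  by (simp add: coef_def ip_lincomb_right fun_eq_iff)

lemma parseval_sums:
  assumes "u \<in> L2_space M"
  shows "(\<lambda>i. (cmod (coef u i))\<^sup>2) sums (nrm M u)\<^sup>2"
  unfolding sums_def
proof (rule LIMSEQ_I)
  fix r :: real assume "0 < r"
  then obtain v where "v \<in> lin_span \<phi>" and v: "nrm M (\<lambda>x. u x - v x) < sqrt r"
    using dense assms unfolding dense_in_L2_def by (metis real_sqrt_gt_zero)
  then obtain n c where vc: "v = (\<lambda>x. \<Sum>i<n. c i * \<phi> i x)"
    by (auto simp: lin_span_def)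
  have "(nrm M (\<lambda>x. u x - v x))\<^sup>2 < r"
    using v \<open>0 < r\<close> power_strict_mono[OF v, of 2] by simp
  moreover have "0 \<le> (\<Sum>i<n. (cmod (coef u i - c i))\<^sup>2)"
    by (intro sum_nonneg) auto
  ultimately have n: "(nrm M u)\<^sup>2 - (\<Sum>i<n. (cmod (coef u i))\<^sup>2) < r"
    using nrm_diff_comb_sq[of "{..<n}" u c] assms by (simp add: vc)
  have "norm ((\<Sum>i<m. (cmod (coef u i))\<^sup>2) - (nrm M u)\<^sup>2) < r" if "m \<ge> n" for m
  proof -
    have "(\<Sum>i<n. (cmod (coef u i))\<^sup>2) \<le> (\<Sum>i<m. (cmod (coef u i))\<^sup>2)"
      using that by (intro sum_mono2) auto
    moreover have "(\<Sum>i<m. (cmod (coef u i))\<^sup>2) \<le> (nrm M u)\<^sup>2"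
      using nrm_diff_comb_sq[of "{..<m}" u "coef u"] assms
        zero_le_power2[of "nrm M (\<lambda>x. u x - (\<Sum>i<m. coef u i * \<phi> i x))"] by simp
    ultimately show ?thesis using n by simp
  qed
  then show "\<exists>n. \<forall>m\<ge>n. norm ((\<Sum>i<m. (cmod (coef u i))\<^sup>2) - (nrm M u)\<^sup>2) < r"
    by blast
qed

lemma coef_ell2[simp]: "u \<in> L2_space M \<Longrightarrow> coef u \<in> L2_space ell2"
  using parseval_sums[of u] by (simp add: ell2_iff sums_iff)

lemma nrm_coef: 
  assumes "u \<in> L2_space M" shows "nrm ell2 (coef u) = nrm M u"
proof -
  have "(nrm ell2 (coef u))\<^sup>2 = (nrm M u)\<^sup>2"
    using sums_unique2[OF nrm_ell2_sums[OF coef_ell2[OF assms]] parseval_sums[OF assms]] .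
  then show ?thesis by (rule power2_eq_imp_eq) auto
qed

text \<open>
  Polarization of \<open>nrm_coef\<close>.
\<close>
lemma ip_coef:
  assumes "u \<in> L2_space M" "v \<in> L2_space M"
  shows "ip ell2 (coef u) (coef v) = ip M u v"
proof -
  have re: "Re (ip ell2 (coef u) (coef v)) = Re (ip M u v)" if "v \<in> L2_space M" for v
  proof -
    have "coef (\<lambda>x. u x + v x) = (\<lambda>i. coef u i + coef v i)"
      using coef_lincomb[OF assms(1) that, of 1 1] by simp
    then have "(nrm ell2 (\<lambda>i. coef u i + coef v i))\<^sup>2 = (nrm M (\<lambda>x. u x + v x))\<^sup>2"
      using nrm_coef[OF L2_add[OF assms(1) that]] by simp
    then show ?thesis
      using assms(1) that by (simp add: nrm_add_sq nrm_coef)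
  qed
  have "coef (\<lambda>x. \<i> * v x) = (\<lambda>i. \<i> * coef v i)"
    by (simp add: coef_def ip_scale_right fun_eq_iff)
  then have "Im (ip ell2 (coef u) (coef v)) = Im (ip M u v)"
    using re[OF L2_scale[OF assms(2), of \<i>]] by (simp add: ip_scale_right)
  with re[OF assms(2)] show ?thesis by (simp add: complex_eq_iff)
qed

lemma AE_eq_if_coef_eq:
  assumes "u \<in> L2_space M" "v \<in> L2_space M" "coef u = coef v"
  shows "AE x in M. u x = v x"
  by (rule AE_eq_by_ip) (use assms in \<open>auto simp flip: ip_coef\<close>)

lemma Riesz_Fischer:
  assumes "c \<in> L2_space ell2"
  obtains u where "u \<in> L2_space M" "coef u = c"
proof -
  define s where "s n x = (\<Sum>i<n. c i * \<phi> i x)" for n x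
  have sL: "s n \<in> L2_space M" for n
    unfolding s_def by (intro comb_L2) auto
  have diff: "(nrm M (\<lambda>x. s m x - s n x))\<^sup>2 = (\<Sum>i\<in>{n..<m}. (cmod (c i))\<^sup>2)" if "n \<le> m" for m n
  proof -
    have "s m x - s n x = (\<Sum>i\<in>{n..<m}. c i * \<phi> i x)" for x
      using that by (simp add: s_def sum_diff_nat_ivl flip: atLeast0LessThan)
    then show ?thesis by (simp add: nrm_comb_sq)
  qed
  have "\<exists>N. \<forall>m\<ge>N. \<forall>n\<ge>N. nrm M (\<lambda>x. s m x - s n x) \<le> e" if "0 < e" for e
  proof -
    have "summable (\<lambda>i. (cmod (c i))\<^sup>2)" using assms by (simp add: ell2_iff)
    moreover have "0 < e\<^sup>2" using \<open>0 < e\<close> by simp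
    ultimately have "\<exists>N. \<forall>m\<ge>N. \<forall>n. norm (\<Sum>i\<in>{m..<n}. (cmod (c i))\<^sup>2) < e\<^sup>2"
      unfolding summable_Cauchy by blast
    then obtain N where N: "\<And>m n. m \<ge> N \<Longrightarrow> norm (\<Sum>i\<in>{m..<n}. (cmod (c i))\<^sup>2) < e\<^sup>2"
      by blast
    have *: "nrm M (\<lambda>x. s m x - s n x) \<le> e" if "n \<le> m" "n \<ge> N" for m n
    proof (rule power2_le_imp_le)
      show "(nrm M (\<lambda>x. s m x - s n x))\<^sup>2 \<le> e\<^sup>2"
        unfolding diff[OF that(1)] using N[OF that(2), of m] by (simp add: abs_less_iff)
    qed (use \<open>0 < e\<close> in simp)
    have "nrm M (\<lambda>x. s m x - s n x) \<le> e" if "m \<ge> N" "n \<ge> N" for m n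
      using *[of n m] *[of m n] that nrm_minus_commute[of M "s m" "s n"]
      by (cases "n \<le> m") auto
    then show ?thesis by blast
  qed
  from L2_complete[of s, OF sL this] obtain u
    where u: "u \<in> L2_space M" "(\<lambda>n. nrm M (\<lambda>x. s n x - u x)) \<longlonglongrightarrow> 0"
    by blast
  have "coef u j = c j" for j
  proof -
    have "(\<lambda>n. coef (s n) j) \<longlonglongrightarrow> coef u j"
    proof (rule LIM_zero_cancel, rule Lim_null_comparison[OF _ u(2)])
      have "cmod (coef (s n) j - coef u j) \<le> nrm M (\<lambda>x. s n x - u x)" for n
      proof -
        have "coef (s n) j - coef u j = ip M (\<phi> j) (\<lambda>x. s n x - u x)"
          using sL u by (simp add: coef_def ip_diff_right)
        moreover have "nrm M (\<phi> j) = 1"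
          by (simp add: nrm_def ip_\<phi>)
        ultimately show ?thesis
          using Cauchy_Schwarz_L2[of "\<phi> j" M "\<lambda>x. s n x - u x"] sL u by (simp add: L2_diff)
      qed
      then show "\<forall>\<^sub>F n in sequentially. norm (coef (s n) j - coef u j) \<le> nrm M (\<lambda>x. s n x - u x)"
        by simp
    qed
    moreover have "(\<lambda>n. coef (s n) j) \<longlonglongrightarrow> c j"
    proof (rule tendsto_eventually, rule eventually_sequentiallyI)
      fix n assume "n \<ge> Suc j"
      then show "coef (s n) j = c j"
        unfolding s_def by (subst coef_comb) auto
    qed
    ultimately show ?thesis by (rule LIMSEQ_unique)
  qed
  then show ?thesis using u(1) that by blast
qed

definition synth :: "(nat \<Rightarrow> complex) \<Rightarrow> 'a \<Rightarrow> complex" where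
  "synth c = (SOME u. u \<in> L2_space M \<and> coef u = c)"

lemma synth:
  assumes "c \<in> L2_space ell2"
  shows "synth c \<in> L2_space M" "coef (synth c) = c"
proof -
  obtain u where "u \<in> L2_space M \<and> coef u = c"
    using Riesz_Fischer[OF assms] by metis
  then have "synth c \<in> L2_space M \<and> coef (synth c) = c"
    unfolding synth_def by (rule someI[where P = "\<lambda>u. u \<in> L2_space M \<and> coef u = c"])
  then show "synth c \<in> L2_space M" "coef (synth c) = c" by auto
qed

lemma diagonalization_synth:
  assumes "g \<in> borel_measurable M"
  shows "diagonalization ell2 M synth coef g"
proof
  fix c v assume "c \<in> L2_space ell2" "v \<in> L2_space M"
  then show "ip M (synth c) v = ip ell2 c (coef v)"
    using ip_coef[of "synth c" v] by (simp add: synth)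
qed (use assms synth in \<open>auto intro!: AE_eq_if_coef_eq\<close>)

text \<open>
  The rows of the matrix are the conjugated coefficients of the square-integrable functions
  \<open>g \<phi>\<^sub>i\<close>. So every row series converges on all of \<open>\<ell>\<^sup>2\<close>, and Parseval's identity evaluates it.
\<close>
lemma mat_op_gmat:
  fixes g :: "'a \<Rightarrow> real"
  assumes g\<phi>: "\<And>i. (\<lambda>x. complex_of_real (g x) * \<phi> i x) \<in> L2_space M"
  defines "z \<equiv> \<lambda>v i. ip M (\<lambda>x. complex_of_real (g x) * \<phi> i x) (synth v)"
  shows "fst (M_inf M \<phi> g) = {v \<in> L2_space ell2. z v \<in> L2_space ell2}"
    and "v \<in> L2_space ell2 \<Longrightarrow> snd (M_inf M \<phi> g) v = z v"
proof -
  have row: "gmat M \<phi> g i j = cnj (coef (\<lambda>x. complex_of_real (g x) * \<phi> i x) j)" for i j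
    by (simp add: gmat_def coef_def ip_cnj) (simp add: ip_def mult_ac)
  have *: "(\<lambda>j. gmat M \<phi> g i j * v j) summable_on UNIV" "(\<Sum>\<^sub>\<infinity>j. gmat M \<phi> g i j * v j) = z v i"
    if "v \<in> L2_space ell2" for v i
    unfolding row z_def
    using infsum_ip_ell2[OF coef_ell2[OF g\<phi>[of i]] that] that ip_coef[OF g\<phi> synth(1)[OF that], of i]
    by (simp_all add: synth)
  then show "fst (M_inf M \<phi> g) = {v \<in> L2_space ell2. z v \<in> L2_space ell2}"
    by (auto simp: mat_op_def cong: conj_cong)
  show "snd (M_inf M \<phi> g) v = z v" if "v \<in> L2_space ell2"
    using that * by (simp add: mat_op_def)
qed

text \<open>
  Where \<open>g synth v\<close> is square-integrable, the matrix acts as multiplication by \<open>g\<close>. Conversely let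
  \<open>v\<close> be in the domain of the matrix, with image \<open>z\<close>. Symmetry against vectors \<open>coef p\<close>, for \<open>p\<close>
  supported where \<open>\<bar>g\<bar> \<le> n\<close>, says that \<open>g synth v\<close> and \<open>synth z\<close> agree where \<open>\<bar>g\<bar> \<le> n\<close>. As \<open>n\<close> is
  arbitrary, \<open>g synth v = synth z\<close> is square-integrable.
\<close>
lemma represents_M_inf:
  fixes g :: "'a \<Rightarrow> real"
  assumes g: "g \<in> borel_measurable M"
    and g\<phi>: "\<And>i. (\<lambda>x. complex_of_real (g x) * \<phi> i x) \<in> L2_space M"
    and sa: "self_adjoint ell2 (M_inf M \<phi> g)"
  shows "diagonalization.represents ell2 M synth coef g (\<lambda>t. t) (M_inf M \<phi> g)"
proof -
  interpret diagonalization ell2 M synth coef g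
    using g by (rule diagonalization_synth)
  note g[measurable]
  define gm :: "('a \<Rightarrow> complex) \<Rightarrow> 'a \<Rightarrow> complex" where "gm u x = complex_of_real (g x) * u x" for u x
  have gm_sym: "ip M (gm u) v = ip M u (gm v)" for u v
    by (simp add: ip_def gm_def mult_ac)
  have gm\<phi>: "gm (\<phi> i) \<in> L2_space M" for i
    using g\<phi> by (simp add: gm_def[abs_def])
  have gm_measurable: "gm u \<in> borel_measurable M" if "u \<in> L2_space M" for u
    using L2_measurable[OF that] by (simp add: gm_def[abs_def])
  let ?A = "M_inf M \<phi> g"
  have fst_A: "fst ?A = {v \<in> L2_space ell2. (\<lambda>i. ip M (gm (\<phi> i)) (synth v)) \<in> L2_space ell2}"
    using mat_op_gmat(1)[OF g\<phi>] by (simp add: gm_def[abs_def])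
  have snd_A: "snd ?A v = (\<lambda>i. ip M (gm (\<phi> i)) (synth v))" if "v \<in> L2_space ell2" for v
    using mat_op_gmat(2)[OF g\<phi> that] by (simp add: gm_def[abs_def])
  have in_dom: "v \<in> fst ?A" "snd ?A v = coef (gm (synth v))"
    if "v \<in> L2_space ell2" "gm (synth v) \<in> L2_space M" for v
  proof -
    have "(\<lambda>i. ip M (gm (\<phi> i)) (synth v)) = coef (gm (synth v))"
      by (simp add: gm_sym coef_def fun_eq_iff)
    then show "v \<in> fst ?A" "snd ?A v = coef (gm (synth v))"
      using that by (auto simp: fst_A snd_A)
  qed
  have dom: "gm (synth v) \<in> L2_space M" if v: "v \<in> fst ?A" for v
  proof -
    have vL: "v \<in> L2_space ell2" and zL: "snd ?A v \<in> L2_space ell2"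
      using v by (auto simp: fst_A snd_A)
    let ?u = "synth v" and ?z = "synth (snd ?A v)"
    have uL: "?u \<in> L2_space M" and zL': "?z \<in> L2_space M"
      using vL zL by (auto simp: synth)
    have weak: "ip M ?u (gm p) = ip M ?z p" if p: "p \<in> L2_space M" "gm p \<in> L2_space M" for p
    proof -
      let ?c = "coef p"
      have "AE x in M. synth ?c x = p x"
        using p by (intro AE_eq_if_coef_eq) (auto simp: synth)
      then have eq: "AE x in M. gm p x = gm (synth ?c) x"
        by (auto simp: gm_def)
      have L: "gm (synth ?c) \<in> L2_space M"
        by (rule L2_cong_AE[OF p(2) eq]) (use p in \<open>simp add: gm_measurable synth\<close>)
      have c: "?c \<in> fst ?A" "snd ?A ?c = coef (gm (synth ?c))"
        using in_dom[OF _ L] p by auto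
      have "ip ell2 v (snd ?A ?c) = ip ell2 (snd ?A v) ?c"
        using sa v c(1) vL zL unfolding self_adjoint_def by blast
      then have "ip M ?u (gm (synth ?c)) = ip M ?z p"
        using L uL zL' p vL zL unfolding c(2)
        using ip_coef[OF uL L] ip_coef[OF zL' p(1)] by (simp add: synth)
      moreover have "ip M ?u (gm (synth ?c)) = ip M ?u (gm p)"
        by (rule ip_cong_AE) (use eq L uL p in auto)
      ultimately show ?thesis by simp
    qed
    have cut: "AE x in M. indicator {- real n..real n} (g x) * (gm ?u x - ?z x) = 0" for n :: nat
    proof -
      define \<kappa> :: "real \<Rightarrow> complex" where "\<kappa> = indicator {- real n..real n}"
      have \<kappa>: "\<kappa> \<in> borel_measurable borel" "\<And>t. cmod (\<kappa> t) \<le> 1"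
        by (auto simp: \<kappa>_def split: split_indicator)
      have \<kappa>t: "(\<lambda>t. complex_of_real t * \<kappa> t) \<in> borel_measurable borel"
          "\<And>t. cmod (complex_of_real t * \<kappa> t) \<le> real n"
        by (auto simp: \<kappa>_def split: split_indicator)
      have bound: "(\<lambda>x. \<kappa> (g x) * p x) \<in> L2_space M" "gm (\<lambda>x. \<kappa> (g x) * p x) \<in> L2_space M"
          "(\<lambda>x. \<kappa> (g x) * gm p x) \<in> L2_space M" if "p \<in> L2_space M" for p
        using bounded_mult_L2(1)[OF \<kappa> that] bounded_mult_L2(1)[OF \<kappa>t that]
        by (simp_all add: gm_def[abs_def] mult_ac)
      have sym: "ip M p (\<lambda>x. \<kappa> (g x) * q x) = ip M (\<lambda>x. \<kappa> (g x) * p x) q" for p q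
        unfolding ip_def \<kappa>_def
        by (rule Bochner_Integration.integral_cong) (auto split: split_indicator)
      have "AE x in M. \<kappa> (g x) * gm ?u x = \<kappa> (g x) * ?z x"
      proof (rule AE_eq_by_ip)
        fix p assume p: "p \<in> L2_space M"
        let ?p = "\<lambda>x. \<kappa> (g x) * p x"
        have "ip M ?u (gm ?p) = ip M ?z ?p"
          using weak bound[OF p] by blast
        then have "ip M (gm ?p) ?u = ip M ?p ?z"
          by (metis ip_cnj)
        then show "ip M p (\<lambda>x. \<kappa> (g x) * gm ?u x) = ip M p (\<lambda>x. \<kappa> (g x) * ?z x)"
          by (simp add: sym gm_sym)
      qed (use bound uL zL' in auto)
      then show ?thesis
        by eventually_elim (auto simp: \<kappa>_def split: split_indicator)
    qed
    have "AE x in M. \<forall>n::nat. indicator {- real n..real n} (g x) * (gm ?u x - ?z x) = 0"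
      unfolding AE_all_countable using cut by blast
    then have "AE x in M. ?z x = gm ?u x"
    proof eventually_elim
      fix x assume *: "\<forall>n::nat. indicator {- real n..real n} (g x) * (gm ?u x - ?z x) = 0"
      obtain n :: nat where "\<bar>g x\<bar> \<le> real n" using real_arch_simple by blast
      with *[rule_format, of n] show "?z x = gm ?u x" by (simp add: abs_le_iff)
    qed
    then show ?thesis
      by (rule L2_cong_AE[OF zL']) (use uL in \<open>simp add: gm_measurable\<close>)
  qed
  show ?thesis
    unfolding represents_def gm_def[symmetric]
    using in_dom dom fst_A by (auto simp: gm_def[abs_def])
qed

end

section \<open>Diagonalization of Hermitian matrices\<close>

lemma Cvec_L2[simp]: "u \<in> L2_space (Cvec n)"
  by (simp add: L2_space_def integrable_count_space)

lemma ip_Cvec: "ip (Cvec n) u v = (\<Sum>i\<le>n. cnj (u i) * v i)"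
  by (simp add: ip_def lebesgue_integral_count_space_finite)

lemma nrm_Cvec_sq: "(nrm (Cvec n) u)\<^sup>2 = (\<Sum>i\<le>n. (cmod (u i))\<^sup>2)"
  by (simp add: nrm_sq lebesgue_integral_count_space_finite)

lemma nrm_Cvec_eq_0_iff: "nrm (Cvec n) u = 0 \<longleftrightarrow> (\<forall>i\<le>n. u i = 0)"
  by (subst nrm_eq_0_iff) (auto simp: AE_count_space)

lemma ip_Cvec_basis_vec: "j \<le> n \<Longrightarrow> ip (Cvec n) u (basis_vec j) = cnj (u j)"
  by (simp add: ip_Cvec basis_vec_def if_distrib[of "\<lambda>x. _ * x"] cong: if_cong)

text \<open>
  Tychonoff's theorem for the product topology, in which convergence is coordinatewise.
\<close>
lemma compact_bounded_sequences: "compact {u :: nat \<Rightarrow> complex. \<forall>i. cmod (u i) \<le> C}"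
proof -
  have "compactin (product_topology (\<lambda>_. euclidean) UNIV) (PiE UNIV (\<lambda>i::nat. cball (0::complex) C))"
    by (subst compactin_PiE) auto
  moreover have "PiE UNIV (\<lambda>i::nat. cball (0::complex) C) = {u. \<forall>i. cmod (u i) \<le> C}"
    by (auto simp: PiE_def Pi_def extensional_def)
  ultimately show ?thesis
    by (simp add: euclidean_product_topology)
qed

text \<open>
  The left side is linear in \<open>s\<close> and the right side quadratic: for positive \<open>a\<close> and \<open>b\<close> the choice
  \<open>s = a / b\<close> is contradictory.
\<close>
lemma Rayleigh_variation:
  fixes a b :: real
  assumes "\<And>s. 0 < s \<Longrightarrow> 2 * s * a \<le> s\<^sup>2 * b"
  shows "a \<le> 0"
proof (rule ccontr)
  assume a: "\<not> a \<le> 0"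
  show False
  proof (cases "b \<le> 0")
    case True
    then show False using assms[of 1] a by simp
  next
    case False
    then have "2 * (a / b) * a \<le> (a / b)\<^sup>2 * b" using a by (intro assms) simp
    then have "2 * (a * a) \<le> a * a" using False by (simp add: power2_eq_square field_simps)
    then show False using a by simp
  qed
qed

lemma continuous_on_coordinate[continuous_intros]:
  "continuous_on S (\<lambda>u :: 'i \<Rightarrow> complex. u i)"
  by (rule continuous_on_product_coordinates[THEN continuous_on_subset]) simp

locale hermitian =
  fixes A :: "nat \<Rightarrow> nat \<Rightarrow> complex" and n :: nat
  assumes hermitian: "i \<le> n \<Longrightarrow> j \<le> n \<Longrightarrow> A j i = cnj (A i j)"
begin

definition T :: "(nat \<Rightarrow> complex) \<Rightarrow> nat \<Rightarrow> complex" where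
  "T u i = (\<Sum>j\<le>n. A i j * u j)"

lemma T_sym: "ip (Cvec n) u (T v) = ip (Cvec n) (T u) v"
proof -
  have "ip (Cvec n) u (T v) = (\<Sum>i\<le>n. \<Sum>j\<le>n. cnj (u i) * A i j * v j)"
    by (simp add: ip_Cvec T_def sum_distrib_left mult.assoc)
  also have "\<dots> = (\<Sum>j\<le>n. \<Sum>i\<le>n. cnj (A j i) * cnj (u i) * v j)"
    by (subst sum.swap) (intro sum.cong refl, simp add: hermitian[symmetric])
  also have "\<dots> = ip (Cvec n) (T u) v"
    by (simp add: ip_Cvec T_def sum_distrib_right)
  finally show ?thesis .
qed

lemma T_lincomb: "T (\<lambda>i. a * u i + b * v i) = (\<lambda>i. a * T u i + b * T v i)"
  by (simp add: T_def fun_eq_iff sum.distrib sum_distrib_left algebra_simps)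

definition eigenbasis :: "nat \<Rightarrow> (nat \<Rightarrow> nat \<Rightarrow> complex) \<Rightarrow> (nat \<Rightarrow> real) \<Rightarrow> bool" where
  "eigenbasis m \<psi> lam \<longleftrightarrow>
     orthonormal_family (Cvec n) {..<m} \<psi> \<and>
     (\<forall>k<m. \<forall>i\<le>n. T (\<psi> k) i = complex_of_real (lam k) * \<psi> k i)"

text \<open>
  A trace computation: an orthonormal family of fewer than \<open>n + 1\<close> vectors leaves some standard
  basis vector with a nonzero residual, and one of \<open>n + 1\<close> vectors leaves none. The first gives a vector
  orthogonal to the family, the second completeness.
\<close>
lemma residual_sum:
  assumes "orthonormal_family (Cvec n) {..<m} \<psi>"
  defines "r \<equiv> \<lambda>l i. basis_vec l i - (\<Sum>k<m. cnj (\<psi> k l) * \<psi> k i)"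
  shows "(\<Sum>l\<le>n. (nrm (Cvec n) (r l))\<^sup>2) = real (Suc n) - real m"
    and "l \<le> n \<Longrightarrow> k < m \<Longrightarrow> ip (Cvec n) (\<psi> k) (r l) = 0"
proof -
  interpret orthonormal_family "Cvec n" "{..<m}" \<psi> by fact
  have coef: "coef (basis_vec l) k = cnj (\<psi> k l)" if "l \<le> n" for k l
    using that by (simp add: coef_def ip_Cvec_basis_vec)
  show "ip (Cvec n) (\<psi> k) (r l) = 0" if "l \<le> n" "k < m"
  proof -
    have "ip (Cvec n) (\<psi> k) (r l) = coef (basis_vec l) k - coef (\<lambda>x. \<Sum>k<m. cnj (\<psi> k l) * \<psi> k x) k"
      unfolding r_def coef_def by (rule ip_diff_right) auto
    then show ?thesis using that by (simp add: coef coef_comb)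
  qed
  have "(nrm (Cvec n) (r l))\<^sup>2 = 1 - (\<Sum>k<m. (cmod (\<psi> k l))\<^sup>2)" if "l \<le> n" for l
    using nrm_diff_comb_sq[of "{..<m}" "basis_vec l" "\<lambda>k. cnj (\<psi> k l)"] that
    by (simp add: r_def coef) (simp add: nrm_Cvec_sq basis_vec_def if_distrib[of "\<lambda>x. (cmod x)\<^sup>2"] cong: if_cong)
  then have "(\<Sum>l\<le>n. (nrm (Cvec n) (r l))\<^sup>2) = (\<Sum>l\<le>n. 1 - (\<Sum>k<m. (cmod (\<psi> k l))\<^sup>2))"
    by simp
  also have "\<dots> = real (Suc n) - (\<Sum>l\<le>n. \<Sum>k<m. (cmod (\<psi> k l))\<^sup>2)"
    by (simp add: sum_subtractf)
  also have "(\<Sum>l\<le>n. \<Sum>k<m. (cmod (\<psi> k l))\<^sup>2) = (\<Sum>k<m. (nrm (Cvec n) (\<psi> k))\<^sup>2)"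
    by (subst sum.swap) (simp add: nrm_Cvec_sq)
  also have "\<dots> = real m"
    by (simp add: nrm_def ip_\<phi>)
  finally show "(\<Sum>l\<le>n. (nrm (Cvec n) (r l))\<^sup>2) = real (Suc n) - real m" .
qed

text \<open>
  The Rayleigh quotient attains its maximum over the unit vectors orthogonal to the eigenvectors
  found so far. At a maximizer \<open>u\<close> with value \<open>\<mu>\<close> the form of \<open>\<mu> - T\<close> is nonnegative on that orthogonal
  complement and vanishes at \<open>u\<close>; varying \<open>u\<close> in the direction \<open>y = (\<mu> - T) u\<close> forces \<open>y = 0\<close>.
\<close>
lemma next_eigenvector:
  assumes eb: "eigenbasis m \<psi> lam" and m: "m \<le> n"
  obtains u l where "nrm (Cvec n) u = 1" "\<And>k. k < m \<Longrightarrow> ip (Cvec n) (\<psi> k) u = 0"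
    "\<And>i. i \<le> n \<Longrightarrow> T u i = complex_of_real l * u i"
proof -
  have on: "orthonormal_family (Cvec n) {..<m} \<psi>"
    and eig: "\<And>k i. k < m \<Longrightarrow> i \<le> n \<Longrightarrow> T (\<psi> k) i = complex_of_real (lam k) * \<psi> k i"
    using eb by (auto simp: eigenbasis_def)
  interpret orthonormal_family "Cvec n" "{..<m}" \<psi> by fact
  define K where "K = {u. \<forall>k<m. ip (Cvec n) (\<psi> k) u = 0}"
  \<comment> \<open>Coordinates beyond \<open>n\<close> are normalized to 0 and all others are bounded by 1, which puts \<open>S\<close> into a compact set.\<close>
  define S where "S = {u. \<forall>i. cmod (u i) \<le> 1} \<inter> {u. \<forall>i>n. u i = 0} \<inter>
      {u. (\<Sum>i\<le>n. (cmod (u i))\<^sup>2) = 1} \<inter> {u. \<forall>k<m. (\<Sum>i\<le>n. cnj (\<psi> k i) * u i) = 0}"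
  have S_iff: "u \<in> S \<longleftrightarrow> (\<forall>i>n. u i = 0) \<and> nrm (Cvec n) u = 1 \<and> u \<in> K" for u
  proof -
    have "cmod (u i) \<le> 1" if "\<forall>i>n. u i = 0" "(\<Sum>i\<le>n. (cmod (u i))\<^sup>2) = 1" for i
    proof (cases "i \<le> n")
      case True
      then have "(cmod (u i))\<^sup>2 \<le> (\<Sum>i\<le>n. (cmod (u i))\<^sup>2)"
        by (intro member_le_sum) auto
      then show ?thesis using that by (simp add: power_le_one_iff abs_square_le_1)
    qed (use that in auto)
    moreover have "nrm (Cvec n) u = 1 \<longleftrightarrow> (\<Sum>i\<le>n. (cmod (u i))\<^sup>2) = 1"
      using nrm_Cvec_sq[of n u] by (metis nrm_nonneg one_power2 power2_eq_imp_eq zero_le_one)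
    ultimately show ?thesis
      by (auto simp: S_def K_def ip_Cvec)
  qed
  have "compact S"
    unfolding S_def
    by (intro compact_Int_closed compact_bounded_sequences closed_Collect_all closed_Collect_imp
        closed_Collect_eq open_Collect_const continuous_intros)
  have normalise: "\<exists>v\<in>S. \<exists>c>0. \<forall>i\<le>n. w i = complex_of_real c * v i"
    if "w \<in> K" "nrm (Cvec n) w \<noteq> 0" for w
  proof -
    define c where "c = nrm (Cvec n) w"
    have c: "c > 0" using that(2) by (simp add: c_def order.strict_iff_order)
    define v where "v i = (if i \<le> n then w i / complex_of_real c else 0)" for i
    have eq: "AE i in Cvec n. v i = complex_of_real (1 / c) * w i"
      by (auto simp: AE_count_space v_def)
    have "nrm (Cvec n) v = nrm (Cvec n) (\<lambda>i. complex_of_real (1 / c) * w i)"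
      using eq by (intro nrm_cong_AE) auto
    then have "nrm (Cvec n) v = 1"
      using c by (simp only: nrm_scale) (simp add: c_def norm_divide)
    moreover have "ip (Cvec n) (\<psi> k) v = complex_of_real (1 / c) * ip (Cvec n) (\<psi> k) w" for k
      using eq by (subst ip_scale_right[symmetric]) (intro ip_cong_AE, auto)
    ultimately have "v \<in> S" using that(1) by (simp add: S_iff K_def v_def)
    moreover have "\<forall>i\<le>n. w i = complex_of_real c * v i" using c by (simp add: v_def)
    ultimately show ?thesis using c by blast
  qed
  have "S \<noteq> {}"
  proof -
    let ?r = "\<lambda>l i. basis_vec l i - (\<Sum>k<m. cnj (\<psi> k l) * \<psi> k i)"
    have "(\<Sum>l\<le>n. (nrm (Cvec n) (?r l))\<^sup>2) \<noteq> 0"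
      unfolding residual_sum(1)[OF on] using m by simp
    then obtain l where "l \<le> n" "nrm (Cvec n) (?r l) \<noteq> 0"
      by (metis (no_types, lifting) sum.neutral atMost_iff zero_power2)
    with normalise[of "?r l"] residual_sum(2)[OF on] show ?thesis
      by (auto simp: K_def)
  qed
  define q where "q w = Re (ip (Cvec n) w (T w))" for w
  have "continuous_on S q"
    unfolding q_def ip_Cvec T_def by (intro continuous_intros)
  from continuous_attains_sup[OF \<open>compact S\<close> \<open>S \<noteq> {}\<close> this]
  obtain u where u: "u \<in> S" and max: "\<And>v. v \<in> S \<Longrightarrow> q v \<le> q u" by blast
  define B where "B w i = complex_of_real (q u) * w i - T w i" for w i
  define b where "b w = Re (ip (Cvec n) w (B w))" for w
  have b_eq: "b w = q u * (nrm (Cvec n) w)\<^sup>2 - q w" for w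
    by (simp add: b_def B_def[abs_def] q_def ip_diff_right ip_scale_right ip_self_nrm)
  have b_nonneg: "0 \<le> b w" if w: "w \<in> K" for w
  proof (cases "nrm (Cvec n) w = 0")
    case True
    then have "\<forall>i\<le>n. w i = 0" by (simp add: nrm_Cvec_eq_0_iff)
    then have "q w = 0" by (simp add: q_def ip_Cvec)
    then show ?thesis using True by (simp add: b_eq)
  next
    case False
    then obtain v c where v: "v \<in> S" "c > 0" "\<forall>i\<le>n. w i = complex_of_real c * v i"
      using normalise w by blast
    have "T w = (\<lambda>i. complex_of_real c * T v i)"
      using v(3) by (simp add: T_def fun_eq_iff sum_distrib_left algebra_simps)
    then have "q w = c\<^sup>2 * q v"
      using v(3) by (simp add: q_def ip_Cvec sum_distrib_left power2_eq_square algebra_simps)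
    moreover have "(nrm (Cvec n) w)\<^sup>2 = c\<^sup>2 * (nrm (Cvec n) v)\<^sup>2"
      using v(3) by (simp add: nrm_Cvec_sq norm_mult power_mult_distrib sum_distrib_left)
    ultimately have "b w = c\<^sup>2 * (q u - q v)"
      using v(1) by (simp add: b_eq S_iff algebra_simps)
    then show ?thesis using max[OF v(1)] by simp
  qed
  have uK: "u \<in> K" and u1: "nrm (Cvec n) u = 1" using u by (auto simp: S_iff)
  define y where "y = B u"
  have "b u = 0" using u1 by (simp add: b_eq)
  have B_sym: "ip (Cvec n) v (B w) = ip (Cvec n) (B v) w" for v w
    unfolding B_def[abs_def]
    by (simp add: ip_diff_right ip_diff_left ip_scale_right ip_scale_left T_sym)
  have yK: "y \<in> K"
    unfolding K_def
  proof (intro CollectI allI impI)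
    fix k assume k: "k < m"
    have "ip (Cvec n) (B (\<psi> k)) u =
        ip (Cvec n) (\<lambda>i. complex_of_real (q u - lam k) * \<psi> k i) u"
      using eig[OF k] by (intro ip_cong_AE) (auto simp: AE_count_space B_def algebra_simps)
    also have "\<dots> = 0" using uK k by (simp only: ip_scale_left) (simp add: K_def)
    finally show "ip (Cvec n) (\<psi> k) y = 0" by (simp add: y_def B_sym)
  qed
  have "(nrm (Cvec n) y)\<^sup>2 \<le> 0"
  proof (rule Rayleigh_variation)
    fix s :: real assume "0 < s"
    let ?w = "\<lambda>i. 1 * u i + complex_of_real (- s) * y i"
    have "?w \<in> K"
      using uK yK by (simp only: K_def mem_Collect_eq ip_lincomb_right[OF Cvec_L2 Cvec_L2 Cvec_L2]) simp
    then have "0 \<le> b ?w" by (rule b_nonneg)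
    also have "B ?w = (\<lambda>i. 1 * B u i + complex_of_real (- s) * B y i)"
      unfolding B_def T_lincomb by (simp add: fun_eq_iff algebra_simps)
    then have "b ?w = Re (ip (Cvec n) ?w (\<lambda>i. 1 * B u i + complex_of_real (- s) * B y i))"
      by (simp only: b_def)
    also have "\<dots> = b u - s * Re (ip (Cvec n) u (B y)) - s * Re (ip (Cvec n) y (B u)) + s\<^sup>2 * b y"
      by (subst ip_lincomb_right, simp, simp, simp, subst (1 2) ip_lincomb_left)
        (simp_all add: b_def algebra_simps power2_eq_square)
    also have "ip (Cvec n) u (B y) = complex_of_real ((nrm (Cvec n) y)\<^sup>2)"
      by (simp only: B_sym y_def[symmetric] ip_self_nrm)
    also have "ip (Cvec n) y (B u) = complex_of_real ((nrm (Cvec n) y)\<^sup>2)"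
      by (simp only: y_def[symmetric] ip_self_nrm)
    finally show "2 * s * (nrm (Cvec n) y)\<^sup>2 \<le> s\<^sup>2 * b y"
      using \<open>b u = 0\<close> by simp
  qed
  then have "\<forall>i\<le>n. y i = 0" by (simp flip: nrm_Cvec_eq_0_iff)
  then have "T u i = complex_of_real (q u) * u i" if "i \<le> n" for i
    using that by (simp add: y_def B_def)
  then show thesis
    using that u1 uK by (auto simp: K_def)
qed

lemma eigenbasis_exists: "m \<le> Suc n \<Longrightarrow> \<exists>\<psi> lam. eigenbasis m \<psi> lam"
proof (induction m)
  case 0
  show ?case by (auto simp: eigenbasis_def orthonormal_family_def)
next
  case (Suc m)
  then obtain \<psi> lam where eb: "eigenbasis m \<psi> lam" by auto
  then interpret orthonormal_family "Cvec n" "{..<m}" \<psi> by (simp add: eigenbasis_def)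
  obtain u l where u: "nrm (Cvec n) u = 1" "\<And>k. k < m \<Longrightarrow> ip (Cvec n) (\<psi> k) u = 0"
    "\<And>i. i \<le> n \<Longrightarrow> T u i = complex_of_real l * u i"
    using next_eigenvector[OF eb] Suc.prems by auto
  have u': "ip (Cvec n) u (\<psi> k) = 0" if "k < m" for k
    using u(2)[OF that] ip_cnj[of "Cvec n" "\<psi> k" u] by simp
  have "orthonormal_family (Cvec n) {..<Suc m} (\<psi>(m := u))"
    using u u' ip_\<phi> ip_self_nrm[of "Cvec n" u] by unfold_locales (auto simp: less_Suc_eq)
  moreover have "\<forall>k<Suc m. \<forall>i\<le>n. T ((\<psi>(m := u)) k) i = complex_of_real ((lam(m := l)) k) * (\<psi>(m := u)) k i"
    using eb u(3) by (auto simp: eigenbasis_def less_Suc_eq)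
  ultimately show ?case unfolding eigenbasis_def by blast
qed

theorem spectral_theorem:
  obtains \<psi> :: "nat \<Rightarrow> nat \<Rightarrow> complex" and lam :: "nat \<Rightarrow> real" where
    "\<And>k l. k \<le> n \<Longrightarrow> l \<le> n \<Longrightarrow> (\<Sum>i\<le>n. cnj (\<psi> k i) * \<psi> l i) = (if k = l then 1 else 0)"
    "\<And>i j. i \<le> n \<Longrightarrow> j \<le> n \<Longrightarrow> (\<Sum>k\<le>n. \<psi> k i * cnj (\<psi> k j)) = (if i = j then 1 else 0)"
    "\<And>i j. i \<le> n \<Longrightarrow> j \<le> n \<Longrightarrow> A i j = (\<Sum>k\<le>n. \<psi> k i * (complex_of_real (lam k) * cnj (\<psi> k j)))"
proof -
  obtain \<psi> lam where eb: "eigenbasis (Suc n) \<psi> lam"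
    using eigenbasis_exists by blast
  then have on: "orthonormal_family (Cvec n) {..<Suc n} \<psi>" by (simp add: eigenbasis_def)
  then interpret orthonormal_family "Cvec n" "{..<Suc n}" \<psi> .
  have complete: "(\<Sum>k\<le>n. \<psi> k i * cnj (\<psi> k j)) = (if i = j then 1 else 0)" if ij: "i \<le> n" "j \<le> n" for i j
  proof -
    let ?r = "\<lambda>l i. basis_vec l i - (\<Sum>k<Suc n. cnj (\<psi> k l) * \<psi> k i)"
    have "(\<Sum>l\<le>n. (nrm (Cvec n) (?r l))\<^sup>2) = 0"
      unfolding residual_sum(1)[OF on] by simp
    then have "nrm (Cvec n) (?r j) = 0"
      using ij by (subst (asm) sum_nonneg_eq_0_iff) auto
    then have "?r j i = 0" using ij by (simp only: nrm_Cvec_eq_0_iff)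
    then show ?thesis
      by (simp add: basis_vec_def lessThan_Suc_atMost mult.commute)
  qed
  show thesis
  proof
    show "(\<Sum>i\<le>n. cnj (\<psi> k i) * \<psi> l i) = (if k = l then 1 else 0)" if "k \<le> n" "l \<le> n" for k l
      using ip_\<phi>[of k l] that by (simp add: ip_Cvec)
    show "(\<Sum>k\<le>n. \<psi> k i * cnj (\<psi> k j)) = (if i = j then 1 else 0)" if "i \<le> n" "j \<le> n" for i j
      using complete that .
    show "A i j = (\<Sum>k\<le>n. \<psi> k i * (complex_of_real (lam k) * cnj (\<psi> k j)))"
      if ij: "i \<le> n" "j \<le> n" for i j
    proof -
      have "A i j = (\<Sum>l\<le>n. A i l * (if l = j then 1 else 0))"
        using ij by (simp add: if_distrib[of "\<lambda>x. _ * x"] cong: if_cong)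
      also have "\<dots> = (\<Sum>l\<le>n. A i l * (\<Sum>k\<le>n. \<psi> k l * cnj (\<psi> k j)))"
        using ij by (intro sum.cong) (auto simp: complete)
      also have "\<dots> = (\<Sum>k\<le>n. T (\<psi> k) i * cnj (\<psi> k j))"
        unfolding T_def sum_distrib_left sum_distrib_right by (subst sum.swap) (simp add: mult.assoc)
      also have "\<dots> = (\<Sum>k\<le>n. \<psi> k i * (complex_of_real (lam k) * cnj (\<psi> k j)))"
        using eb ij by (intro sum.cong) (auto simp: eigenbasis_def less_Suc_eq_le)
      finally show ?thesis .
    qed
  qed
qed

end

section \<open>Functions of finite blocks\<close>

lemma integrable_count_space_finite_support:
  fixes f :: "'i \<Rightarrow> real"
  assumes "finite F" "\<And>i. i \<notin> F \<Longrightarrow> f i = 0"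
  shows "integrable (count_space I) f"
proof -
  have fin: "finite {a \<in> I. 0 < ennreal (norm (f a))}"
    by (rule finite_subset[OF _ assms(1)]) (use assms(2) in force)
  show ?thesis
    unfolding integrable_iff_bounded by (subst nn_integral_count_space[OF fin]) auto
qed

lemma L2_finite_change:
  assumes "u \<in> L2_space (count_space I)" "finite F" "\<And>i. i \<notin> F \<Longrightarrow> v i = u i"
  shows "v \<in> L2_space (count_space I)"
proof -
  have "(\<lambda>i. v i - u i) \<in> L2_space (count_space I)"
    by (rule L2_spaceI) (use assms in \<open>auto intro!: integrable_count_space_finite_support[of F]\<close>)
  from L2_add[OF assms(1) this] show ?thesis by simp
qed

lemma lebesgue_integral_count_space_supported:
  assumes "finite F" "F \<subseteq> I" "\<And>i. i \<in> I \<Longrightarrow> i \<notin> F \<Longrightarrow> f i = 0"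
  shows "(LINT i|count_space I. f i) = (\<Sum>i\<in>F. f i)"
proof -
  have "finite {a \<in> I. f a \<noteq> 0}"
    by (rule finite_subset[OF _ assms(1)]) (use assms(3) in auto)
  then show ?thesis
    using assms by (subst lebesgue_integral_count_space_finite_support)
      (auto intro!: sum.mono_neutral_left)
qed

lemma infsum_supported:
  assumes "finite F" "F \<subseteq> I" "\<And>i. i \<in> I \<Longrightarrow> i \<notin> F \<Longrightarrow> f i = 0"
  shows "f summable_on I" "(\<Sum>\<^sub>\<infinity>i\<in>I. f i) = (\<Sum>i\<in>F. f i)"
proof -
  have "f summable_on I \<longleftrightarrow> f summable_on F"
    by (rule summable_on_cong_neutral) (use assms in auto)
  then show "f summable_on I" using assms by simp
  have "(\<Sum>\<^sub>\<infinity>i\<in>I. f i) = (\<Sum>\<^sub>\<infinity>i\<in>F. f i)"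
    by (rule infsum_cong_neutral) (use assms in auto)
  then show "(\<Sum>\<^sub>\<infinity>i\<in>I. f i) = (\<Sum>i\<in>F. f i)" using assms by simp
qed

lemma AE_ell2_iff: "(AE i in ell2. P i) \<longleftrightarrow> (\<forall>i. P i)"
  by (simp add: AE_count_space)

text \<open>
  The action of \<open>block n B c\<close> in closed form. It makes sense on sequences over any index set that
  contains \<open>{..n}\<close>, so the matrix on \<open>\<complex>\<^sup>n\<^sup>+\<^sup>1\<close> and its padding to \<open>\<ell>\<^sup>2\<close> are treated together.
\<close>
definition block_apply ::
  "nat \<Rightarrow> (nat \<Rightarrow> nat \<Rightarrow> complex) \<Rightarrow> complex \<Rightarrow> (nat \<Rightarrow> complex) \<Rightarrow> nat \<Rightarrow> complex" where
  "block_apply n B c v i = (if i \<le> n then \<Sum>j\<le>n. B i j * v j else c * v i)"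

lemma block_apply_L2:
  "v \<in> L2_space (count_space I) \<Longrightarrow> block_apply n B c v \<in> L2_space (count_space I)"
  by (rule L2_finite_change[OF L2_scale[of v _ c], of _ "{..n}"]) (auto simp: block_apply_def)

lemma mat_op_block:
  "fst (mat_op UNIV (block n B c)) = L2_space ell2"
  "snd (mat_op UNIV (block n B c)) v = block_apply n B c v"
proof -
  have row: "(\<lambda>j. block n B c i j * v j) summable_on UNIV \<and>
      (\<Sum>\<^sub>\<infinity>j. block n B c i j * v j) = block_apply n B c v i" for i v
  proof (cases "i \<le> n")
    case True
    then show ?thesis
      using infsum_supported[of "{..n}" UNIV "\<lambda>j. block n B c i j * v j"]
      by (auto simp: block_def block_apply_def)
  next
    case False
    then show ?thesis
      using infsum_supported[of "{i}" UNIV "\<lambda>j. block n B c i j * v j"]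
      by (auto simp: block_def block_apply_def)
  qed
  then show "snd (mat_op UNIV (block n B c)) v = block_apply n B c v"
    by (auto simp: mat_op_def)
  show "fst (mat_op UNIV (block n B c)) = L2_space ell2"
    using row by (auto simp: mat_op_def block_apply_L2)
qed

lemma mat_op_finite:
  "fst (mat_op {..n} B) = L2_space (Cvec n)"
  "snd (mat_op {..n} B) v = (\<lambda>i. \<Sum>j\<le>n. B i j * v j)"
  by (auto simp: mat_op_def)

text \<open>
  The three conditions say that \<open>\<psi>\<^sub>0, \<dots>, \<psi>\<^sub>n\<close> is an orthonormal basis of \<open>\<complex>\<^sup>n\<^sup>+\<^sup>1\<close> in which \<open>A\<close> is diagonal.
  Beyond index \<open>n\<close> the maps below are the identity and the diagonal entries are \<open>0\<close>, which diagonalizes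
  the padded matrix as well.
\<close>
locale eigendecomposition =
  fixes A :: "nat \<Rightarrow> nat \<Rightarrow> complex" and n :: nat
    and \<psi> :: "nat \<Rightarrow> nat \<Rightarrow> complex" and lam :: "nat \<Rightarrow> real"
  assumes orthonormal: "k \<le> n \<Longrightarrow> l \<le> n \<Longrightarrow> (\<Sum>i\<le>n. cnj (\<psi> k i) * \<psi> l i) = (if k = l then 1 else 0)"
    and complete: "i \<le> n \<Longrightarrow> j \<le> n \<Longrightarrow> (\<Sum>k\<le>n. \<psi> k i * cnj (\<psi> k j)) = (if i = j then 1 else 0)"
    and decomposition: "i \<le> n \<Longrightarrow> j \<le> n \<Longrightarrow>
      A i j = (\<Sum>k\<le>n. \<psi> k i * (complex_of_real (lam k) * cnj (\<psi> k j)))"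
begin

definition V :: "(nat \<Rightarrow> complex) \<Rightarrow> nat \<Rightarrow> complex" where
  "V u = block_apply n (\<lambda>k l. cnj (\<psi> k l)) 1 u"

definition W :: "(nat \<Rightarrow> complex) \<Rightarrow> nat \<Rightarrow> complex" where
  "W v = block_apply n (\<lambda>l k. \<psi> k l) 1 v"

definition h :: "nat \<Rightarrow> real" where
  "h k = (if k \<le> n then lam k else 0)"

lemma block_apply_mult:
  "block_apply n B b (block_apply n C c v) =
    block_apply n (\<lambda>i j. \<Sum>k\<le>n. B i k * C k j) (b * c) v"
proof
  fix i
  have "(\<Sum>k\<le>n. B i k * (\<Sum>j\<le>n. C k j * v j)) = (\<Sum>j\<le>n. (\<Sum>k\<le>n. B i k * C k j) * v j)"
    unfolding sum_distrib_left sum_distrib_right by (subst sum.swap) (simp add: mult.assoc)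
  then show "block_apply n B b (block_apply n C c v) i =
      block_apply n (\<lambda>i j. \<Sum>k\<le>n. B i k * C k j) (b * c) v i"
    by (simp add: block_apply_def)
qed

lemma block_apply_id:
  assumes "\<And>i j. i \<le> n \<Longrightarrow> j \<le> n \<Longrightarrow> B i j = (if i = j then 1 else 0)"
  shows "block_apply n B 1 v = v"
proof
  fix i
  have "(\<Sum>j\<le>n. B i j * v j) = (\<Sum>j\<le>n. if i = j then v j else 0)" if "i \<le> n"
    using that assms by (intro sum.cong) auto
  then show "block_apply n B 1 v i = v i"
    by (simp add: block_apply_def)
qed

lemma WV: "W (V u) = u"
  unfolding W_def V_def block_apply_mult mult_1 by (rule block_apply_id) (rule complete)

lemma VW: "V (W u) = u"
  unfolding W_def V_def block_apply_mult mult_1 by (rule block_apply_id) (rule orthonormal)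

lemma diagonalization:
  assumes "{..n} \<subseteq> I"
  shows "diagonalization (count_space I) (count_space I) V W h"
proof
  fix u v assume u: "u \<in> L2_space (count_space I)" and v: "v \<in> L2_space (count_space I)"
  have L: "V u \<in> L2_space (count_space I)" "W v \<in> L2_space (count_space I)"
    using u v by (simp_all add: V_def W_def block_apply_L2)
  have "ip (count_space I) (V u) v - ip (count_space I) u (W v) =
      (LINT i|count_space I. cnj (V u i) * v i - cnj (u i) * W v i)"
    unfolding ip_def using u v L
    by (intro Bochner_Integration.integral_diff[symmetric] L2_integrable_prod)
  also have "\<dots> = (\<Sum>i\<le>n. cnj (V u i) * v i - cnj (u i) * W v i)"
    by (rule lebesgue_integral_count_space_supported)
      (use assms in \<open>auto simp: V_def W_def block_apply_def\<close>)
  also have "\<dots> = (\<Sum>i\<le>n. \<Sum>j\<le>n. \<psi> i j * cnj (u j) * v i) - (\<Sum>j\<le>n. \<Sum>i\<le>n. \<psi> i j * cnj (u j) * v i)"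
    by (simp add: sum_subtractf V_def W_def block_apply_def sum_distrib_left sum_distrib_right mult_ac)
  also have "\<dots> = 0" by (subst sum.swap) simp
  finally show "ip (count_space I) (V u) v = ip (count_space I) u (W v)" by simp
qed (simp_all add: V_def[symmetric] W_def[symmetric] WV VW, simp_all add: V_def W_def block_apply_L2)

definition fun_matrix :: "(real \<Rightarrow> complex) \<Rightarrow> nat \<Rightarrow> nat \<Rightarrow> complex" where
  "fun_matrix f i j = (\<Sum>k\<le>n. \<psi> k i * (f (lam k) * cnj (\<psi> k j)))"

text \<open>
  The formula does not mention the index set, hence functions of the matrix and of its padding have
  the same upper left block; on the lower block a function of \<open>0\<close> is the scalar \<open>f 0\<close>.
\<close>
lemma \<Phi>_eq: "diagonalization.\<Phi> V W h f u = block_apply n (fun_matrix f) (f 0) u"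
proof -
  interpret diagonalization ell2 ell2 V W h by (rule diagonalization) simp
  have "(\<lambda>k. f (h k) * V u k) = block_apply n (\<lambda>k j. f (lam k) * cnj (\<psi> k j)) (f 0) u"
    by (auto simp: V_def h_def block_apply_def fun_eq_iff sum_distrib_left mult.assoc)
  then show ?thesis
    by (simp add: \<Phi>_def W_def block_apply_mult fun_matrix_def[abs_def])
qed

lemma mult_h_L2: "v \<in> L2_space (count_space I) \<Longrightarrow> (\<lambda>k. complex_of_real (h k) * v k) \<in> L2_space (count_space I)"
  by (rule L2_finite_change[OF L2_zero, of "{..n}"]) (auto simp: h_def)

lemma W_h_V: "W (\<lambda>k. complex_of_real (h k) * V u k) = block_apply n A 0 u"
proof -
  interpret diagonalization ell2 ell2 V W h by (rule diagonalization) simp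
  have "W (\<lambda>k. complex_of_real (h k) * V u k) = block_apply n (fun_matrix complex_of_real) 0 u"
    using \<Phi>_eq[of complex_of_real u] by (simp add: \<Phi>_def)
  then show ?thesis
    by (simp add: block_apply_def fun_eq_iff fun_matrix_def decomposition)
qed

lemma represents_block:
  "diagonalization.represents ell2 ell2 V W h (\<lambda>t. t) (mat_op UNIV (block n A 0))"
proof -
  interpret diagonalization ell2 ell2 V W h by (rule diagonalization) simp
  show ?thesis
    unfolding represents_def mat_op_block W_h_V by (auto intro: mult_h_L2 block_apply_L2)
qed

lemma represents_finite:
  "diagonalization.represents (Cvec n) (Cvec n) V W h (\<lambda>t. t) (mat_op {..n} A)"
proof -
  interpret diagonalization "Cvec n" "Cvec n" V W h by (rule diagonalization) simp
  show ?thesis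
    unfolding represents_def mat_op_finite W_h_V by (auto simp: AE_count_space block_apply_def)
qed

context
  fixes f :: "real \<Rightarrow> real"
  assumes f: "f \<in> borel_measurable borel" "bounded (range f)"
begin

lemma op_fun_block:
  "fst (op_fun ell2 (mat_op UNIV (block n A 0)) f) = L2_space ell2"
  "u \<in> L2_space ell2 \<Longrightarrow> snd (op_fun ell2 (mat_op UNIV (block n A 0)) f) u =
    block_apply n (fun_matrix (\<lambda>t. complex_of_real (f t))) (complex_of_real (f 0)) u"
proof -
  interpret diagonalization ell2 ell2 V W h by (rule diagonalization) simp
  have *: "op_eq ell2 (op_fun ell2 (mat_op UNIV (block n A 0)) f) (L2_space ell2, \<Phi> (\<lambda>t. complex_of_real (f t)))"
    by (rule op_fun_diagonalized(1)[OF represents_block f])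
  then show "fst (op_fun ell2 (mat_op UNIV (block n A 0)) f) = L2_space ell2"
    by (simp add: op_eq_def)
  show "snd (op_fun ell2 (mat_op UNIV (block n A 0)) f) u =
      block_apply n (fun_matrix (\<lambda>t. complex_of_real (f t))) (complex_of_real (f 0)) u"
    if "u \<in> L2_space ell2"
    using * that unfolding op_eq_def AE_ell2_iff \<Phi>_eq by auto
qed

lemma matrix_of_op_fun:
  assumes "i \<le> n" "j \<le> n"
  shows "matrix_of (op_fun (Cvec n) (mat_op {..n} A) f) i j = fun_matrix (\<lambda>t. complex_of_real (f t)) i j"
proof -
  interpret diagonalization "Cvec n" "Cvec n" V W h by (rule diagonalization) simp
  have "op_eq (Cvec n) (op_fun (Cvec n) (mat_op {..n} A) f) (L2_space (Cvec n), \<Phi> (\<lambda>t. complex_of_real (f t)))"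
    by (rule op_fun_diagonalized(1)[OF represents_finite f])
  then have "snd (op_fun (Cvec n) (mat_op {..n} A) f) (basis_vec j) i = \<Phi> (\<lambda>t. complex_of_real (f t)) (basis_vec j) i"
    using assms by (auto simp: op_eq_def AE_count_space)
  then show ?thesis
    using assms unfolding matrix_of_def \<Phi>_eq
    by (simp add: block_apply_def basis_vec_def if_distrib[of "\<lambda>x. _ * x"] cong: if_cong)
qed

lemma block_op_fun:
  "snd (mat_op UNIV (block n (matrix_of (op_fun (Cvec n) (mat_op {..n} A) f)) c)) u =
    block_apply n (fun_matrix (\<lambda>t. complex_of_real (f t))) c u"
  unfolding mat_op_block by (auto simp: block_apply_def matrix_of_op_fun fun_eq_iff)

end

end

section \<open>Resolvents and weak limits\<close>

context diagonalization begin

text \<open>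
  Multiplication by this function represents the resolvent of the diagonalized operator at \<open>z\<close>.
\<close>
definition \<rho> :: "complex \<Rightarrow> real \<Rightarrow> complex" where
  "\<rho> z t = 1 / (complex_of_real t - z)"

lemma \<rho>_bounded:
  assumes "Im z \<noteq> 0"
  shows "\<rho> z \<in> borel_measurable borel" "cmod (\<rho> z t) \<le> 1 / \<bar>Im z\<bar>"
    and "complex_of_real t * \<rho> z t = 1 + z * \<rho> z t"
proof -
  have ne: "complex_of_real t - z \<noteq> 0" for t
    using assms by (auto simp: complex_eq_iff)
  then show "\<rho> z \<in> borel_measurable borel"
    unfolding \<rho>_def[abs_def]
    by (intro borel_measurable_continuous_onI continuous_intros) auto
  have "\<bar>Im z\<bar> \<le> cmod (complex_of_real t - z)"
    using abs_Im_le_cmod[of "complex_of_real t - z"] by simp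
  then show "cmod (\<rho> z t) \<le> 1 / \<bar>Im z\<bar>"
    using assms by (simp add: \<rho>_def norm_divide frac_le)
  show "complex_of_real t * \<rho> z t = 1 + z * \<rho> z t"
    using ne[of t] by (simp add: \<rho>_def field_simps)
qed

lemma h_V_resolvent:
  assumes "Im z \<noteq> 0" "u \<in> L2_space M"
  shows "(\<lambda>x. complex_of_real (h x) * V (\<Phi> (\<rho> z) u) x) \<in> L2_space N"
    and "AE x in N. complex_of_real (h x) * V (\<Phi> (\<rho> z) u) x = V u x + z * (\<rho> z (h x) * V u x)"
proof -
  note b = \<rho>_bounded(1,2)[OF assms(1)]
  have R: "(\<lambda>x. \<rho> z (h x) * V u x) \<in> L2_space N"
    by (intro bounded_mult_L2[OF b] V_L2 assms)
  show *: "AE x in N. complex_of_real (h x) * V (\<Phi> (\<rho> z) u) x = V u x + z * (\<rho> z (h x) * V u x)"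
    using V_\<Phi>[OF b assms(2)]
  proof eventually_elim
    case (elim x)
    have "complex_of_real (h x) * (\<rho> z (h x) * V u x) = (complex_of_real (h x) * \<rho> z (h x)) * V u x"
      by simp
    then show ?case
      unfolding elim \<rho>_bounded(3)[OF assms(1)] by (simp add: algebra_simps)
  qed
  show "(\<lambda>x. complex_of_real (h x) * V (\<Phi> (\<rho> z) u) x) \<in> L2_space N"
  proof (rule L2_cong_AE)
    show "(\<lambda>x. V u x + z * (\<rho> z (h x) * V u x)) \<in> L2_space N"
      using assms R by (intro L2_add L2_scale V_L2)
    have "V (\<Phi> (\<rho> z) u) \<in> borel_measurable N"
      by (intro L2_measurable V_L2 \<Phi>_L2[OF b] assms)
    then show "(\<lambda>x. complex_of_real (h x) * V (\<Phi> (\<rho> z) u) x) \<in> borel_measurable N" by simp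
    show "AE x in N. V u x + z * (\<rho> z (h x) * V u x) = complex_of_real (h x) * V (\<Phi> (\<rho> z) u) x"
      using * by eventually_elim simp
  qed
qed

lemma resolvent_solves:
  assumes A: "represents (\<lambda>t. t) A" and z: "Im z \<noteq> 0" and u: "u \<in> L2_space M"
  shows "\<Phi> (\<rho> z) u \<in> fst A"
    and "AE x in M. snd A (\<Phi> (\<rho> z) u) x = u x + z * \<Phi> (\<rho> z) u x"
proof -
  note b = \<rho>_bounded(1,2)[OF z]
  let ?x = "\<Phi> (\<rho> z) u"
  have xL: "?x \<in> L2_space M" by (intro \<Phi>_L2[OF b] u)
  have R: "(\<lambda>x. \<rho> z (h x) * V u x) \<in> L2_space N"
    by (intro bounded_mult_L2[OF b] V_L2 u)
  show x: "?x \<in> fst A"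
    using A xL h_V_resolvent(1)[OF z u] by (simp add: represents_def)
  have "AE x in M. W (\<lambda>x. complex_of_real (h x) * V ?x x) x = W (\<lambda>x. 1 * V u x + z * (\<rho> z (h x) * V u x)) x"
    using h_V_resolvent[OF z u] R u by (intro W_cong L2_lincomb V_L2) auto
  moreover have "AE x in M. W (\<lambda>x. 1 * V u x + z * (\<rho> z (h x) * V u x)) x =
      1 * W (V u) x + z * W (\<lambda>x. \<rho> z (h x) * V u x) x"
    using u R by (intro W_lincomb V_L2)
  moreover have "AE x in M. snd A ?x x = W (\<lambda>x. complex_of_real (h x) * V ?x x) x"
    using A x by (simp add: represents_def)
  ultimately show "AE x in M. snd A ?x x = u x + z * ?x x"
    using WV[OF u] by eventually_elim (simp add: \<Phi>_def)
qed

lemma resolvent_unique: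
  assumes A: "represents (\<lambda>t. t) A" and z: "Im z \<noteq> 0" and u: "u \<in> L2_space M"
    and x: "x \<in> fst A" and eq: "AE t in M. snd A x t = u t + z * x t"
  shows "AE t in M. x t = \<Phi> (\<rho> z) u t"
proof -
  note b = \<rho>_bounded(1,2)[OF z]
  have xL: "x \<in> L2_space M" and hL: "(\<lambda>t. complex_of_real (h t) * V x t) \<in> L2_space N"
    and Ax: "AE t in M. snd A x t = W (\<lambda>t. complex_of_real (h t) * V x t) t"
    using A x by (auto simp: represents_def)
  have "AE t in N. V (W (\<lambda>t. complex_of_real (h t) * V x t)) t = V (\<lambda>t. 1 * u t + z * x t) t"
    using Ax eq u xL hL by (intro V_cong W_L2 L2_lincomb) auto
  then have "AE t in N. complex_of_real (h t) * V x t = V u t + z * V x t"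
    using VW[OF hL] V_lincomb[OF u xL, of 1 z] by eventually_elim simp
  then have "AE t in N. V x t = \<rho> z (h t) * V u t"
  proof eventually_elim
    case (elim t)
    have "complex_of_real (h t) - z \<noteq> 0" using z by (auto simp: complex_eq_iff)
    then show ?case using elim by (simp add: \<rho>_def field_simps)
  qed
  then have "AE t in M. W (V x) t = W (\<lambda>t. \<rho> z (h t) * V u t) t"
    by (intro W_cong V_L2 xL bounded_mult_L2[OF b] u)
  with WV[OF xL] show ?thesis by eventually_elim (simp add: \<Phi>_def)
qed

text \<open>
  For \<open>A x = u + z x\<close> with real \<open>\<langle>x, A x\<rangle>\<close>, take imaginary parts of \<open>\<langle>x, A x\<rangle> = \<langle>x, u\<rangle> + z \<parallel>x\<parallel>\<^sup>2\<close>. This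
  expresses the norm through a weakly continuous quantity.
\<close>
lemma resolvent_nrm:
  assumes A: "represents (\<lambda>t. t) A" and z: "Im z \<noteq> 0" and u: "u \<in> L2_space M"
  shows "(nrm M (\<Phi> (\<rho> z) u))\<^sup>2 = Im (ip M u (\<Phi> (\<rho> z) u)) / Im z"
proof -
  let ?x = "\<Phi> (\<rho> z) u"
  have x: "?x \<in> fst A" and eq: "AE t in M. snd A ?x t = u t + z * ?x t"
    using resolvent_solves[OF assms] by auto
  have xL: "?x \<in> L2_space M" "snd A ?x \<in> L2_space M" "(\<lambda>t. complex_of_real (h t) * V ?x t) \<in> L2_space N"
    and Ax: "AE t in M. snd A ?x t = W (\<lambda>t. complex_of_real (h t) * V ?x t) t"
    using A x by (auto simp: represents_def)
  have "ip M ?x (snd A ?x) = ip M ?x (W (\<lambda>t. complex_of_real (h t) * V ?x t))"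
    using Ax xL by (intro ip_cong_AE) auto
  also have "\<dots> = ip N (V ?x) (\<lambda>t. complex_of_real (h t) * V ?x t)"
    using xL by (simp add: adjoint)
  also have "\<dots> = (LINT t|N. complex_of_real (h t * (cmod (V ?x t))\<^sup>2))"
    unfolding ip_def
    by (rule Bochner_Integration.integral_cong) (simp_all only: of_real_mult complex_norm_square mult_ac)
  finally have "Im (ip M ?x (snd A ?x)) = 0"
    by (simp only: integral_complex_of_real Im_complex_of_real)
  moreover have "ip M ?x (snd A ?x) = ip M ?x (\<lambda>t. 1 * u t + z * ?x t)"
    using eq xL u by (intro ip_cong_AE L2_lincomb) auto
  moreover have "\<dots> = cnj (ip M u ?x) + z * complex_of_real ((nrm M ?x)\<^sup>2)"
    by (subst ip_lincomb_right[OF xL(1) u xL(1)]) (simp add: ip_cnj ip_self_nrm)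
  ultimately show ?thesis using z by (simp add: field_simps)
qed

lemma \<Phi>_const: "u \<in> L2_space M \<Longrightarrow> AE x in M. \<Phi> (\<lambda>_. c) u x = c * u x"
  using WV[of u] W_lincomb[of "V u" "V u" c 0] by (simp add: \<Phi>_def) (auto elim: eventually_elim2)

end

lemma ell2_coordinate_le: 
  assumes "x \<in> L2_space ell2" shows "cmod (x i) \<le> nrm ell2 x"
proof (rule power2_le_imp_le)
  show "(cmod (x i))\<^sup>2 \<le> (nrm ell2 x)\<^sup>2"
    using sum_le_suminf[OF sums_summable, OF nrm_ell2_sums[OF assms], of "{i}"] 
      sums_unique[OF nrm_ell2_sums[OF assms]] by simp
qed simp

lemma ell2_truncation:
  assumes "a \<in> L2_space ell2"
  shows "(\<lambda>j. if j < m then a j else 0) \<in> L2_space ell2"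
    and "(\<lambda>m. nrm ell2 (\<lambda>j. a j - (if j < m then a j else 0))) \<longlonglongrightarrow> 0"
proof -
  have L: "(\<lambda>j. if j < m then a j else 0) \<in> L2_space ell2" for m
    unfolding ell2_iff by (rule summable_finite[of "{..<m}"]) auto
  then show "(\<lambda>j. if j < m then a j else 0) \<in> L2_space ell2" .
  have sq: "(nrm ell2 (\<lambda>j. a j - (if j < m then a j else 0)))\<^sup>2 = (nrm ell2 a)\<^sup>2 - (\<Sum>j<m. (cmod (a j))\<^sup>2)" for m
  proof -
    have "(\<lambda>j. if j \<in> {..<m} then (cmod (a j))\<^sup>2 else 0) sums (\<Sum>j\<in>{..<m}. (cmod (a j))\<^sup>2)"
      by (rule sums_If_finite_set) simp
    from sums_diff[OF nrm_ell2_sums[OF assms] this]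
    have "(\<lambda>j. (cmod (a j - (if j < m then a j else 0)))\<^sup>2) sums ((nrm ell2 a)\<^sup>2 - (\<Sum>j<m. (cmod (a j))\<^sup>2))"
      by (rule sums_cong[THEN iffD1, rotated]) auto
    then show ?thesis
      using nrm_ell2_sums[OF L2_diff[OF assms L[of m]]] sums_unique2 by blast
  qed
  have "(\<lambda>m. (nrm ell2 a)\<^sup>2 - (\<Sum>j<m. (cmod (a j))\<^sup>2)) \<longlonglongrightarrow> (nrm ell2 a)\<^sup>2 - (nrm ell2 a)\<^sup>2"
    using nrm_ell2_sums[OF assms] by (intro tendsto_diff tendsto_const) (simp add: sums_def)
  then have "(\<lambda>m. (nrm ell2 (\<lambda>j. a j - (if j < m then a j else 0)))\<^sup>2) \<longlonglongrightarrow> 0"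
    by (simp add: sq)
  then have "(\<lambda>m. sqrt ((nrm ell2 (\<lambda>j. a j - (if j < m then a j else 0)))\<^sup>2)) \<longlonglongrightarrow> sqrt 0"
    by (rule tendsto_real_sqrt)
  then show "(\<lambda>m. nrm ell2 (\<lambda>j. a j - (if j < m then a j else 0))) \<longlonglongrightarrow> 0"
    by simp
qed

text \<open>
  Norm-bounded sequences in \<open>\<ell>\<^sup>2\<close> that converge in every coordinate converge weakly: truncating \<open>a\<close>
  leaves a finite sum, at an error controlled by the common bound.
\<close>
lemma ell2_weak_limit:
  assumes x: "\<And>k. x k \<in> L2_space ell2" "\<And>k. nrm ell2 (x k) \<le> C"
    and lim: "\<And>i. (\<lambda>k. x k i) \<longlonglongrightarrow> y i"
  shows "y \<in> L2_space ell2" and "a \<in> L2_space ell2 \<Longrightarrow> (\<lambda>k. ip ell2 a (x k)) \<longlonglongrightarrow> ip ell2 a y"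
proof -
  have C: "0 \<le> C" using x(2)[of 0] nrm_nonneg order_trans by blast
  have part: "(\<Sum>i<m. (cmod (y i))\<^sup>2) \<le> C\<^sup>2" for m
  proof (rule LIMSEQ_le_const2)
    show "(\<lambda>k. \<Sum>i<m. (cmod (x k i))\<^sup>2) \<longlonglongrightarrow> (\<Sum>i<m. (cmod (y i))\<^sup>2)"
      by (intro tendsto_intros lim)
    have "(\<Sum>i<m. (cmod (x k i))\<^sup>2) \<le> C\<^sup>2" for k
    proof -
      have "(\<Sum>i<m. (cmod (x k i))\<^sup>2) \<le> (nrm ell2 (x k))\<^sup>2"
        using nrm_ell2_sums[OF x(1)[of k]] sum_le_suminf[of "\<lambda>i. (cmod (x k i))\<^sup>2" "{..<m}"]
        by (simp add: sums_iff)
      also have "\<dots> \<le> C\<^sup>2" using x(2)[of k] by (intro power_mono) auto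
      finally show ?thesis .
    qed
    then show "\<exists>K. \<forall>k\<ge>K. (\<Sum>i<m. (cmod (x k i))\<^sup>2) \<le> C\<^sup>2" by blast
  qed
  then have sm: "summable (\<lambda>i. (cmod (y i))\<^sup>2)"
    by (intro summableI_nonneg_bounded[of _ "C\<^sup>2"]) auto
  then show y: "y \<in> L2_space ell2" by (simp add: ell2_iff)
  have "(nrm ell2 y)\<^sup>2 \<le> C\<^sup>2"
    using nrm_ell2_sums[OF y] suminf_le_const[OF sm part] by (simp add: sums_iff)
  then have yC: "nrm ell2 y \<le> C" using C by (rule power2_le_imp_le)
  show "(\<lambda>k. ip ell2 a (x k)) \<longlonglongrightarrow> ip ell2 a y" if a: "a \<in> L2_space ell2"
  proof (rule LIM_zero_cancel, rule LIMSEQ_I)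
    fix e :: real assume "0 < e"
    define b where "b m j = (if j < m then a j else 0)" for m :: nat and j
    have bL: "b m \<in> L2_space ell2" for m
      unfolding b_def by (rule ell2_truncation(1)[OF a])
    have "(\<lambda>m. nrm ell2 (\<lambda>j. a j - b m j)) \<longlonglongrightarrow> 0"
      unfolding b_def by (rule ell2_truncation(2)[OF a])
    moreover have "0 < e / (4 * C + 1)" using \<open>0 < e\<close> C by simp
    ultimately have "\<exists>m. nrm ell2 (\<lambda>j. a j - b m j) < e / (4 * C + 1)"
      using LIMSEQ_D[of "\<lambda>m. nrm ell2 (\<lambda>j. a j - b m j)" 0] by fastforce
    then obtain m where m: "nrm ell2 (\<lambda>j. a j - b m j) < e / (4 * C + 1)" ..
    have b_ip: "ip ell2 (b m) v = (\<Sum>j<m. cnj (a j) * v j)" if "v \<in> L2_space ell2" for v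
    proof -
      have "(\<lambda>j. cnj (b m j) * v j) sums ip ell2 (b m) v"
        unfolding ip_def by (intro sums_integral_count_space_nat L2_integrable_prod bL that)
      moreover have "(\<lambda>j. if j \<in> {..<m} then cnj (a j) * v j else 0) sums (\<Sum>j\<in>{..<m}. cnj (a j) * v j)"
        by (rule sums_If_finite_set) simp
      moreover have "(\<lambda>j. cnj (b m j) * v j) = (\<lambda>j. if j \<in> {..<m} then cnj (a j) * v j else 0)"
        by (auto simp: b_def)
      ultimately show ?thesis using sums_unique2 by simp
    qed
    have "(\<lambda>k. ip ell2 (b m) (x k)) \<longlonglongrightarrow> ip ell2 (b m) y"
      unfolding b_ip[OF x(1)] b_ip[OF y] by (intro tendsto_intros lim)
    then obtain K where K: "\<And>k. k \<ge> K \<Longrightarrow> cmod (ip ell2 (b m) (x k) - ip ell2 (b m) y) < e / 2"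
      using LIMSEQ_D[of "\<lambda>k. ip ell2 (b m) (x k)" "ip ell2 (b m) y" "e / 2"] \<open>0 < e\<close> by auto
    have "norm (ip ell2 a (x k) - ip ell2 a y - 0) < e" if "k \<ge> K" for k
    proof -
      let ?d = "\<lambda>j. a j - b m j"
      have dL: "?d \<in> L2_space ell2" by (rule L2_diff[OF a bL])
      have "ip ell2 a (x k) - ip ell2 a y =
          (ip ell2 (b m) (x k) - ip ell2 (b m) y) + (ip ell2 ?d (x k) - ip ell2 ?d y)"
        using a bL x(1) y by (simp add: ip_diff_left)
      then have "cmod (ip ell2 a (x k) - ip ell2 a y) \<le>
          cmod (ip ell2 (b m) (x k) - ip ell2 (b m) y) + cmod (ip ell2 ?d (x k) - ip ell2 ?d y)"
        by (simp only: norm_triangle_ineq)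
      moreover have "cmod (ip ell2 ?d (x k) - ip ell2 ?d y) \<le> cmod (ip ell2 ?d (x k)) + cmod (ip ell2 ?d y)"
        by (rule norm_triangle_ineq4)
      moreover have "cmod (ip ell2 ?d (x k)) \<le> nrm ell2 ?d * C"
        by (rule order_trans[OF Cauchy_Schwarz_L2[OF dL x(1)] mult_left_mono[OF x(2)]]) simp
      moreover have "cmod (ip ell2 ?d y) \<le> nrm ell2 ?d * C"
        by (rule order_trans[OF Cauchy_Schwarz_L2[OF dL y] mult_left_mono[OF yC]]) simp
      moreover have "nrm ell2 ?d * (4 * C + 1) < e"
        using m C by (simp add: pos_less_divide_eq)
      moreover have "nrm ell2 ?d * (4 * C + 1) = 4 * (nrm ell2 ?d * C) + nrm ell2 ?d"
        by (simp add: algebra_simps)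
      ultimately show ?thesis
        using K[OF that] nrm_nonneg[of ell2 ?d] by (simp only: diff_zero)
    qed
    then show "\<exists>K. \<forall>k\<ge>K. norm (ip ell2 a (x k) - ip ell2 a y - 0) < e" by blast
  qed
qed

section \<open>Strong convergence of the functional calculus\<close>

text \<open>
  The last assumption is the only link between \<open>A\<close> and its approximations: coordinatewise limits of
  norm-bounded sequences taken from their graphs lie in the graph of \<open>A\<close>.
\<close>
locale weakly_closed_limit = lim: diagonalization ell2 N V W h
  for N :: "'b measure" and V W h +
  fixes Nn :: "nat \<Rightarrow> 'c measure" and Vn Wn hn
    and An :: "nat \<Rightarrow> nat l2op" and A :: "nat l2op"
  assumes diag: "\<And>n. diagonalization ell2 (Nn n) (Vn n) (Wn n) (hn n)"
    and rep_n: "\<And>n. diagonalization.represents ell2 (Nn n) (Vn n) (Wn n) (hn n) (\<lambda>t. t) (An n)"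
    and rep: "lim.represents (\<lambda>t. t) A"
    and weakly_closed: "\<And>r x C y b. strict_mono r \<Longrightarrow> (\<And>k. x k \<in> fst (An (r k))) \<Longrightarrow>
      (\<And>k. x k \<in> L2_space ell2) \<Longrightarrow> (\<And>k. nrm ell2 (x k) \<le> C) \<Longrightarrow>
      (\<And>i. (\<lambda>k. x k i) \<longlonglongrightarrow> y i) \<Longrightarrow> (\<And>i. (\<lambda>k. snd (An (r k)) (x k) i) \<longlonglongrightarrow> b i) \<Longrightarrow>
      b \<in> L2_space ell2 \<Longrightarrow> y \<in> fst A \<and> (\<forall>i. snd A y i = b i)"
begin

abbreviation \<Phi>n where "\<Phi>n n \<equiv> diagonalization.\<Phi> (Vn n) (Wn n) (hn n)"

abbreviation dev :: "nat \<Rightarrow> (real \<Rightarrow> complex) \<Rightarrow> (nat \<Rightarrow> complex) \<Rightarrow> real" where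
  "dev n f u \<equiv> nrm ell2 (\<lambda>i. \<Phi>n n f u i - lim.\<Phi> f u i)"

definition bounded_borel :: "(real \<Rightarrow> complex) \<Rightarrow> bool" where
  "bounded_borel f \<longleftrightarrow> f \<in> borel_measurable borel \<and> (\<exists>C. \<forall>t. cmod (f t) \<le> C)"

definition converges :: "(real \<Rightarrow> complex) \<Rightarrow> bool" where
  "converges f \<longleftrightarrow> bounded_borel f \<and>
     (\<forall>u\<in>L2_space ell2. (\<lambda>n. dev n f u) \<longlonglongrightarrow> 0)"

lemma \<Phi>_L2':
  assumes "bounded_borel f" "u \<in> L2_space ell2"
  shows "lim.\<Phi> f u \<in> L2_space ell2" "\<Phi>n n f u \<in> L2_space ell2"
proof -
  obtain C where C: "f \<in> borel_measurable borel" "\<And>t. cmod (f t) \<le> C"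
    using assms(1) by (auto simp: bounded_borel_def)
  show "lim.\<Phi> f u \<in> L2_space ell2" by (rule lim.\<Phi>_L2[OF C assms(2)])
  interpret d: diagonalization ell2 "Nn n" "Vn n" "Wn n" "hn n" by (rule diag)
  show "\<Phi>n n f u \<in> L2_space ell2" by (rule d.\<Phi>_L2[OF C assms(2)])
qed

text \<open>
  Otherwise some subsequence stays away from the limit \<open>x\<close>. By compactness a further subsequence
  converges in every coordinate, its limit solves the resolvent equation and hence is \<open>x\<close>, and the norm
  identity makes the convergence strong.
\<close>
lemma converges_resolvent:
  assumes z: "Im z \<noteq> 0"
  shows "converges (lim.\<rho> z)"
  unfolding converges_def
proof (intro conjI ballI)
  note b = lim.\<rho>_bounded(1,2)[OF z]
  show bb: "bounded_borel (lim.\<rho> z)" using b by (auto simp: bounded_borel_def)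
  fix u :: "nat \<Rightarrow> complex" assume u: "u \<in> L2_space ell2"
  define X where "X n = \<Phi>n n (lim.\<rho> z) u" for n
  define x where "x = lim.\<Phi> (lim.\<rho> z) u"
  define C where "C = 1 / \<bar>Im z\<bar> * nrm ell2 u"
  have X: "X n \<in> L2_space ell2" "nrm ell2 (X n) \<le> C" "X n \<in> fst (An n)"
      "\<And>i. snd (An n) (X n) i = u i + z * X n i"
      "(nrm ell2 (X n))\<^sup>2 = Im (ip ell2 u (X n)) / Im z" for n
  proof -
    interpret d: diagonalization ell2 "Nn n" "Vn n" "Wn n" "hn n" by (rule diag)
    show "X n \<in> L2_space ell2" unfolding X_def by (rule d.\<Phi>_L2[OF b u])
    show "nrm ell2 (X n) \<le> C" unfolding X_def C_def by (rule d.nrm_\<Phi>_le[OF b u])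
    show "X n \<in> fst (An n)" "\<And>i. snd (An n) (X n) i = u i + z * X n i"
      using d.resolvent_solves[OF rep_n z u] by (auto simp: X_def AE_count_space)
    show "(nrm ell2 (X n))\<^sup>2 = Im (ip ell2 u (X n)) / Im z"
      unfolding X_def by (rule d.resolvent_nrm[OF rep_n z u])
  qed
  have xL: "x \<in> L2_space ell2" unfolding x_def by (rule lim.\<Phi>_L2[OF b u])
  have x_nrm: "(nrm ell2 x)\<^sup>2 = Im (ip ell2 u x) / Im z"
    unfolding x_def by (rule lim.resolvent_nrm[OF rep z u])
  have "(\<lambda>n. nrm ell2 (\<lambda>i. X n i - x i)) \<longlonglongrightarrow> 0"
  proof (rule ccontr)
    assume "\<not> ?thesis"
    then obtain e where e: "0 < e" "\<And>K. \<exists>n\<ge>K. e \<le> nrm ell2 (\<lambda>i. X n i - x i)"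
      unfolding LIMSEQ_def by (auto simp: not_less)
    then have "infinite {n. e \<le> nrm ell2 (\<lambda>i. X n i - x i)}"
      unfolding infinite_nat_iff_unbounded_le by blast
    then obtain r :: "nat \<Rightarrow> nat" where r: "strict_mono r" "\<And>k. e \<le> nrm ell2 (\<lambda>i. X (r k) i - x i)"
      using infinite_enumerate by blast
    have "X n \<in> {v. \<forall>i. cmod (v i) \<le> C}" for n
      using ell2_coordinate_le[OF X(1)] X(2) order_trans by blast
    then obtain s :: "nat \<Rightarrow> nat" and y where s: "strict_mono s" "(\<lambda>k. X (r (s k))) \<longlonglongrightarrow> y"
      using compact_imp_seq_compact[OF compact_bounded_sequences[of C], unfolded seq_compact_def, rule_format, of "\<lambda>k. X (r k)"]
      by (auto simp: o_def)
    have lim: "(\<lambda>k. X (r (s k)) i) \<longlonglongrightarrow> y i" for i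
    proof -
      have "isCont (\<lambda>v :: nat \<Rightarrow> complex. v i) y"
        using continuous_on_coordinate[of UNIV i] continuous_on_eq_continuous_at open_UNIV by blast
      then show ?thesis using s(2) by (rule isCont_tendsto_compose)
    qed
    have yL: "y \<in> L2_space ell2"
      by (rule ell2_weak_limit(1)[OF X(1,2) lim])
    have "y \<in> fst A \<and> (\<forall>i. snd A y i = u i + z * y i)"
    proof (rule weakly_closed)
      show "strict_mono (\<lambda>k. r (s k))"
        using strict_mono_o[OF r(1) s(1)] by (simp add: o_def)
      show "(\<lambda>k. snd (An (r (s k))) (X (r (s k))) i) \<longlonglongrightarrow> u i + z * y i" for i
        unfolding X(4) by (intro tendsto_intros lim)
      show "(\<lambda>i. u i + z * y i) \<in> L2_space ell2"
        using u yL by (intro L2_add L2_scale)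
    qed (use X lim in auto)
    then have "AE i in ell2. y i = x i"
      unfolding x_def by (intro lim.resolvent_unique[OF rep z u]) auto
    then have yx: "y = x" by (auto simp: AE_count_space)
    have weak: "(\<lambda>k. ip ell2 a (X (r (s k)))) \<longlonglongrightarrow> ip ell2 a x" if "a \<in> L2_space ell2" for a
      using ell2_weak_limit(2)[OF X(1,2) lim that] by (simp add: yx)
    have "(\<lambda>k. (nrm ell2 (X (r (s k))))\<^sup>2) \<longlonglongrightarrow> (nrm ell2 x)\<^sup>2"
      unfolding X(5) x_nrm using z by (intro tendsto_intros weak u)
    then have "(\<lambda>k. (nrm ell2 (X (r (s k))))\<^sup>2 - 2 * Re (ip ell2 x (X (r (s k)))) + (nrm ell2 x)\<^sup>2)
        \<longlonglongrightarrow> (nrm ell2 x)\<^sup>2 - 2 * Re (ip ell2 x x) + (nrm ell2 x)\<^sup>2"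
      by (intro tendsto_add tendsto_diff tendsto_const tendsto_mult tendsto_Re weak xL)
    moreover have "(nrm ell2 (X n))\<^sup>2 - 2 * Re (ip ell2 x (X n)) + (nrm ell2 x)\<^sup>2 =
        (nrm ell2 (\<lambda>i. X n i - x i))\<^sup>2" for n
      using X(1)[of n] xL arg_cong[OF ip_cnj[of ell2 x "X n"], of Re] by (simp add: nrm_diff_sq)
    ultimately have null: "(\<lambda>k. (nrm ell2 (\<lambda>i. X (r (s k)) i - x i))\<^sup>2) \<longlonglongrightarrow> 0"
      by (simp add: ip_self_nrm)
    have "e\<^sup>2 \<le> (nrm ell2 (\<lambda>i. X (r (s k)) i - x i))\<^sup>2" for k
      using r(2)[of "s k"] e(1) by (intro power_mono) auto
    then have "e\<^sup>2 \<le> 0"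
      by (intro LIMSEQ_le_const[OF null]) blast
    with e(1) show False by simp
  qed
  then show "(\<lambda>n. dev n (lim.\<rho> z) u) \<longlonglongrightarrow> 0"
    by (simp add: X_def x_def)
qed

lemma bounded_borelE:
  assumes "bounded_borel f" obtains C where "f \<in> borel_measurable borel" "\<And>t. cmod (f t) \<le> C" "0 \<le> C"
  using assms norm_ge_zero order_trans unfolding bounded_borel_def by metis

lemma bounded_borel_lincomb:
  assumes "bounded_borel f" "bounded_borel g"
  shows "bounded_borel (\<lambda>t. a * f t + b * g t)"
proof -
  obtain C where C: "f \<in> borel_measurable borel" "\<And>t. cmod (f t) \<le> C" "0 \<le> C"
    by (rule bounded_borelE[OF assms(1)]) blast
  obtain C' where C': "g \<in> borel_measurable borel" "\<And>t. cmod (g t) \<le> C'" "0 \<le> C'"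
    by (rule bounded_borelE[OF assms(2)]) blast
  have "cmod (a * f t + b * g t) \<le> cmod a * C + cmod b * C'" for t
    using norm_triangle_ineq[of "a * f t" "b * g t"] mult_left_mono[OF C(2)[of t], of "cmod a"]
      mult_left_mono[OF C'(2)[of t], of "cmod b"] by (simp add: norm_mult)
  then show ?thesis using C(1) C'(1) unfolding bounded_borel_def by auto
qed

lemma bounded_borel_mult:
  assumes "bounded_borel f" "bounded_borel g"
  shows "bounded_borel (\<lambda>t. f t * g t)"
proof -
  obtain C where C: "f \<in> borel_measurable borel" "\<And>t. cmod (f t) \<le> C" "0 \<le> C"
    by (rule bounded_borelE[OF assms(1)]) blast
  obtain C' where C': "g \<in> borel_measurable borel" "\<And>t. cmod (g t) \<le> C'" "0 \<le> C'"
    by (rule bounded_borelE[OF assms(2)]) blast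
  have "cmod (f t * g t) \<le> C * C'" for t
    using C C' by (simp add: norm_mult mult_mono)
  then show ?thesis using C(1) C'(1) unfolding bounded_borel_def by auto
qed

lemma \<Phi>_ell2:
  assumes "bounded_borel f" "bounded_borel g" "u \<in> L2_space ell2"
  shows "lim.\<Phi> (\<lambda>t. a * f t + b * g t) u i = a * lim.\<Phi> f u i + b * lim.\<Phi> g u i"
    and "lim.\<Phi> (\<lambda>t. f t * g t) u = lim.\<Phi> f (lim.\<Phi> g u)"
    and "\<Phi>n n (\<lambda>t. a * f t + b * g t) u i = a * \<Phi>n n f u i + b * \<Phi>n n g u i"
    and "\<Phi>n n (\<lambda>t. f t * g t) u = \<Phi>n n f (\<Phi>n n g u)"
proof -
  obtain C where C: "f \<in> borel_measurable borel" "\<And>t. cmod (f t) \<le> C" "0 \<le> C"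
    by (rule bounded_borelE[OF assms(1)]) blast
  obtain C' where C': "g \<in> borel_measurable borel" "\<And>t. cmod (g t) \<le> C'" "0 \<le> C'"
    by (rule bounded_borelE[OF assms(2)]) blast
  interpret d: diagonalization ell2 "Nn n" "Vn n" "Wn n" "hn n" by (rule diag)
  show "lim.\<Phi> (\<lambda>t. a * f t + b * g t) u i = a * lim.\<Phi> f u i + b * lim.\<Phi> g u i"
    using lim.\<Phi>_lincomb[OF C(1,2) C'(1,2) assms(3), of a b] by (auto simp: AE_count_space)
  show "lim.\<Phi> (\<lambda>t. f t * g t) u = lim.\<Phi> f (lim.\<Phi> g u)"
    using lim.\<Phi>_mult[OF C(1,2) C'(1,2) assms(3)] by (auto simp: AE_count_space)
  show "\<Phi>n n (\<lambda>t. a * f t + b * g t) u i = a * \<Phi>n n f u i + b * \<Phi>n n g u i"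
    using d.\<Phi>_lincomb[OF C(1,2) C'(1,2) assms(3), of a b] by (auto simp: AE_count_space)
  show "\<Phi>n n (\<lambda>t. f t * g t) u = \<Phi>n n f (\<Phi>n n g u)"
    using d.\<Phi>_mult[OF C(1,2) C'(1,2) assms(3)] by (auto simp: AE_count_space)
qed

lemma \<Phi>n_bound:
  assumes "f \<in> borel_measurable borel" "\<And>t. cmod (f t) \<le> C" "u \<in> L2_space ell2"
  shows "nrm ell2 (\<Phi>n n f u) \<le> C * nrm ell2 u"
  by (rule diagonalization.nrm_\<Phi>_le[OF diag assms])

lemma \<Phi>n_diff:
  assumes "bounded_borel f" "u \<in> L2_space ell2" "v \<in> L2_space ell2"
  shows "\<Phi>n n f (\<lambda>i. u i - v i) = (\<lambda>i. \<Phi>n n f u i - \<Phi>n n f v i)"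
proof -
  obtain C where C: "f \<in> borel_measurable borel" "\<And>t. cmod (f t) \<le> C" "0 \<le> C"
    by (rule bounded_borelE[OF assms(1)]) blast
  interpret d: diagonalization ell2 "Nn n" "Vn n" "Wn n" "hn n" by (rule diag)
  have m: "(\<lambda>x. f (hn n x) * Vn n w x) \<in> L2_space (Nn n)" if "w \<in> L2_space ell2" for w
    by (intro d.bounded_mult_L2[OF C(1,2)] d.V_L2 that)
  have w: "(\<lambda>i. 1 * u i + (- 1) * v i) \<in> L2_space ell2" using assms by (intro L2_lincomb)
  have "AE x in Nn n. f (hn n x) * Vn n (\<lambda>i. 1 * u i + (- 1) * v i) x =
      1 * (f (hn n x) * Vn n u x) + (- 1) * (f (hn n x) * Vn n v x)"
    using d.V_lincomb[OF assms(2,3), of 1 "- 1"]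
  proof eventually_elim
    case (elim x)
    show ?case unfolding elim by (simp add: algebra_simps)
  qed
  then have "AE i in ell2. d.\<Phi> f (\<lambda>i. 1 * u i + (- 1) * v i) i =
      Wn n (\<lambda>x. 1 * (f (hn n x) * Vn n u x) + (- 1) * (f (hn n x) * Vn n v x)) i"
    unfolding d.\<Phi>_def by (intro d.W_cong m w L2_lincomb assms)
  moreover have "AE i in ell2. Wn n (\<lambda>x. 1 * (f (hn n x) * Vn n u x) + (- 1) * (f (hn n x) * Vn n v x)) i =
      1 * d.\<Phi> f u i + (- 1) * d.\<Phi> f v i"
    unfolding d.\<Phi>_def by (intro d.W_lincomb m assms)
  ultimately show ?thesis by (auto simp: AE_count_space)
qed

lemma converges_const: "converges (\<lambda>_. c)"
  unfolding converges_def
proof (intro conjI ballI)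
  show "bounded_borel (\<lambda>_. c)" by (auto simp: bounded_borel_def)
  fix u :: "nat \<Rightarrow> complex" assume u: "u \<in> L2_space ell2"
  have "\<Phi>n n (\<lambda>_. c) u i = c * u i" for n i
    using diagonalization.\<Phi>_const[OF diag u, of n c] by (auto simp: AE_count_space)
  moreover have "lim.\<Phi> (\<lambda>_. c) u i = c * u i" for i
    using lim.\<Phi>_const[OF u, of c] by (auto simp: AE_count_space)
  ultimately show "(\<lambda>n. dev n (\<lambda>_. c) u) \<longlonglongrightarrow> 0"
    by simp
qed

lemma converges_lincomb:
  assumes "converges f" "converges g"
  shows "converges (\<lambda>t. a * f t + b * g t)"
  unfolding converges_def
proof (intro conjI ballI)
  have bb: "bounded_borel f" "bounded_borel g" using assms by (auto simp: converges_def)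
  then show "bounded_borel (\<lambda>t. a * f t + b * g t)" by (rule bounded_borel_lincomb)
  fix u :: "nat \<Rightarrow> complex" assume u: "u \<in> L2_space ell2"
  let ?d = "\<lambda>f n i. \<Phi>n n f u i - lim.\<Phi> f u i"
  have dL: "?d f n \<in> L2_space ell2" if "bounded_borel f" for f n
    using \<Phi>_L2'[OF that u] by (intro L2_diff)
  have *: "(\<lambda>n. cmod a * dev n f u + cmod b * dev n g u) \<longlonglongrightarrow> cmod a * 0 + cmod b * 0"
    using assms u by (intro tendsto_intros) (auto simp: converges_def)
  have le: "dev n (\<lambda>t. a * f t + b * g t) u \<le>
      cmod a * dev n f u + cmod b * dev n g u" for n
  proof -
    have "(\<lambda>i. \<Phi>n n (\<lambda>t. a * f t + b * g t) u i - lim.\<Phi> (\<lambda>t. a * f t + b * g t) u i) =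
        (\<lambda>i. a * ?d f n i + b * ?d g n i)"
      by (simp add: \<Phi>_ell2[OF bb u] algebra_simps)
    then show ?thesis
      using nrm_triangle[OF L2_scale[OF dL[OF bb(1)]] L2_scale[OF dL[OF bb(2)]], of a n b n]
      by (simp only: nrm_scale)
  qed
  show "(\<lambda>n. dev n (\<lambda>t. a * f t + b * g t) u) \<longlonglongrightarrow> 0"
    by (rule tendsto_sandwich[where f = "\<lambda>_. 0" and h = "\<lambda>n. cmod a * dev n f u + cmod b * dev n g u"])
      (use le * in auto)
qed

text \<open>
  Write \<open>f(A\<^sub>n) g(A\<^sub>n) u - f(A) g(A) u\<close> as \<open>f(A\<^sub>n) (g(A\<^sub>n) u - g(A) u)\<close> plus
  \<open>(f(A\<^sub>n) - f(A)) g(A) u\<close>; the operators \<open>f(A\<^sub>n)\<close> are uniformly bounded.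
\<close>
lemma converges_mult:
  assumes "converges f" "converges g"
  shows "converges (\<lambda>t. f t * g t)"
  unfolding converges_def
proof (intro conjI ballI)
  have bb: "bounded_borel f" "bounded_borel g" using assms by (auto simp: converges_def)
  then show "bounded_borel (\<lambda>t. f t * g t)" by (rule bounded_borel_mult)
  obtain C where C: "f \<in> borel_measurable borel" "\<And>t. cmod (f t) \<le> C" "0 \<le> C"
    by (rule bounded_borelE[OF bb(1)]) blast
  fix u :: "nat \<Rightarrow> complex" assume u: "u \<in> L2_space ell2"
  let ?v = "lim.\<Phi> g u"
  have v: "?v \<in> L2_space ell2" by (rule \<Phi>_L2'(1)[OF bb(2) u])
  let ?p = "\<lambda>n i. \<Phi>n n g u i - ?v i" and ?q = "\<lambda>n i. \<Phi>n n f ?v i - lim.\<Phi> f ?v i"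
  have pL: "?p n \<in> L2_space ell2" and gL: "\<Phi>n n g u \<in> L2_space ell2" for n
    using \<Phi>_L2'[OF bb(2) u] by (auto intro: L2_diff)
  have qL: "?q n \<in> L2_space ell2" for n
    using \<Phi>_L2'[OF bb(1) v] by (auto intro: L2_diff)
  have *: "(\<lambda>n. C * nrm ell2 (?p n) + nrm ell2 (?q n)) \<longlonglongrightarrow> C * 0 + 0"
    using assms u v by (intro tendsto_intros) (auto simp: converges_def)
  have le: "dev n (\<lambda>t. f t * g t) u \<le>
      C * nrm ell2 (?p n) + nrm ell2 (?q n)" for n
  proof -
    have "(\<lambda>i. \<Phi>n n (\<lambda>t. f t * g t) u i - lim.\<Phi> (\<lambda>t. f t * g t) u i) =
        (\<lambda>i. \<Phi>n n f (?p n) i + ?q n i)"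
      by (simp add: \<Phi>_ell2[OF bb u] \<Phi>n_diff[OF bb(1) gL v])
    then have "dev n (\<lambda>t. f t * g t) u \<le>
        nrm ell2 (\<Phi>n n f (?p n)) + nrm ell2 (?q n)"
      using nrm_triangle[OF \<Phi>_L2'(2)[OF bb(1) pL] qL] by simp
    also have "nrm ell2 (\<Phi>n n f (?p n)) \<le> C * nrm ell2 (?p n)"
      by (rule \<Phi>n_bound[OF C(1,2) pL])
    finally show ?thesis by simp
  qed
  show "(\<lambda>n. dev n (\<lambda>t. f t * g t) u) \<longlonglongrightarrow> 0"
    by (rule tendsto_sandwich[where f = "\<lambda>_. 0" and h = "\<lambda>n. C * nrm ell2 (?p n) + nrm ell2 (?q n)"])
      (use le * in auto)
qed

text \<open>
  The error of \<open>f\<close> is at most that of \<open>g\<close> plus the contributions of \<open>f - g\<close>, which need only be small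
  for the given \<open>u\<close> and for large \<open>n\<close>.
\<close>
lemma converges_approx:
  assumes f: "bounded_borel f" and u: "u \<in> L2_space ell2"
    and approx: "\<And>e. 0 < e \<Longrightarrow> \<exists>g. converges g \<and>
      (\<forall>\<^sub>F n in sequentially. nrm ell2 (\<Phi>n n (\<lambda>t. 1 * f t + (- 1) * g t) u) < e) \<and>
      nrm ell2 (lim.\<Phi> (\<lambda>t. 1 * f t + (- 1) * g t) u) < e"
  shows "(\<lambda>n. dev n f u) \<longlonglongrightarrow> 0"
proof (rule tendstoI)
  fix e :: real assume "0 < e"
  then obtain g where g: "converges g"
    "\<forall>\<^sub>F n in sequentially. nrm ell2 (\<Phi>n n (\<lambda>t. 1 * f t + (- 1) * g t) u) < e / 3"
    "nrm ell2 (lim.\<Phi> (\<lambda>t. 1 * f t + (- 1) * g t) u) < e / 3"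
    using approx[of "e / 3"] by auto
  have bg: "bounded_borel g" using g(1) by (simp add: converges_def)
  let ?r = "\<lambda>t. 1 * f t + (- 1) * g t"
  have br: "bounded_borel ?r" by (rule bounded_borel_lincomb[OF f bg])
  note L = \<Phi>_L2'[OF f u] \<Phi>_L2'[OF bg u] \<Phi>_L2'[OF br u]
  have "(\<lambda>n. dev n g u) \<longlonglongrightarrow> 0"
    using g(1) u by (simp add: converges_def)
  then have "\<forall>\<^sub>F n in sequentially. dev n g u < e / 3"
    using \<open>0 < e\<close> by (intro order_tendstoD) auto
  with g(2) show "\<forall>\<^sub>F n in sequentially. dist (dev n f u) 0 < e"
  proof eventually_elim
    case (elim n)
    have "(\<lambda>i. \<Phi>n n f u i - lim.\<Phi> f u i) =
        (\<lambda>i. (\<Phi>n n g u i - lim.\<Phi> g u i) + (\<Phi>n n ?r u i - lim.\<Phi> ?r u i))"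
      by (simp only: \<Phi>_ell2[OF f bg u]) (simp add: algebra_simps)
    moreover have "nrm ell2 (\<lambda>i. (\<Phi>n n g u i - lim.\<Phi> g u i) + (\<Phi>n n ?r u i - lim.\<Phi> ?r u i)) \<le>
        dev n g u + dev n ?r u"
      by (rule nrm_triangle[OF L2_diff[OF L(4,3)] L2_diff[OF L(6,5)]])
    moreover have "dev n ?r u \<le>
        nrm ell2 (\<Phi>n n ?r u) + nrm ell2 (lim.\<Phi> ?r u)"
      using nrm_triangle_diff[OF L(6) L2_zero L(5)] nrm_minus_commute[of ell2 "\<lambda>_. 0" "lim.\<Phi> ?r u"]
      by (simp only: diff_zero)
    ultimately show ?case
      using elim g(3) nrm_nonneg[of ell2 "\<lambda>i. \<Phi>n n f u i - lim.\<Phi> f u i"]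
      by (simp only: dist_real_def diff_zero abs_of_nonneg)
  qed
qed

lemma converges_uniform_limit:
  assumes f: "bounded_borel f"
    and approx: "\<And>e. 0 < e \<Longrightarrow> \<exists>g. converges g \<and> (\<forall>t. cmod (f t - g t) \<le> e)"
  shows "converges f"
  unfolding converges_def
proof (intro conjI ballI f)
  fix u :: "nat \<Rightarrow> complex" assume u: "u \<in> L2_space ell2"
  show "(\<lambda>n. dev n f u) \<longlonglongrightarrow> 0"
  proof (rule converges_approx[OF f u])
    fix e :: real assume "0 < e"
    \<comment> \<open>The summand 1 avoids division by zero and makes the estimate strict.\<close>
    define e' where "e' = e / (nrm ell2 u + 1)"
    have n: "0 < nrm ell2 u + 1" using nrm_nonneg[of ell2 u] by linarith
    have e': "0 < e'" using \<open>0 < e\<close> n by (simp add: e'_def)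
    obtain g where g: "converges g" "\<And>t. cmod (f t - g t) \<le> e'"
      using approx[OF e'] by blast
    let ?r = "\<lambda>t. 1 * f t + (- 1) * g t"
    have bg: "bounded_borel g" using g(1) by (simp add: converges_def)
    have r: "?r \<in> borel_measurable borel" "\<And>t. cmod (?r t) \<le> e'"
      using bounded_borel_lincomb[OF f bg, of 1 "- 1"] g(2) by (auto simp: bounded_borel_def)
    have "e' * nrm ell2 u < e' * (nrm ell2 u + 1)" using e' by (intro mult_strict_left_mono) auto
    also have "\<dots> = e" using n by (simp add: e'_def)
    finally have "nrm ell2 (lim.\<Phi> ?r u) < e" "\<And>n. nrm ell2 (\<Phi>n n ?r u) < e"
      using lim.nrm_\<Phi>_le[OF r u] \<Phi>n_bound[OF r u] by (meson le_less_trans)+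
    then show "\<exists>g. converges g \<and>
        (\<forall>\<^sub>F n in sequentially. nrm ell2 (\<Phi>n n (\<lambda>t. 1 * f t + (- 1) * g t) u) < e) \<and>
        nrm ell2 (lim.\<Phi> (\<lambda>t. 1 * f t + (- 1) * g t) u) < e"
      using g(1) by (intro exI[of _ g]) simp
  qed
qed

text \<open>
  Partial fractions with the poles \<open>\<i>\<close> and \<open>-\<i>\<close>. The point \<open>(1 / (1 + t\<^sup>2), t / (1 + t\<^sup>2))\<close> runs through the
  circle \<open>x\<^sup>2 + y\<^sup>2 = x\<close>, on which the missing point \<open>(0, 0)\<close> stands for \<open>t = \<plusminus>\<infinity>\<close>.
\<close>
lemma converges_circle:
  "converges (\<lambda>t. complex_of_real (1 / (1 + t\<^sup>2)))" "converges (\<lambda>t. complex_of_real (t / (1 + t\<^sup>2)))"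
proof -
  have r: "converges (lim.\<rho> \<i>)" "converges (lim.\<rho> (- \<i>))"
    by (rule converges_resolvent, simp)+
  have ne: "complex_of_real t - \<i> \<noteq> 0" "complex_of_real t + \<i> \<noteq> 0" for t
    by (auto simp: complex_eq_iff)
  have eq: "complex_of_real (1 + t\<^sup>2) = (complex_of_real t - \<i>) * (complex_of_real t + \<i>)" for t
    by (simp add: algebra_simps power2_eq_square)
  have c: "1 / (a * b) = 1 / (2 * \<i>) * (1 / a) + (- 1 / (2 * \<i>)) * (1 / b)"
    if "a \<noteq> 0" "b \<noteq> 0" "b - a = 2 * \<i>" for a b :: complex
  proof -
    have "- 1 / (2 * \<i>) = - (1 / (2 * \<i>))" by simp
    then have "1 / (2 * \<i>) * (1 / a) + (- 1 / (2 * \<i>)) * (1 / b) = 1 / (2 * \<i>) * (1 / a - 1 / b)"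
      by (simp only: right_diff_distrib mult_minus_left add_uminus_conv_diff)
    also have "1 / a - 1 / b = 2 * \<i> / (a * b)"
      using that by (simp add: diff_frac_eq)
    finally show ?thesis by simp
  qed
  have s: "x / (a * b) = 1 / 2 * (1 / a) + 1 / 2 * (1 / b)"
    if "a \<noteq> 0" "b \<noteq> 0" "a + b = 2 * x" for a b x :: complex
    using that by (simp add: divide_simps) (simp add: algebra_simps)
  have c': "complex_of_real (1 / (1 + t\<^sup>2)) = 1 / (2 * \<i>) * lim.\<rho> \<i> t + (- 1 / (2 * \<i>)) * lim.\<rho> (- \<i>) t" for t
    unfolding of_real_divide eq lim.\<rho>_def using c[OF ne[of t]] by simp
  show "converges (\<lambda>t. complex_of_real (1 / (1 + t\<^sup>2)))"
    unfolding c' by (rule converges_lincomb[OF r])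
  have s': "complex_of_real (t / (1 + t\<^sup>2)) = 1 / 2 * lim.\<rho> \<i> t + 1 / 2 * lim.\<rho> (- \<i>) t" for t
    unfolding of_real_divide eq lim.\<rho>_def using s[OF ne[of t], of "complex_of_real t"] by simp
  show "converges (\<lambda>t. complex_of_real (t / (1 + t\<^sup>2)))"
    unfolding s' by (rule converges_lincomb[OF r])
qed

lemma converges_polynomial:
  fixes p :: "real \<times> real \<Rightarrow> real"
  assumes "real_polynomial_function p"
  shows "converges (\<lambda>t. complex_of_real (p (1 / (1 + t\<^sup>2), t / (1 + t\<^sup>2))))"
  using assms
proof induction
  case (linear p)
  then interpret bounded_linear p .
  have "p (x, y) = x * p (1, 0) + y * p (0, 1)" for x y
    using add[of "x *\<^sub>R (1, 0)" "y *\<^sub>R (0, 1)"] by (simp add: scaleR[of _ "(1, 0)"] scaleR[of _ "(0, 1)"] del: scaleR_Pair) simp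
  then have lin: "complex_of_real (p (x, y)) =
      complex_of_real (p (1, 0)) * complex_of_real x + complex_of_real (p (0, 1)) * complex_of_real y" for x y
    by (metis of_real_add of_real_mult mult.commute)
  show ?case
    by (subst lin) (rule converges_lincomb[OF converges_circle])
next
  case (const c)
  show ?case by (rule converges_const)
next
  case (add f g)
  then show ?case using converges_lincomb[OF add.IH, of 1 1] by simp
next
  case (mult f g)
  then show ?case using converges_mult[OF mult.IH] by simp
qed

lemma bounded_borel_continuous:
  assumes "continuous_on UNIV f" "\<And>t. \<bar>f t\<bar> \<le> C"
  shows "bounded_borel (\<lambda>t. complex_of_real (f t))"
  unfolding bounded_borel_def using assms
  by (auto intro!: borel_measurable_continuous_onI continuous_intros exI[of _ C])

text \<open>
  Through \<open>t = y / x\<close> a continuous function of compact support becomes a continuous function on the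
  compact circle \<open>x\<^sup>2 + y\<^sup>2 = x\<close>, zero near the point at infinity, and can be approximated uniformly by
  polynomials in \<open>x\<close> and \<open>y\<close>.
\<close>
lemma converges_compact_support:
  fixes f :: "real \<Rightarrow> real"
  assumes cont: "continuous_on UNIV f" and supp: "\<And>t. R \<le> \<bar>t\<bar> \<Longrightarrow> f t = 0"
  shows "converges (\<lambda>t. complex_of_real (f t))"
proof (rule converges_uniform_limit)
  have "\<exists>C. \<forall>t\<in>{-R..R}. \<bar>f t\<bar> \<le> C"
    using compact_imp_bounded[OF compact_continuous_image[OF continuous_on_subset[OF cont] compact_Icc]]
    by (auto simp: bounded_iff)
  then obtain C where C: "\<And>t. t \<in> {-R..R} \<Longrightarrow> \<bar>f t\<bar> \<le> C" by blast
  have "\<bar>f t\<bar> \<le> max C 0" for t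
  proof (cases "t \<in> {-R..R}")
    case True
    then show ?thesis using C[of t] by simp
  next
    case False
    then have "R \<le> \<bar>t\<bar>" by auto
    then show ?thesis by (simp add: supp)
  qed
  then show "bounded_borel (\<lambda>t. complex_of_real (f t))"
    by (rule bounded_borel_continuous[OF cont])
  fix e :: real assume "0 < e"
  \<comment> \<open>At the point of the circle with parameter \<open>t\<close>, \<open>x \<le> \<delta>\<close> means \<open>t\<^sup>2 \<ge> R\<^sup>2\<close>.\<close>
  define \<delta> where "\<delta> = 1 / (1 + R\<^sup>2)"
  have pos: "0 < 1 + t\<^sup>2" for t :: real by (simp add: add_pos_nonneg)
  then have \<delta>: "0 < \<delta>" by (simp add: \<delta>_def)
  define S where "S = {p :: real \<times> real. (fst p)\<^sup>2 + (snd p)\<^sup>2 = fst p}"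
  define F where "F p = (if fst p \<le> \<delta> then 0 else f (snd p / fst p))" for p :: "real \<times> real"
  have "closed S"
    unfolding S_def by (intro closed_Collect_eq continuous_intros)
  moreover have "bounded S"
  proof (rule bounded_subset[OF bounded_cbox])
    show "S \<subseteq> cbox (-1, -1) (1, 1)"
    proof
      fix p assume "p \<in> S"
      then have *: "(fst p)\<^sup>2 + (snd p)\<^sup>2 = fst p" by (simp add: S_def)
      have "0 \<le> fst p" using * sum_power2_ge_zero[of "fst p" "snd p"] by linarith
      moreover have "fst p \<le> 1"
      proof (rule ccontr)
        assume "\<not> fst p \<le> 1"
        then have "fst p * 1 < fst p * fst p" by (intro mult_strict_left_mono) auto
        with * zero_le_power2[of "snd p"] show False by (simp only: power2_eq_square mult_1_right)
      qed
      moreover have "\<bar>snd p\<bar> \<le> 1"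
      proof -
        have "(snd p)\<^sup>2 \<le> 1"
          using * \<open>fst p \<le> 1\<close> zero_le_power2[of "fst p"] by linarith
        then show ?thesis by (simp add: abs_square_le_1)
      qed
      ultimately show "p \<in> cbox (-1, -1) (1, 1)"
        by (cases p) (auto simp: mem_box Basis_prod_def)
    qed
  qed
  ultimately have "compact S" by (simp add: compact_eq_bounded_closed)
  have "continuous_on S F"
    unfolding F_def
  proof (rule continuous_on_cases_le)
    have "continuous_on {p \<in> S. \<delta> \<le> fst p} (\<lambda>p. snd p / fst p)"
      using \<delta> by (intro continuous_intros) auto
    then show "continuous_on {p \<in> S. \<delta> \<le> fst p} (\<lambda>p. f (snd p / fst p))"
      using continuous_on_compose2[OF cont] by blast
    fix p assume "p \<in> S" and p: "fst p = \<delta>"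
    then have "(snd p)\<^sup>2 = \<delta> - \<delta>\<^sup>2" by (simp add: S_def)
    also have "\<dots> = (R * \<delta>)\<^sup>2"
      using pos[of R] by (simp add: \<delta>_def power2_eq_square divide_simps)
    finally have "R * \<delta> \<le> \<bar>snd p\<bar>"
      using abs_le_square_iff[of "R * \<delta>" "snd p"] by simp
    then have "R \<le> \<bar>snd p / fst p\<bar>"
      using \<delta> by (simp add: p abs_divide pos_le_divide_eq)
    then show "0 = f (snd p / fst p)" by (simp add: supp)
  qed (intro continuous_intros)+
  from Stone_Weierstrass_real_polynomial_function[OF \<open>compact S\<close> this \<open>0 < e\<close>]
  obtain p where p: "real_polynomial_function p" "\<And>x. x \<in> S \<Longrightarrow> \<bar>F x - p x\<bar> < e" by blast
  let ?c = "\<lambda>t. (1 / (1 + t\<^sup>2), t / (1 + t\<^sup>2)) :: real \<times> real"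
  have "?c t \<in> S" for t
    using pos[of t] by (simp add: S_def power2_eq_square divide_simps)
  moreover have "F (?c t) = f t" for t
  proof (cases "1 / (1 + t\<^sup>2) \<le> \<delta>")
    case True
    then have "R\<^sup>2 \<le> t\<^sup>2" using pos[of t] pos[of R] by (simp add: \<delta>_def divide_simps split: if_splits)
    then have "R \<le> \<bar>t\<bar>" using abs_le_square_iff[of R t] by linarith
    then show ?thesis using True by (simp add: F_def supp)
  next
    case False
    then show ?thesis using pos[of t] by (simp add: F_def)
  qed
  ultimately have "cmod (complex_of_real (f t) - complex_of_real (p (?c t))) \<le> e" for t
    using p(2)[of "?c t"] by (metis less_imp_le norm_of_real of_real_diff)
  then show "\<exists>g. converges g \<and> (\<forall>t. cmod (complex_of_real (f t) - g t) \<le> e)"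
    using converges_polynomial[OF p(1)] by blast
qed

definition cutoff :: "nat \<Rightarrow> real \<Rightarrow> real" where
  "cutoff m t = max 0 (min 1 (real m + 1 - \<bar>t\<bar>))"

lemma cutoff:
  "0 \<le> cutoff m t" "cutoff m t \<le> 1" "\<bar>t\<bar> \<le> real m \<Longrightarrow> cutoff m t = 1"
  "real m + 1 \<le> \<bar>t\<bar> \<Longrightarrow> cutoff m t = 0" "continuous_on UNIV (cutoff m)"
  unfolding cutoff_def[abs_def] by (auto intro!: continuous_intros)

text \<open>
  Dominated convergence on the diagonalizing space: at a point \<open>x\<close> the factor \<open>1 - cutoff m (h x)\<close>
  vanishes as soon as \<open>m \<ge> \<bar>h x\<bar>\<close>.
\<close>
lemma tight:
  assumes "u \<in> L2_space ell2"
  shows "(\<lambda>m. nrm ell2 (lim.\<Phi> (\<lambda>t. 1 * 1 + (- 1) * complex_of_real (cutoff m t)) u)) \<longlonglongrightarrow> 0"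
proof -
  let ?g = "\<lambda>m t. 1 * 1 + (- 1) * complex_of_real (cutoff m t)"
  have g1: "cmod (?g m t) \<le> 1" for m t
  proof -
    have "?g m t = complex_of_real (1 - cutoff m t)" by simp
    then have "cmod (?g m t) = \<bar>1 - cutoff m t\<bar>" by (simp only: norm_of_real)
    then show ?thesis using cutoff(1,2)[of m t] by linarith
  qed
  have gm: "?g m \<in> borel_measurable borel" for m
    by (intro borel_measurable_continuous_onI continuous_intros cutoff)
  have Vu: "V u \<in> L2_space N" using assms by simp
  have eq: "(nrm ell2 (lim.\<Phi> (?g m) u))\<^sup>2 = (LINT x|N. (cmod (?g m (h x) * V u x))\<^sup>2)" for m
    unfolding lim.\<Phi>_def
    by (subst lim.nrm_W[OF lim.bounded_mult_L2(1)[OF gm g1 Vu]]) (rule nrm_sq)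
  have "(\<lambda>m. LINT x|N. (cmod (?g m (h x) * V u x))\<^sup>2) \<longlonglongrightarrow> (LINT x|N. 0)"
  proof (rule integral_dominated_convergence[where w = "\<lambda>x. (cmod (V u x))\<^sup>2"])
    show "integrable N (\<lambda>x. (cmod (V u x))\<^sup>2)" by (rule L2_integrable_sq[OF Vu])
    show "(\<lambda>x. (cmod (?g m (h x) * V u x))\<^sup>2) \<in> borel_measurable N" for m
      using L2_measurable[OF lim.bounded_mult_L2(1)[OF gm g1 Vu, of m]] by measurable
    have "(\<lambda>m. (cmod (?g m (h x) * V u x))\<^sup>2) \<longlonglongrightarrow> 0" for x
    proof (rule tendsto_eventually)
      obtain K :: nat where K: "\<bar>h x\<bar> \<le> real K" using real_arch_simple by blast
      have "(cmod (?g m (h x) * V u x))\<^sup>2 = 0" if "m \<ge> K" for m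
        using K that by (simp add: cutoff(3))
      then show "\<forall>\<^sub>F m in sequentially. (cmod (?g m (h x) * V u x))\<^sup>2 = 0"
        by (rule eventually_sequentiallyI)
    qed
    then show "AE x in N. (\<lambda>m. (cmod (?g m (h x) * V u x))\<^sup>2) \<longlonglongrightarrow> 0" by simp
    have "(cmod (?g m (h x) * V u x))\<^sup>2 \<le> (cmod (V u x))\<^sup>2" for m x
    proof -
      have "cmod (?g m (h x)) * cmod (V u x) \<le> 1 * cmod (V u x)"
        by (intro mult_right_mono g1) simp
      then show ?thesis by (intro power_mono) (simp_all only: norm_mult mult_1 norm_ge_zero mult_nonneg_nonneg)
    qed
    then show "AE x in N. norm ((cmod (?g m (h x) * V u x))\<^sup>2) \<le> (cmod (V u x))\<^sup>2" for m
      by (intro AE_I2) (simp only: real_norm_def abs_of_nonneg zero_le_power2)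
  qed simp
  then have "(\<lambda>m. (nrm ell2 (lim.\<Phi> (?g m) u))\<^sup>2) \<longlonglongrightarrow> 0"
    unfolding eq by simp
  then have "(\<lambda>m. sqrt ((nrm ell2 (lim.\<Phi> (?g m) u))\<^sup>2)) \<longlonglongrightarrow> sqrt 0"
    by (rule tendsto_real_sqrt)
  then show ?thesis by (simp only: real_sqrt_abs abs_of_nonneg nrm_nonneg real_sqrt_zero)
qed

text \<open>
  The approximating function is \<open>f \<kappa>\<close> with \<open>\<kappa> = cutoff m\<close>. Since \<open>\<parallel>(f - f \<kappa>)(A\<^sub>n) u\<parallel> \<le> C \<parallel>(1 - \<kappa>)(A\<^sub>n) u\<parallel>\<close>
  and \<open>1 - \<kappa>\<close> is itself a function for which convergence is known, the bound for the limit operator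
  passes to all large \<open>n\<close>.
\<close>
theorem converges_bounded_continuous:
  fixes f :: "real \<Rightarrow> real"
  assumes cont: "continuous_on UNIV f" and "bounded (range f)"
  shows "converges (\<lambda>t. complex_of_real (f t))"
proof -
  obtain C where C: "\<And>t. \<bar>f t\<bar> \<le> C" using assms(2) by (auto simp: bounded_iff)
  have C0: "0 \<le> C" using C[of 0] by linarith
  let ?f = "\<lambda>t. complex_of_real (f t)"
  have bf: "bounded_borel ?f" by (rule bounded_borel_continuous[OF cont C])
  have fb: "?f \<in> borel_measurable borel" "\<And>t. cmod (?f t) \<le> C"
    using bf C by (auto simp: bounded_borel_def)
  show ?thesis
    unfolding converges_def
  proof (intro conjI ballI bf)
    fix u :: "nat \<Rightarrow> complex" assume u: "u \<in> L2_space ell2"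
    show "(\<lambda>n. dev n ?f u) \<longlonglongrightarrow> 0"
    proof (rule converges_approx[OF bf u])
      fix e :: real assume "0 < e"
      let ?g = "\<lambda>m t. 1 * 1 + (- 1) * complex_of_real (cutoff m t)"
      have k: "converges (\<lambda>t. complex_of_real (cutoff m t))" for m
        by (rule converges_compact_support[OF cutoff(5) cutoff(4)])
      have g: "converges (?g m)" for m
        by (rule converges_lincomb[OF converges_const k])
      then have bg: "bounded_borel (?g m)" for m by (simp add: converges_def)
      have e': "0 < e / (C + 1)" using \<open>0 < e\<close> C0 by simp
      have "\<forall>\<^sub>F m in sequentially. nrm ell2 (lim.\<Phi> (?g m) u) < e / (C + 1)"
        by (rule order_tendstoD(2)[OF tight[OF u] e'])
      then obtain m where m: "nrm ell2 (lim.\<Phi> (?g m) u) < e / (C + 1)"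
        using eventually_happens trivial_limit_sequentially by blast
      have "(\<lambda>n. dev n (?g m) u + nrm ell2 (lim.\<Phi> (?g m) u))
          \<longlonglongrightarrow> 0 + nrm ell2 (lim.\<Phi> (?g m) u)"
        using g[of m] u by (intro tendsto_add tendsto_const) (simp only: converges_def)
      then have ev: "\<forall>\<^sub>F n in sequentially. dev n (?g m) u +
          nrm ell2 (lim.\<Phi> (?g m) u) < e / (C + 1)"
        by (rule order_tendstoD) (use m in linarith)
      let ?k = "\<lambda>t. complex_of_real (f t * cutoff m t)"
      have kc: "converges ?k"
        by (rule converges_compact_support[of _ "real m + 1"])
          (use cont cutoff(4,5) in \<open>auto intro!: continuous_intros\<close>)
      have eq: "(\<lambda>t. 1 * ?f t + (- 1) * ?k t) = (\<lambda>t. ?f t * ?g m t)"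
        by (simp add: fun_eq_iff algebra_simps)
      have small: "C * x < e" if "0 \<le> x" "x < e / (C + 1)" for x
      proof -
        have "C * x \<le> (C + 1) * x" using that by (intro mult_right_mono) auto
        also have "\<dots> < e" using that(2) C0 by (simp add: pos_less_divide_eq mult.commute)
        finally show ?thesis .
      qed
      have "nrm ell2 (lim.\<Phi> (\<lambda>t. 1 * ?f t + (- 1) * ?k t) u) < e"
        unfolding eq \<Phi>_ell2(2)[OF bf bg u]
        by (rule le_less_trans[OF lim.nrm_\<Phi>_le[OF fb \<Phi>_L2'(1)[OF bg u]] small[OF nrm_nonneg m]])
      moreover have "\<forall>\<^sub>F n in sequentially. nrm ell2 (\<Phi>n n (\<lambda>t. 1 * ?f t + (- 1) * ?k t) u) < e"
        using ev
      proof eventually_elim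
        case (elim n)
        have "nrm ell2 (\<Phi>n n (?g m) u) \<le>
            dev n (?g m) u + nrm ell2 (lim.\<Phi> (?g m) u)"
          using nrm_triangle[OF L2_diff[OF \<Phi>_L2'(2)[OF bg u] \<Phi>_L2'(1)[OF bg u]] \<Phi>_L2'(1)[OF bg u], of n m m m]
          by (simp only: diff_add_cancel)
        with elim have "nrm ell2 (\<Phi>n n (?g m) u) < e / (C + 1)" by linarith
        from le_less_trans[OF \<Phi>n_bound[OF fb \<Phi>_L2'(2)[OF bg u]] small[OF nrm_nonneg this]]
        show ?case unfolding eq \<Phi>_ell2(4)[OF bf bg u] .
      qed
      ultimately show "\<exists>g. converges g \<and>
          (\<forall>\<^sub>F n in sequentially. nrm ell2 (\<Phi>n n (\<lambda>t. 1 * ?f t + (- 1) * g t) u) < e) \<and>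
          nrm ell2 (lim.\<Phi> (\<lambda>t. 1 * ?f t + (- 1) * g t) u) < e"
        using kc by blast
    qed
  qed
qed

end

section \<open>Finite sections of the matrix of a multiplication operator\<close>

text \<open>
  In row \<open>i\<close> the section \<open>A\<^sub>n\<close> with \<open>n \<ge> i\<close> pairs the full row of the infinite matrix with the truncation
  of the vector to indices up to \<open>n\<close>. Truncation changes neither the bound nor the coordinatewise
  limit, so weak convergence applies.
\<close>
lemma (in orthonormal_basis) finite_sections_weakly_closed:
  fixes g :: "'a \<Rightarrow> real"
  assumes g\<phi>: "\<And>i. (\<lambda>x. complex_of_real (g x) * \<phi> i x) \<in> L2_space M"
    and r: "strict_mono (r :: nat \<Rightarrow> nat)"
    and x: "\<And>k. x k \<in> L2_space ell2" "\<And>k. nrm ell2 (x k) \<le> C"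
    and y: "\<And>i. (\<lambda>k. x k i) \<longlonglongrightarrow> y i"
    and b: "\<And>i. (\<lambda>k. snd (mat_op UNIV (block (r k) (gmat M \<phi> g) 0)) (x k) i) \<longlonglongrightarrow> b i"
      "b \<in> L2_space ell2"
  shows "y \<in> fst (M_inf M \<phi> g) \<and> (\<forall>i. snd (M_inf M \<phi> g) y i = b i)"
proof -
  have yL: "y \<in> L2_space ell2" by (rule ell2_weak_limit(1)[OF x y])
  define a where "a i = coef (\<lambda>x. complex_of_real (g x) * \<phi> i x)" for i
  have aL: "a i \<in> L2_space ell2" for i unfolding a_def by (rule coef_ell2[OF g\<phi>])
  have G: "gmat M \<phi> g i j = cnj (a i j)" for i j
    by (simp add: a_def gmat_def coef_def ip_cnj) (simp add: ip_def mult_ac)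
  define p where "p k j = (if j \<le> r k then x k j else 0)" for k j
  have pL: "p k \<in> L2_space ell2" for k
    using ell2_truncation(1)[OF x(1)[of k], of "Suc (r k)"] by (simp add: p_def[abs_def] less_Suc_eq_le)
  have pC: "nrm ell2 (p k) \<le> C" for k
    using nrm_mono[OF x(1)[of k], of "p k"] x(2)[of k] by (simp add: p_def)
  have pl: "(\<lambda>k. p k j) \<longlonglongrightarrow> y j" for j
  proof (rule Lim_transform_eventually[OF y])
    have "p k j = x k j" if "k \<ge> j" for k
      using strict_mono_imp_increasing[OF r, of k] that by (simp add: p_def)
    then show "\<forall>\<^sub>F k in sequentially. x k j = p k j"
      by (intro eventually_sequentiallyI[of j]) simp
  qed
  have eq: "b i = ip ell2 (a i) y" for i
  proof (rule LIMSEQ_unique[OF b(1)])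
    have "snd (mat_op UNIV (block (r k) (gmat M \<phi> g) 0)) (x k) i = ip ell2 (a i) (p k)" if "k \<ge> i" for k
    proof -
      have "i \<le> r k" using strict_mono_imp_increasing[OF r, of k] that by simp
      then have "snd (mat_op UNIV (block (r k) (gmat M \<phi> g) 0)) (x k) i = (\<Sum>j\<le>r k. cnj (a i j) * p k j)"
        by (simp add: mat_op_block block_apply_def G p_def)
      also have "\<dots> = ip ell2 (a i) (p k)"
        unfolding ip_def by (rule lebesgue_integral_count_space_supported[symmetric]) (auto simp: p_def)
      finally show ?thesis .
    qed
    then have "\<forall>\<^sub>F k in sequentially. ip ell2 (a i) (p k) =
        snd (mat_op UNIV (block (r k) (gmat M \<phi> g) 0)) (x k) i"
      by (intro eventually_sequentiallyI[of i]) simp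
    then show "(\<lambda>k. snd (mat_op UNIV (block (r k) (gmat M \<phi> g) 0)) (x k) i) \<longlonglongrightarrow> ip ell2 (a i) y"
      by (rule Lim_transform_eventually[OF ell2_weak_limit(2)[OF pL pC pl aL]])
  qed
  have "(\<lambda>i. ip M (\<lambda>x. complex_of_real (g x) * \<phi> i x) (synth y)) = b"
    using ip_coef[OF g\<phi> synth(1)[OF yL]] by (simp add: eq a_def synth(2)[OF yL] fun_eq_iff)
  with mat_op_gmat[OF g\<phi>] b(2) yL show ?thesis by auto
qed

lemma hermitian_gmat: "hermitian (gmat M \<phi> g) n"
proof
  fix i j
  show "gmat M \<phi> g j i = cnj (gmat M \<phi> g i j)"
    unfolding gmat_def ip_cnj by (simp add: ip_def mult_ac)
qed

lemma eigendecomposition_exists: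
  assumes "hermitian A n" shows "\<exists>\<psi> lam. eigendecomposition A n \<psi> lam"
proof -
  interpret hermitian A n by fact
  show ?thesis
    by (rule spectral_theorem, intro exI, rule eigendecomposition.intro)
qed

lemma ip_ell2_basis_vec: "ip ell2 (basis_vec i) v = v i"
proof -
  have "ip ell2 (basis_vec i) v = (\<Sum>j\<in>{i}. cnj (basis_vec i j) * v j)"
    unfolding ip_def by (rule lebesgue_integral_count_space_supported) (auto simp: basis_vec_def)
  then show ?thesis by (simp add: basis_vec_def)
qed

lemma basis_vec_ell2: "basis_vec i \<in> L2_space ell2"
  unfolding ell2_iff by (rule summable_finite[of "{i}"]) (auto simp: basis_vec_def)

lemma diagonalization_mult_op:
  assumes "g \<in> borel_measurable M"
  shows "diagonalization M M (\<lambda>u. u) (\<lambda>u. u) g"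
    and "diagonalization.represents M M (\<lambda>u. u) (\<lambda>u. u) g (\<lambda>t. t) (mult_op M g)"
proof -
  show d: "diagonalization M M (\<lambda>u. u) (\<lambda>u. u) g"
    by unfold_locales (use assms in auto)
  show "diagonalization.represents M M (\<lambda>u. u) (\<lambda>u. u) g (\<lambda>t. t) (mult_op M g)"
    unfolding diagonalization.represents_def[OF d] by (auto simp: mult_op_def)
qed

context orthonormal_basis begin

context
  fixes g :: "'a \<Rightarrow> real" and f :: "real \<Rightarrow> real"
  assumes g: "g \<in> borel_measurable M"
    and g\<phi>: "\<And>i. (\<lambda>x. complex_of_real (g x) * \<phi> i x) \<in> L2_space M"
    and sa: "self_adjoint ell2 (M_inf M \<phi> g)"
    and f: "continuous_on UNIV f" "bounded (range f)"
begin

abbreviation (input) "G \<equiv> gmat M \<phi> g"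
abbreviation (input) "fM n \<equiv> op_fun (Cvec n) (M_fin M \<phi> g n) f"
abbreviation (input) "fS n \<equiv> op_fun ell2 (mat_op UNIV (block n G 0)) f"
abbreviation (input) "fA \<equiv> op_fun ell2 (M_inf M \<phi> g) f"

lemma f_borel: "f \<in> borel_measurable borel"
  by (intro borel_measurable_continuous_onI f)

lemma block_fun_eq_fun_block:
  "op_eq ell2 (mat_op UNIV (block n (matrix_of (fM n)) (complex_of_real (f 0)))) (fS n)"
proof -
  obtain \<psi> lam where "eigendecomposition G n \<psi> lam"
    using eigendecomposition_exists[OF hermitian_gmat] by blast
  then interpret eigendecomposition G n \<psi> lam .
  show ?thesis
    unfolding op_eq_def block_op_fun[OF f_borel f(2)] mat_op_block(1)
    by (auto simp: op_fun_block[OF f_borel f(2)])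
qed

lemma block_fun_eq_fun_block_zero:
  "f 0 = 0 \<Longrightarrow> op_eq ell2 (mat_op UNIV (block n (matrix_of (fM n)) 0)) (fS n)"
  using block_fun_eq_fun_block[of n] by simp

lemma fA_eq:
  "fst fA = L2_space ell2"
  "u \<in> L2_space ell2 \<Longrightarrow> snd fA u = diagonalization.\<Phi> synth coef g (\<lambda>t. complex_of_real (f t)) u"
proof -
  interpret d: diagonalization ell2 M synth coef g by (rule diagonalization_synth[OF g])
  have *: "op_eq ell2 fA (L2_space ell2, d.\<Phi> (\<lambda>t. complex_of_real (f t)))"
    by (rule d.op_fun_diagonalized(1)[OF represents_M_inf[OF g g\<phi> sa] f_borel f(2)])
  then show "fst fA = L2_space ell2" by (simp add: op_eq_def)
  show "snd fA u = d.\<Phi> (\<lambda>t. complex_of_real (f t)) u" if "u \<in> L2_space ell2"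
    using * that unfolding op_eq_def AE_ell2_iff by auto
qed

theorem fun_of_padded_sections_converges: "strong_conv ell2 fS fA"
proof -
  interpret d: diagonalization ell2 M synth coef g by (rule diagonalization_synth[OF g])
  have "\<exists>\<psi> lam. eigendecomposition G n \<psi> lam" for n
    by (rule eigendecomposition_exists[OF hermitian_gmat])
  then obtain \<psi> lam where ed: "\<And>n. eigendecomposition G n (\<psi> n) (lam n)" by metis
  let ?V = "\<lambda>n. eigendecomposition.V n (\<psi> n)" and ?W = "\<lambda>n. eigendecomposition.W n (\<psi> n)"
    and ?h = "\<lambda>n. eigendecomposition.h n (lam n)"
  interpret weakly_closed_limit M synth coef g "\<lambda>_. ell2" ?V ?W ?h
      "\<lambda>n. mat_op UNIV (block n G 0)" "M_inf M \<phi> g"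
  proof (intro weakly_closed_limit.intro weakly_closed_limit_axioms.intro d.diagonalization_axioms)
    show "diagonalization ell2 ell2 (?V n) (?W n) (?h n)" for n
      by (rule eigendecomposition.diagonalization[OF ed]) simp
    show "diagonalization.represents ell2 ell2 (?V n) (?W n) (?h n) (\<lambda>t. t) (mat_op UNIV (block n G 0))" for n
      by (rule eigendecomposition.represents_block[OF ed])
    show "d.represents (\<lambda>t. t) (M_inf M \<phi> g)"
      by (rule represents_M_inf[OF g g\<phi> sa])
    show "y \<in> fst (M_inf M \<phi> g) \<and> (\<forall>i. snd (M_inf M \<phi> g) y i = b i)"
      if "strict_mono r" "\<And>k. x k \<in> L2_space ell2" "\<And>k. nrm ell2 (x k) \<le> C"
        "\<And>i. (\<lambda>k. x k i) \<longlonglongrightarrow> y i"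
        "\<And>i. (\<lambda>k. snd (mat_op UNIV (block (r k) G 0)) (x k) i) \<longlonglongrightarrow> b i"
        "b \<in> L2_space ell2" for r x C y b
      by (rule finite_sections_weakly_closed[OF g\<phi> that])
  qed
  have "converges (\<lambda>t. complex_of_real (f t))"
    by (rule converges_bounded_continuous[OF f])
  moreover have "snd (fS n) u = \<Phi>n n (\<lambda>t. complex_of_real (f t)) u" if "u \<in> L2_space ell2" for n u
    using that by (simp add: eigendecomposition.op_fun_block(2)[OF ed f_borel f(2)]
        eigendecomposition.\<Phi>_eq[OF ed])
  ultimately show ?thesis
    by (simp add: strong_conv_def fA_eq converges_def eigendecomposition.op_fun_block(1)[OF ed f_borel f(2)])
qed

text \<open>
  Padding \<open>f(M\<^sub>n)\<close> with zeros differs from applying \<open>f\<close> to the padded matrix by \<open>f 0\<close> times the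
  projection to the coordinates above \<open>n\<close>, which tends to zero strongly.
\<close>
theorem padded_fun_of_sections_converges:
  "strong_conv ell2 (\<lambda>n. mat_op UNIV (block n (matrix_of (fM n)) 0)) fA"
  unfolding strong_conv_def
proof (intro conjI allI ballI)
  show "fst (mat_op UNIV (block n (matrix_of (fM n)) 0)) = L2_space ell2" for n
    by (rule mat_op_block)
  show "fst fA = L2_space ell2" by (rule fA_eq)
  fix u :: "nat \<Rightarrow> complex" assume u: "u \<in> L2_space ell2"
  let ?S = "\<lambda>n. snd (fS n) u" and ?B = "\<lambda>n. snd (mat_op UNIV (block n (matrix_of (fM n)) 0)) u"
    and ?A = "snd fA u"
  have S: "(\<lambda>n. nrm ell2 (\<lambda>x. ?S n x - ?A x)) \<longlonglongrightarrow> 0" and fstS: "fst (fS n) = L2_space ell2" for n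
    using fun_of_padded_sections_converges u by (auto simp: strong_conv_def)
  let ?t = "\<lambda>n j. u j - (if j < Suc n then u j else 0)"
  \<comment> \<open>The block has \<open>n + 1\<close> rows, hence the shift by one.\<close>
  have t: "(\<lambda>n. nrm ell2 (?t n)) \<longlonglongrightarrow> 0"
    using LIMSEQ_Suc[OF ell2_truncation(2)[OF u]] .
  have tL: "?t n \<in> L2_space ell2" for n
    by (rule L2_diff[OF u ell2_truncation(1)[OF u]])
  have SB: "?B n = (\<lambda>j. ?S n j - complex_of_real (f 0) * ?t n j)" for n
  proof -
    have "snd (mat_op UNIV (block n (matrix_of (fM n)) (complex_of_real (f 0)))) u = ?S n"
      using block_fun_eq_fun_block[of n] u unfolding op_eq_def AE_ell2_iff mat_op_block(1) by auto
    then have "?S n = block_apply n (matrix_of (fM n)) (complex_of_real (f 0)) u"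
      by (simp add: mat_op_block)
    then show ?thesis
      by (auto simp: mat_op_block block_apply_def)
  qed
  have BL: "?B n \<in> L2_space ell2" for n
    by (simp add: mat_op_block block_apply_L2 u)
  have SL: "?S n \<in> L2_space ell2" for n
    using L2_add[OF BL L2_scale[OF tL, of "complex_of_real (f 0)"], of n n] by (simp add: SB)
  interpret d: diagonalization ell2 M synth coef g by (rule diagonalization_synth[OF g])
  obtain C where C: "\<And>t. \<bar>f t\<bar> \<le> C" using f(2) by (auto simp: bounded_iff)
  have AL: "?A \<in> L2_space ell2"
    unfolding fA_eq(2)[OF u] by (rule d.\<Phi>_L2[of _ C, OF _ _ u]) (use f_borel C in auto)
  have le: "nrm ell2 (\<lambda>x. ?B n x - ?A x) \<le> \<bar>f 0\<bar> * nrm ell2 (?t n) + nrm ell2 (\<lambda>x. ?S n x - ?A x)" for n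
  proof -
    have "(\<lambda>x. ?B n x - ?S n x) = (\<lambda>j. (- complex_of_real (f 0)) * ?t n j)"
      by (simp add: SB)
    then have "nrm ell2 (\<lambda>x. ?B n x - ?S n x) = \<bar>f 0\<bar> * nrm ell2 (?t n)"
      by (simp only: nrm_scale norm_minus_cancel norm_of_real)
    then show ?thesis
      using nrm_triangle_diff[OF BL[of n] SL[of n] AL] by simp
  qed
  have "(\<lambda>n. \<bar>f 0\<bar> * nrm ell2 (?t n) + nrm ell2 (\<lambda>x. ?S n x - ?A x)) \<longlonglongrightarrow> \<bar>f 0\<bar> * 0 + 0"
    by (intro tendsto_intros t S)
  then show "(\<lambda>n. nrm ell2 (\<lambda>x. ?B n x - ?A x)) \<longlonglongrightarrow> 0"
    by (intro tendsto_sandwich[where f = "\<lambda>_. 0" and g = "\<lambda>n. nrm ell2 (\<lambda>x. ?B n x - ?A x)"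
          and h = "\<lambda>n. \<bar>f 0\<bar> * nrm ell2 (?t n) + nrm ell2 (\<lambda>x. ?S n x - ?A x)"])
      (use le in auto)
qed

theorem corner_entry_converges:
  "(\<lambda>n. ip (Cvec n) (basis_vec 0) (snd (fM n) (basis_vec 0))) \<longlonglongrightarrow> ip ell2 (basis_vec 0) (snd fA (basis_vec 0))"
proof -
  let ?e = "basis_vec 0"
  let ?B = "\<lambda>n. snd (mat_op UNIV (block n (matrix_of (fM n)) 0)) ?e"
  have B: "ip (Cvec n) ?e (snd (fM n) ?e) = ?B n 0" for n
  proof -
    have "ip (Cvec n) ?e (snd (fM n) ?e) = snd (fM n) ?e 0"
      using ip_Cvec_basis_vec[of 0 n "snd (fM n) ?e"] by (metis complex_cnj_cnj ip_cnj le0)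
    then show ?thesis
      by (simp add: mat_op_block block_apply_def matrix_of_def basis_vec_def[of 0]
          if_distrib[of "\<lambda>x. _ * x"] cong: if_cong)
  qed
  have lim: "(\<lambda>n. nrm ell2 (\<lambda>x. ?B n x - snd fA ?e x)) \<longlonglongrightarrow> 0"
    using padded_fun_of_sections_converges basis_vec_ell2[of 0] unfolding strong_conv_def by blast
  interpret d: diagonalization ell2 M synth coef g by (rule diagonalization_synth[OF g])
  obtain C where C: "\<And>t. \<bar>f t\<bar> \<le> C" using f(2) by (auto simp: bounded_iff)
  have AL: "snd fA ?e \<in> L2_space ell2"
    unfolding fA_eq(2)[OF basis_vec_ell2]
    by (rule d.\<Phi>_L2[of _ C, OF _ _ basis_vec_ell2]) (use f_borel C in auto)
  have "cmod (?B n 0 - snd fA ?e 0) \<le> nrm ell2 (\<lambda>x. ?B n x - snd fA ?e x)" for n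
    by (rule ell2_coordinate_le[of "\<lambda>x. ?B n x - snd fA ?e x", OF L2_diff[OF _ AL]])
      (simp add: mat_op_block block_apply_L2 basis_vec_ell2)
  then have "(\<lambda>n. ?B n 0 - snd fA ?e 0) \<longlonglongrightarrow> 0"
    by (intro Lim_null_comparison[OF _ lim]) simp
  then show ?thesis
    unfolding B ip_ell2_basis_vec by (rule LIM_zero_cancel)
qed

text \<open>
  The basis vector \<open>e\<^sub>0\<close> is the coefficient sequence of \<open>\<phi>\<^sub>0 = 1\<close>.
\<close>
lemma corner_entry_eq:
  assumes "AE x in M. \<phi> 0 x = 1"
  shows "ip ell2 (basis_vec 0) (snd fA (basis_vec 0)) = (LINT x|M. complex_of_real (f (g x)))"
proof -
  interpret d: diagonalization ell2 M synth coef g by (rule diagonalization_synth[OF g])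
  obtain C where C: "\<And>t. \<bar>f t\<bar> \<le> C" using f(2) by (auto simp: bounded_iff)
  let ?e = "basis_vec 0"
  have coef0: "coef (\<phi> 0) = ?e"
    by (auto simp: coef_def ip_\<phi> basis_vec_def)
  have syn: "synth ?e \<in> L2_space M" "coef (synth ?e) = ?e"
    by (rule synth[OF basis_vec_ell2])+
  have "AE x in M. synth ?e x = \<phi> 0 x"
    by (rule AE_eq_if_coef_eq) (simp_all add: syn coef0)
  with assms have one: "AE x in M. synth ?e x = 1" by auto
  have "ip ell2 ?e (snd fA ?e) = (LINT x|M. complex_of_real (f (g x)) * (cnj (synth ?e x) * synth ?e x))"
    unfolding fA_eq(2)[OF basis_vec_ell2]
    by (rule d.ip_\<Phi>[of _ C, OF _ _ basis_vec_ell2 basis_vec_ell2]) (use f_borel C in auto)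
  also have "\<dots> = (LINT x|M. complex_of_real (f (g x)))"
  proof (rule integral_cong_AE)
    show "(\<lambda>x. complex_of_real (f (g x))) \<in> borel_measurable M"
      using measurable_compose[OF g f_borel] by simp
    then show "(\<lambda>x. complex_of_real (f (g x)) * (cnj (synth ?e x) * synth ?e x)) \<in> borel_measurable M"
      using borel_measurable_cnj_prod[OF L2_measurable[OF syn(1)] L2_measurable[OF syn(1)]] by simp
    show "AE x in M. complex_of_real (f (g x)) * (cnj (synth ?e x) * synth ?e x) = complex_of_real (f (g x))"
      using one by eventually_elim simp
  qed
  finally show ?thesis .
qed

end

end

lemma op_eqD: "op_eq M A B \<Longrightarrow> u \<in> fst B \<Longrightarrow> AE x in M. snd A u x = snd B u x"
  by (simp add: op_eq_def)

text \<open>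
  Multiplication operators are diagonalized by the identity map.
\<close>
lemma ip_one_fun_mult_op:
  fixes g :: "'a \<Rightarrow> real"
  assumes g: "g \<in> borel_measurable M" and f: "f \<in> borel_measurable borel" "bounded (range f)"
    and one: "(\<lambda>_. 1) \<in> L2_space M"
  shows "ip M (\<lambda>_. 1) (snd (op_fun M (mult_op M g) f) (\<lambda>_. 1)) = (LINT x|M. complex_of_real (f (g x)))"
proof -
  interpret d: diagonalization M M "\<lambda>u. u" "\<lambda>u. u" g by (rule diagonalization_mult_op[OF g])
  have "op_eq M (op_fun M (mult_op M g) f) (L2_space M, d.\<Phi> (\<lambda>t. complex_of_real (f t)))"
    by (rule d.op_fun_diagonalized(1)[OF diagonalization_mult_op(2)[OF g] f])
  from op_eqD[OF this, unfolded fst_conv snd_conv, OF one]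
  have "AE x in M. snd (op_fun M (mult_op M g) f) (\<lambda>_. 1) x = d.\<Phi> (\<lambda>t. complex_of_real (f t)) (\<lambda>_. 1) x" .
  then have ae: "AE x in M. snd (op_fun M (mult_op M g) f) (\<lambda>_. 1) x = complex_of_real (f (g x))"
    unfolding d.\<Phi>_def by simp
  have L: "snd (op_fun M (mult_op M g) f) (\<lambda>_. 1) \<in> L2_space M"
    by (rule d.op_fun_diagonalized(2)[OF diagonalization_mult_op(2)[OF g] f one])
  have "(LINT x|M. cnj 1 * snd (op_fun M (mult_op M g) f) (\<lambda>_. 1) x) = (LINT x|M. complex_of_real (f (g x)))"
    using ae L2_measurable[OF L] measurable_compose[OF g f(1)] by (intro integral_cong_AE) auto
  then show ?thesis by (simp only: ip_def)
qed

theorem theorem7: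
  fixes \<Omega> :: "(real ^ 'd) set" and w g :: "real ^ 'd \<Rightarrow> real" and f :: "real \<Rightarrow> real"
    and \<phi> :: "nat \<Rightarrow> real ^ 'd \<Rightarrow> complex"
  defines "L \<equiv> weighted \<Omega> w"
  assumes "\<Omega> \<in> sets lebesgue"
    and "w \<in> borel_measurable (lebesgue_on \<Omega>)"
    and "\<forall>x\<in>\<Omega>. 0 \<le> w x"
    and "(LINT x|lebesgue_on \<Omega>. w x) = 1"
    and "g \<in> borel_measurable (lebesgue_on \<Omega>)"
    and "orthonormal_seq L \<phi>"
    and "\<forall>x\<in>\<Omega>. \<phi> 0 x = 1"
    and "dense_in_L2 L (lin_span \<phi>)"
    and "\<forall>i. integrable (lebesgue_on \<Omega>) (\<lambda>x. (cmod (complex_of_real (g x) * \<phi> i x))\<^sup>2 * w x)"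
    and "self_adjoint ell2 (M_inf L \<phi> g)"
    and "continuous_on UNIV f"
    and "bounded (range f)"
  shows
    "(\<forall>n. op_eq ell2
        (mat_op UNIV (block n (matrix_of (op_fun (Cvec n) (M_fin L \<phi> g n) f)) (complex_of_real (f 0))))
        (op_fun ell2 (mat_op UNIV (block n (gmat L \<phi> g) 0)) f)) \<and>
     (f 0 = 0 \<longrightarrow> (\<forall>n. op_eq ell2
        (mat_op UNIV (block n (matrix_of (op_fun (Cvec n) (M_fin L \<phi> g n) f)) 0))
        (op_fun ell2 (mat_op UNIV (block n (gmat L \<phi> g) 0)) f))) \<and>
     strong_conv ell2
        (\<lambda>n. mat_op UNIV (block n (matrix_of (op_fun (Cvec n) (M_fin L \<phi> g n) f)) 0))
        (op_fun ell2 (M_inf L \<phi> g) f) \<and>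
     strong_conv ell2
        (\<lambda>n. op_fun ell2 (mat_op UNIV (block n (gmat L \<phi> g) 0)) f)
        (op_fun ell2 (M_inf L \<phi> g) f) \<and>
     (\<lambda>n. ip (Cvec n) (basis_vec 0) (snd (op_fun (Cvec n) (M_fin L \<phi> g n) f) (basis_vec 0)))
        \<longlonglongrightarrow> ip ell2 (basis_vec 0) (snd (op_fun ell2 (M_inf L \<phi> g) f) (basis_vec 0)) \<and>
     ip ell2 (basis_vec 0) (snd (op_fun ell2 (M_inf L \<phi> g) f) (basis_vec 0)) =
        ip L (\<lambda>x. 1) (snd (op_fun L (mult_op L g) f) (\<lambda>x. 1)) \<and>
     ip L (\<lambda>x. 1) (snd (op_fun L (mult_op L g) f) (\<lambda>x. 1)) =
        complex_of_real (LINT x|lebesgue_on \<Omega>. f (g x) * w x)"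
proof -
  note \<Omega> = assms(2) and w = assms(3) and w_nonneg = assms(4) and w_int = assms(5) and g = assms(6)
    and on = assms(7) and \<phi>0 = assms(8) and dense = assms(9) and g\<phi> = assms(10)
    and sa = assms(11) and f = assms(12,13)
  have space: "space (lebesgue_on \<Omega>) = \<Omega>" by simp
  have w0: "AE x in lebesgue_on \<Omega>. 0 \<le> w x"
    using w_nonneg by (intro AE_I2) simp
  have spaceL: "space L = \<Omega>" by (simp add: L_def weighted_def)
  have meas: "F \<in> borel_measurable L \<longleftrightarrow> F \<in> borel_measurable (lebesgue_on \<Omega>)" for F :: "real ^ 'd \<Rightarrow> 'e::topological_space"
    by (simp add: L_def weighted_def)
  have gL: "g \<in> borel_measurable L" using g by (simp add: meas)
  have \<phi>L: "\<phi> i \<in> L2_space L" for i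
    using on by (auto simp: orthonormal_seq_def)
  have g\<phi>L: "(\<lambda>x. complex_of_real (g x) * \<phi> i x) \<in> L2_space L" for i
  proof (rule L2_spaceI)
    show m: "(\<lambda>x. complex_of_real (g x) * \<phi> i x) \<in> borel_measurable L"
      using gL L2_measurable[OF \<phi>L] by simp
    then have "(\<lambda>x. (cmod (complex_of_real (g x) * \<phi> i x))\<^sup>2) \<in> borel_measurable (lebesgue_on \<Omega>)"
      by (simp add: meas)
    then show "integrable L (\<lambda>x. (cmod (complex_of_real (g x) * \<phi> i x))\<^sup>2)"
      unfolding L_def weighted_def using g\<phi>[rule_format, of i]
      by (subst integrable_density[OF _ w w0]) (simp_all add: mult.commute)
  qed
  interpret orthonormal_basis L \<phi>
    by unfold_locales (use on dense in \<open>auto simp: orthonormal_seq_def\<close>)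
  have one_eq: "AE x in L. \<phi> 0 x = 1"
    using \<phi>0 by (intro AE_I2) (simp add: spaceL)
  have one: "(\<lambda>_. 1) \<in> L2_space L"
    by (rule L2_cong_AE[OF \<phi>L[of 0] one_eq]) simp
  have f_borel: "f \<in> borel_measurable borel"
    by (intro borel_measurable_continuous_onI f)
  have fg: "(\<lambda>x. f (g x)) \<in> borel_measurable (lebesgue_on \<Omega>)"
    by (rule measurable_compose[OF g f_borel])
  have "(LINT x|L. f (g x)) = (LINT x|lebesgue_on \<Omega>. f (g x) * w x)"
    unfolding L_def weighted_def by (subst integral_density[OF fg w w0]) (simp add: mult.commute)
  then have int: "(LINT x|L. complex_of_real (f (g x))) = complex_of_real (LINT x|lebesgue_on \<Omega>. f (g x) * w x)"
    by (simp only: integral_complex_of_real)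
  note ctx = gL g\<phi>L sa f
  have corner: "ip ell2 (basis_vec 0) (snd (op_fun ell2 (M_inf L \<phi> g) f) (basis_vec 0)) =
      (LINT x|L. complex_of_real (f (g x)))"
    by (rule corner_entry_eq[OF ctx one_eq])
  have mult: "ip L (\<lambda>x. 1) (snd (op_fun L (mult_op L g) f) (\<lambda>x. 1)) = (LINT x|L. complex_of_real (f (g x)))"
    by (rule ip_one_fun_mult_op[OF gL f_borel f(2) one])
  show ?thesis
    by (intro conjI allI impI block_fun_eq_fun_block[OF ctx] block_fun_eq_fun_block_zero[OF ctx]
        padded_fun_of_sections_converges[OF ctx] fun_of_padded_sections_converges[OF ctx]
        corner_entry_converges[OF ctx] trans[OF corner mult[symmetric]] trans[OF mult int])
qed

end
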